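(* Let $s\in\mathbb{R}$ be given, and assume that $\partial_x\mathcal{A}\psi_k=i\lambda_k\psi_k$ with $\lambda_k=k\,a(k)$ for all $k\in\mathbb{Z}$. Assume moreover that one of the following two sets of conditions holds. (I) There is $n_0\in\mathbb{N}$ with $m(k_1)\le n_0$ for all $k_1\in\mathbb{Z}$; there is $k_1^*\in\mathbb{N}$ with $m(k_1)=1$ for all $|k_1|\ge k_1^*$; and, for an index set $\mathbb{I}\subseteq\mathbb{Z}$ containing exactly one index from each class $I(k)$, $$\inf_{\substack{k,n\in\mathbb{I}\\k\neq n}}|\lambda_k-\lambda_n|>0,\qquad \gamma'=\sup_{S\subset\mathbb{I}\text{ finite}}\ \inf_{\substack{k,n\in\mathbb{I}\setminus S\\k\ne n}}|\lambda_k-\lambda_n|>0.$$ (II) There are $n_0,k_1^*\in\mathbb{N}$ with $m(k_1)\le n_0$ for all $|k_1|<k_1^*$ and $m(k_1)=2$ for all $|k_1|\ge k_1^*$; $a(-k)=-a(k)$ for all $|k|\ge k_1^*$; and, for an index set $\mathbb{J}\subset\{-k_1^*+1,-k_1^*+2,\ldots\}$ containing exactly one index from each class $I(k)$, $$\inf_{\substack{k,n\in\mathbb{J}\\k\neq n}}|\lambda_k-\lambda_n|>0,\qquad \tilde\gamma'=\sup_{S\subset\mathbb{J}\text{ finite}}\ \inf_{\substack{k,n\in\mathbb{J}\setminus S\\k\ne n}}|\lambda_k-\lambda_n|>0.$$ Then there exist positive constants $M=M(g,s)$ and $\alpha=\alpha(g)$ such that for any $u_0\in H^s_p(\mathbb{T})$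 the unique solution $u$ of the closed-loop system $$\begin{cases}u\in C([0,+\infty);H^s_p(\mathbb{T})),\\ \partial_tu(t)=\partial_x\mathcal{A}u(t)-GG^*u(t)\in H^{s-r}_p(\mathbb{T}),\quad t>0,\\ u(0)=u_0,\end{cases}$$ satisfies $$\|u(\cdot,t)-\widehat{u_0}(0)\|_{H^s_p(\mathbb{T})}\le Me^{-\alpha t}\|u_0-\widehat{u_0}(0)\|_{H^s_p(\mathbb{T})}\qquad\text{for all }t\ge0.$$
   Context: Notation. $\mathbb{T}=\mathbb{R}/(2\pi\mathbb{Z})$; $\mathscr{P}=C_p^\infty(\mathbb{T})$ is the space of $2\pi$-periodic $C^\infty$ functions, $\mathscr{P}'$ the space of periodic distributions, $\langle\cdot,\cdot\rangle$ the (bilinear) pairing between $\mathscr{P}'$ and $\mathscr{P}$. For $v\in\mathscr{P}'$, $\widehat v(k)=\frac1{2\pi}\langle v,e^{-ikx}\rangle$, $k\in\mathbb{Z}$. $\psi_k(x)=e^{ikx}/\sqrt{2\pi}$. For $s\in\mathbb{R}$, $H^s_p(\mathbb{T})=\{v\in\mathscr{P}':\|v\|^2_{H^s_p(\mathbb{T})}=2\pi\sum_{k\in\mathbb{Z}}(1+|k|)^{2s}|\widehat v(k)|^2<\infty\}$. The number $\widehat{u_0}(0)$ is also regarded as a constant function. The operator $\mathcal{A}$ (fixed). $\mathcal{A}$ is a linear Fourier multiplier with real symbol $a:\mathbb{Z}\to\mathbb{R}$, i.e. $\widehat{\mathcal{A}u}(k)=a(k)\widehat u(k)$, and there are $r\ge1$,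 $k_0\ge0$ and $C>0$ with $|a(k)|\le C|k|^{r-1}$ for all $|k|\ge k_0$. Multiplicities. With $\lambda_k=k\,a(k)$, for $k_1\in\mathbb{Z}$ put $I(k_1)=\{k\in\mathbb{Z}:\lambda_k=\lambda_{k_1}\}$ and $m(k_1)=|I(k_1)|$. The operator $G$. $g\in C_p^\infty(\mathbb{T})$ is a fixed real non-negative function with $2\pi\widehat g(0)=\int_0^{2\pi}g(x)\,dx=1$, supported in $\omega$, where $\omega=\{x\in\mathbb{T}:g(x)>0\}$ is an open interval. $G(\phi)=g\phi-g\,\langle\phi,g\rangle$ for $\phi\in H^s_p(\mathbb{T})$; it is a bounded linear operator on $H^s_p(\mathbb{T})$ for every $s$. $G^*$ denotes the adjoint operator of $G$, taken with respect to $L^2_p(\mathbb{T})$ (square integrable $2\pi$-periodic functions); $G$ is self-adjoint in $L^2_p(\mathbb{T})$. *)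

theory Defs
  imports "HOL-Analysis.Analysis"
begin

section \<open>Periodic test functions and periodic distributions\<close>

text \<open>Functions on the circle are modelled as functions on the real line with period \<open>2\<pi>\<close>.\<close>

definition Dx :: "(real \<Rightarrow> complex) \<Rightarrow> real \<Rightarrow> complex" where
  "Dx \<phi> = (\<lambda>x. vector_derivative \<phi> (at x))"

definition test_functions :: "(real \<Rightarrow> complex) set"  (\<open>\<P>\<close>) where
  "\<P> = {\<phi>. (\<forall>x. \<phi> (x + 2 * pi) = \<phi> x) \<and> (\<forall>n x. (Dx ^^ n) \<phi> differentiable (at x))}"

text \<open>
  Distributions are the continuous linear functionals on \<open>\<P>\<close>.  The Frechet space \<open>\<P>\<close> is
  metrizable, so continuity is sequential continuity, where convergence in \<open>\<P>\<close> is uniform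
  convergence of all derivatives.  Functionals are extended by \<open>0\<close> outside \<open>\<P>\<close>, so that equality
  of distributions is equality in HOL and the pointwise difference \<open>u - v\<close> of functions is the
  difference of distributions.  The bilinear pairing of \<open>v\<close> and \<open>\<phi>\<close> is the application \<open>v \<phi>\<close>.
\<close>

type_synonym pdist = "(real \<Rightarrow> complex) \<Rightarrow> complex"

definition periodic_distributions :: "pdist set"  (\<open>\<P>''\<close>) where
  "\<P>' = {v. (\<forall>\<phi>. \<phi> \<notin> \<P> \<longrightarrow> v \<phi> = 0)
     \<and> (\<forall>\<phi>\<in>\<P>. \<forall>\<eta>\<in>\<P>. v (\<lambda>x. \<phi> x + \<eta> x) = v \<phi> + v \<eta>)
     \<and> (\<forall>c. \<forall>\<phi>\<in>\<P>. v (\<lambda>x. c * \<phi> x) = c * v \<phi>)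
     \<and> (\<forall>\<Phi> \<phi>. (\<forall>n. \<Phi> n \<in> \<P>) \<and> \<phi> \<in> \<P>
           \<and> (\<forall>j. uniform_limit UNIV (\<lambda>n. (Dx ^^ j) (\<Phi> n)) ((Dx ^^ j) \<phi>) sequentially)
          \<longrightarrow> (\<lambda>n. v (\<Phi> n)) \<longlonglongrightarrow> v \<phi>)}"

definition dist_of :: "(real \<Rightarrow> complex) \<Rightarrow> pdist" where
  "dist_of f = (\<lambda>\<phi>. if \<phi> \<in> \<P> then integral {0..2 * pi} (\<lambda>x. f x * \<phi> x) else 0)"

definition dist_add :: "pdist \<Rightarrow> pdist \<Rightarrow> pdist" where
  "dist_add u v = (\<lambda>\<phi>. u \<phi> + v \<phi>)"

definition dist_scale :: "complex \<Rightarrow> pdist \<Rightarrow> pdist" where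
  "dist_scale c v = (\<lambda>\<phi>. c * v \<phi>)"

definition dist_deriv :: "pdist \<Rightarrow> pdist" where
  "dist_deriv v = (\<lambda>\<phi>. if \<phi> \<in> \<P> then - v (Dx \<phi>) else 0)"

definition dist_mult :: "(real \<Rightarrow> complex) \<Rightarrow> pdist \<Rightarrow> pdist" where
  "dist_mult f v = (\<lambda>\<phi>. if \<phi> \<in> \<P> then v (\<lambda>x. f x * \<phi> x) else 0)"

definition fourier_coeff :: "pdist \<Rightarrow> int \<Rightarrow> complex" where
  "fourier_coeff v k = v (\<lambda>x. exp (- (\<i> * of_int k * of_real x))) / of_real (2 * pi)"

definition psi :: "int \<Rightarrow> real \<Rightarrow> complex" where
  "psi k x = exp (\<i> * of_int k * of_real x) / of_real (sqrt (2 * pi))"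


section \<open>Periodic Sobolev spaces\<close>

definition Hs :: "real \<Rightarrow> pdist set" where
  "Hs s = {v \<in> \<P>'. (\<lambda>k::int. (1 + \<bar>real_of_int k\<bar>) powr (2 * s) * (cmod (fourier_coeff v k))\<^sup>2)
                     summable_on UNIV}"

text \<open>Only meaningful on \<open>Hs s\<close>: the unordered sum of a non-summable family is \<open>0\<close>.\<close>

definition Hs_norm :: "real \<Rightarrow> pdist \<Rightarrow> real" where
  "Hs_norm s v = sqrt (2 * pi *
     (\<Sum>\<^sub>\<infinity>k::int. (1 + \<bar>real_of_int k\<bar>) powr (2 * s) * (cmod (fourier_coeff v k))\<^sup>2))"


section \<open>The operators\<close>

definition linear_fourier_multiplier :: "(int \<Rightarrow> real) \<Rightarrow> (pdist \<Rightarrow> pdist) \<Rightarrow> bool" where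
  "linear_fourier_multiplier a A \<longleftrightarrow>
     (\<forall>v\<in>\<P>'. A v \<in> \<P>') \<and>
     (\<forall>u\<in>\<P>'. \<forall>v\<in>\<P>'. A (dist_add u v) = dist_add (A u) (A v)) \<and>
     (\<forall>c. \<forall>v\<in>\<P>'. A (dist_scale c v) = dist_scale c (A v)) \<and>
     (\<forall>v\<in>\<P>'. \<forall>k. fourier_coeff (A v) k = of_real (a k) * fourier_coeff v k)"

definition G_op :: "(real \<Rightarrow> real) \<Rightarrow> pdist \<Rightarrow> pdist" where
  "G_op g v = (let gc = (\<lambda>x. complex_of_real (g x))
               in dist_mult gc v - dist_scale (v gc) (dist_of gc))"

text \<open>
  Adjoint with respect to the inner product of \<open>L\<^sup>2\<close>, for an operator \<open>T\<close> which maps smooth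
  functions to smooth functions.  The inner product is extended to a distribution \<open>u\<close> and a test
  function \<open>\<phi>\<close> by \<open>(u, \<phi>) = u (cnj \<circ> \<phi>)\<close>, and the adjoint is given by \<open>(T\<^sup>* u, \<phi>) = (u, T \<phi>)\<close>.
  Below, this identity is written for \<open>cnj \<circ> \<phi>\<close> in place of \<open>\<phi>\<close>, and \<open>\<eta>\<close> is the smooth function
  that represents the distribution \<open>T (cnj \<circ> \<phi>)\<close>.
\<close>

definition L2_adjoint :: "(pdist \<Rightarrow> pdist) \<Rightarrow> pdist \<Rightarrow> pdist" where
  "L2_adjoint T u = (\<lambda>\<phi>. if \<phi> \<in> \<P>
     then (let \<eta> = (THE \<eta>. \<eta> \<in> \<P> \<and> dist_of \<eta> = T (dist_of (\<lambda>x. cnj (\<phi> x))))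
           in u (\<lambda>x. cnj (\<eta> x)))
     else 0)"


section \<open>Spectral conditions\<close>

definition eig :: "(int \<Rightarrow> real) \<Rightarrow> int \<Rightarrow> real" where
  "eig a k = of_int k * a k"

definition eig_class :: "(int \<Rightarrow> real) \<Rightarrow> int \<Rightarrow> int set" where
  "eig_class a k1 = {k. eig a k = eig a k1}"

text \<open>The multiplicity lives in \<open>enat\<close>, because \<open>card\<close> of an infinite class would be \<open>0\<close>.\<close>

definition mult :: "(int \<Rightarrow> real) \<Rightarrow> int \<Rightarrow> enat" where
  "mult a k1 = (if finite (eig_class a k1) then enat (card (eig_class a k1)) else \<infinity>)"

definition index_set :: "(int \<Rightarrow> real) \<Rightarrow> int set \<Rightarrow> bool" where
  "index_set a J \<longleftrightarrow> (\<forall>k. \<exists>!j. j \<in> J \<and> j \<in> eig_class a k)"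

text \<open>Gaps are extended reals, because the asymptotic gap may be infinite.\<close>

definition gap :: "(int \<Rightarrow> real) \<Rightarrow> int set \<Rightarrow> ereal" where
  "gap a J = (INF (k, n) \<in> {(k, n). k \<in> J \<and> n \<in> J \<and> k \<noteq> n}. ereal \<bar>eig a k - eig a n\<bar>)"

definition asymptotic_gap :: "(int \<Rightarrow> real) \<Rightarrow> int set \<Rightarrow> ereal" where
  "asymptotic_gap a J = (SUP S \<in> {S. finite S \<and> S \<subseteq> J}. gap a (J - S))"

definition condition_I :: "(int \<Rightarrow> real) \<Rightarrow> bool" where
  "condition_I a \<longleftrightarrow>
     (\<exists>n0::nat. \<forall>k1. mult a k1 \<le> enat n0) \<and>
     (\<exists>k1s::nat. \<forall>k1. \<bar>k1\<bar> \<ge> int k1s \<longrightarrow> mult a k1 = 1) \<and>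
     (\<exists>J. index_set a J \<and> gap a J > 0 \<and> asymptotic_gap a J > 0)"

definition condition_II :: "(int \<Rightarrow> real) \<Rightarrow> bool" where
  "condition_II a \<longleftrightarrow> (\<exists>(n0::nat) (k1s::nat).
     (\<forall>k1. \<bar>k1\<bar> < int k1s \<longrightarrow> mult a k1 \<le> enat n0) \<and>
     (\<forall>k1. \<bar>k1\<bar> \<ge> int k1s \<longrightarrow> mult a k1 = 2) \<and>
     (\<forall>k. \<bar>k\<bar> \<ge> int k1s \<longrightarrow> a (- k) = - a k) \<and>
     (\<exists>J. J \<subseteq> {- int k1s + 1..} \<and> index_set a J \<and> gap a J > 0 \<and> asymptotic_gap a J > 0))"


section \<open>The closed-loop system\<close>

definition closed_loop_rhs :: "(pdist \<Rightarrow> pdist) \<Rightarrow> (real \<Rightarrow> real) \<Rightarrow> pdist \<Rightarrow> pdist" where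
  "closed_loop_rhs A g v = dist_deriv (A v) - G_op g (L2_adjoint (G_op g) v)"

text \<open>
  The time derivative is the limit of the difference quotients in the norm of \<open>Hs (s - r)\<close>.
  Only the values \<open>u t\<close> with \<open>t \<ge> 0\<close> matter.
\<close>

definition closed_loop_solution ::
  "(pdist \<Rightarrow> pdist) \<Rightarrow> (real \<Rightarrow> real) \<Rightarrow> real \<Rightarrow> real \<Rightarrow> pdist \<Rightarrow> (real \<Rightarrow> pdist) \<Rightarrow> bool" where
  "closed_loop_solution A g r s u0 u \<longleftrightarrow>
     (\<forall>t\<ge>0. u t \<in> Hs s) \<and>
     (\<forall>t\<ge>0. ((\<lambda>\<tau>. Hs_norm s (u \<tau> - u t)) \<longlongrightarrow> 0) (at t within {0..})) \<and>
     (\<forall>t>0. closed_loop_rhs A g (u t) \<in> Hs (s - r) \<and>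
        ((\<lambda>h. Hs_norm (s - r)
            (dist_scale (of_real (1 / h)) (u (t + h) - u t) - closed_loop_rhs A g (u t)))
         \<longlongrightarrow> 0) (at 0)) \<and>
     u 0 = u0"

end

theory Submission
  imports Defs
begin

text \<open>
  Decay in \<open>L\<^sup>2\<close> is obtained from an explicit Lyapunov function instead of an observability
  inequality in time. Let \<open>B = G G\<^sup>*\<close> have the matrix \<open>(b\<^sub>k\<^sub>j)\<close> in Fourier modes. Since distinct
  eigenvalues are uniformly separated and \<open>b\<close> decays off the diagonal, the matrix
  \<open>b\<^sub>k\<^sub>j / (i (\<lambda>\<^sub>j - \<lambda>\<^sub>k))\<close>, extended by \<open>0\<close> to pairs of equal eigenvalues, defines a bounded
  operator \<open>Q\<close>, and the derivative of \<open>(Q u, u)\<close> along the free group is \<open>(B u, u) - (D u, u)\<close> with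
  \<open>D\<close> the block-diagonal part of \<open>B\<close>. On functions of mean zero, \<open>D\<close> is coercive if \<open>G\<close> is bounded
  below on the eigenspaces: for high frequencies because these have the form
  \<open>span {e\<^sup>i\<^sup>k\<^sup>x, e\<^sup>-\<^sup>i\<^sup>k\<^sup>x}\<close>, on which \<open>G\<close> is nearly diagonal, and for the finitely many others because a
  trigonometric polynomial that is constant on an interval is constant. Hence
  \<open>N (u, u) + (Q u, u)\<close> with \<open>N\<close> large decays exponentially along the closed loop.

  The weights \<open>(R + |k|)\<^sup>s\<close> carry this over to \<open>H\<^sup>s\<close>: their commutators with \<open>B\<close> are \<open>O(1 / R)\<close>, so a
  large \<open>R = R(s)\<close> makes them a small perturbation, and the rate does not depend on \<open>s\<close>.
  Uniqueness is the decay estimate for the difference of two solutions; existence is a Picard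
  series in the interaction picture.
\<close>

section \<open>Square-summable families\<close>

text \<open>The dissipation \<open>(B u, u)\<close> is the squared norm of \<open>G u\<close>. It
  vanishes for every \<open>u\<close> that is constant where \<open>g\<close> is positive, so the
  energy alone is no strict Lyapunov function. The form \<open>(Q u, u)\<close> repairs this: its
  derivative contributes the coercive term \<open>- (D u, u)\<close> at the price of a further
  \<open>(B u, u)\<close>, which the large multiple \<open>N\<close> of the energy pays for. The
  cross terms between \<open>Q\<close> and \<open>B\<close> are harmless because
  \<open>B u = G (G u)\<close> is controlled by the norm of \<open>G u\<close>, the very quantity
  that is dissipated. The second obstacle is that the free frequencies are unbounded, so a solution
  is in general not differentiable in its own space. Energy identities are therefore derived for
  finitely many modes and integrated in time before the limit is taken. The zero mode decouples, as
  \<open>G\<close> annihilates constants and has a range of mean zero; this is why the mean of the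
  initial value is subtracted in the estimate.\<close>

typedef 'a ell2 = "{x :: 'a \<Rightarrow> complex. (\<lambda>k. (cmod (x k))\<^sup>2) summable_on UNIV}"
  morphisms coord Ell2
  by (rule exI[of _ "\<lambda>_. 0"]) simp

setup_lifting type_definition_ell2

lemma coord_sq_summable: "(\<lambda>k. (cmod (coord x k))\<^sup>2) summable_on UNIV"
  using coord by blast

lemma coord_Ell2: "(\<lambda>k. (cmod (f k))\<^sup>2) summable_on UNIV \<Longrightarrow> coord (Ell2 f) = f"
  by (simp add: Ell2_inverse)

lemma ell2_eqI: "(\<And>k. coord x k = coord y k) \<Longrightarrow> x = y"
  by (metis coord_inject ext)

lemma sq_summable_add:
  assumes "(\<lambda>k. (cmod (x k))\<^sup>2) summable_on A" "(\<lambda>k. (cmod (y k))\<^sup>2) summable_on A"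
  shows "(\<lambda>k. (cmod (x k + y k))\<^sup>2) summable_on A"
proof (rule summable_on_comparison_test)
  show "(\<lambda>k. 2 * (cmod (x k))\<^sup>2 + 2 * (cmod (y k))\<^sup>2) summable_on A"
    by (intro summable_on_add summable_on_cmult_right assms)
  fix k
  have "(cmod (x k + y k))\<^sup>2 \<le> (cmod (x k) + cmod (y k))\<^sup>2"
    by (intro power_mono norm_triangle_ineq) auto
  also have "\<dots> \<le> 2 * (cmod (x k))\<^sup>2 + 2 * (cmod (y k))\<^sup>2"
    using zero_le_power2[of "cmod (x k) - cmod (y k)"] by (simp add: power2_eq_square algebra_simps)
  finally show "(cmod (x k + y k))\<^sup>2 \<le> 2 * (cmod (x k))\<^sup>2 + 2 * (cmod (y k))\<^sup>2" .
qed auto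

lemma inner_abs_summable:
  fixes x y :: "'a \<Rightarrow> complex"
  assumes "(\<lambda>k. (cmod (x k))\<^sup>2) summable_on A" "(\<lambda>k. (cmod (y k))\<^sup>2) summable_on A"
  shows "(\<lambda>k. inner (x k) (y k)) summable_on A"
proof (rule abs_summable_summable, rule summable_on_comparison_test)
  show "(\<lambda>k. (cmod (x k))\<^sup>2 + (cmod (y k))\<^sup>2) summable_on A"
    by (intro summable_on_add assms)
  show "norm (inner (x k) (y k)) \<le> (cmod (x k))\<^sup>2 + (cmod (y k))\<^sup>2" for k
  proof -
    have "norm (inner (x k) (y k)) \<le> cmod (x k) * cmod (y k)"
      by (simp add: Cauchy_Schwarz_ineq2)
    also have "\<dots> \<le> (cmod (x k))\<^sup>2 + (cmod (y k))\<^sup>2"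
      using zero_le_power2[of "cmod (x k) - cmod (y k)"]
        mult_nonneg_nonneg[of "cmod (x k)" "cmod (y k)", OF norm_ge_zero norm_ge_zero]
      unfolding power2_diff by linarith
    finally show ?thesis .
  qed
qed auto

text \<open>\<open>inner\<close> on \<open>complex\<close> is the real part of
  \<open>x * cnj y\<close>, so this is the real part of the usual Hermitian product. A real
  structure suffices because energies and their time derivatives are real.\<close>

instantiation ell2 :: (type) real_inner
begin

lift_definition zero_ell2 :: "'a ell2" is "\<lambda>_. 0" by simp
lift_definition plus_ell2 :: "'a ell2 \<Rightarrow> 'a ell2 \<Rightarrow> 'a ell2" is "\<lambda>x y k. x k + y k"
  by (rule sq_summable_add)
lift_definition uminus_ell2 :: "'a ell2 \<Rightarrow> 'a ell2" is "\<lambda>x k. - x k" by simp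
lift_definition scaleR_ell2 :: "real \<Rightarrow> 'a ell2 \<Rightarrow> 'a ell2" is "\<lambda>c x k. c *\<^sub>R x k"
  by (simp add: power_mult_distrib summable_on_cmult_right)
definition minus_ell2 :: "'a ell2 \<Rightarrow> 'a ell2 \<Rightarrow> 'a ell2" where "minus_ell2 x y = x + - y"
definition inner_ell2 :: "'a ell2 \<Rightarrow> 'a ell2 \<Rightarrow> real" where
  "inner_ell2 x y = (\<Sum>\<^sub>\<infinity>k. inner (coord x k) (coord y k))"
definition norm_ell2 :: "'a ell2 \<Rightarrow> real" where "norm_ell2 x = sqrt (inner x x)"
definition sgn_ell2 :: "'a ell2 \<Rightarrow> 'a ell2" where "sgn_ell2 x = inverse (norm x) *\<^sub>R x"
definition dist_ell2 :: "'a ell2 \<Rightarrow> 'a ell2 \<Rightarrow> real" where "dist_ell2 x y = norm (x - y)"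
definition uniformity_ell2 :: "('a ell2 \<times> 'a ell2) filter" where
  "uniformity_ell2 = (INF e\<in>{0<..}. principal {(x, y). dist x y < e})"
definition open_ell2 :: "'a ell2 set \<Rightarrow> bool" where
  "open_ell2 U = (\<forall>x\<in>U. \<forall>\<^sub>F (x', y) in uniformity. x' = x \<longrightarrow> y \<in> U)"

lemma coord_inner_summable: "(\<lambda>k. inner (coord x k) (coord y k)) summable_on UNIV"
  by (intro inner_abs_summable coord_sq_summable)

instance
proof
  fix x y z :: "'a ell2" and a b :: real
  show "x + y + z = x + (y + z)" by transfer (simp add: algebra_simps)
  show "x + y = y + x" by transfer (simp add: algebra_simps)
  show "0 + x = x" by transfer simp
  show "- x + x = 0" by transfer simp
  show "x - y = x + - y" by (simp add: minus_ell2_def)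
  show "a *\<^sub>R (x + y) = a *\<^sub>R x + a *\<^sub>R y" by transfer (simp add: algebra_simps)
  show "(a + b) *\<^sub>R x = a *\<^sub>R x + b *\<^sub>R x" by transfer (simp add: algebra_simps)
  show "a *\<^sub>R b *\<^sub>R x = (a * b) *\<^sub>R x" by transfer (simp add: algebra_simps)
  show "1 *\<^sub>R x = x" by transfer simp
  show "dist x y = norm (x - y)" by (simp add: dist_ell2_def)
  show "sgn x = inverse (norm x) *\<^sub>R x" by (simp add: sgn_ell2_def)
  show "uniformity = (INF e\<in>{0<..}. principal {(x :: 'a ell2, y). dist x y < e})"
    by (simp add: uniformity_ell2_def)
  show "open U = (\<forall>x\<in>U. \<forall>\<^sub>F (x', y) in uniformity. x' = x \<longrightarrow> y \<in> U)" for U :: "'a ell2 set"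
    by (simp add: open_ell2_def)
  show "inner x y = inner y x" by (simp add: inner_ell2_def inner_commute)
  show "inner (x + y) z = inner x z + inner y z"
    by (simp add: inner_ell2_def plus_ell2.rep_eq inner_add_left infsum_add coord_inner_summable)
  show "inner (a *\<^sub>R x) y = a * inner x y"
    by (simp add: inner_ell2_def scaleR_ell2.rep_eq infsum_cmult_right')
  show "0 \<le> inner x x" by (simp add: inner_ell2_def infsum_nonneg)
  show "(inner x x = 0) = (x = 0)"
  proof
    assume *: "inner x x = 0"
    have "inner (coord x k) (coord x k) = 0" for k
      by (rule nonneg_infsum_le_0D[OF _ coord_inner_summable[of x x]]) (use *[unfolded inner_ell2_def] in auto)
    then have "coord x k = 0" for k by simp
    then show "x = 0" by (intro ell2_eqI) (simp add: zero_ell2.rep_eq)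
  qed (simp add: inner_ell2_def zero_ell2.rep_eq)
  show "norm x = sqrt (inner x x)" by (simp add: norm_ell2_def)
qed

end

lemma coord_simps [simp]:
  "coord 0 k = 0" "coord (x + y) k = coord x k + coord y k" "coord (- x) k = - coord x k"
  "coord (x - y) k = coord x k - coord y k" "coord (c *\<^sub>R x) k = c *\<^sub>R coord x k"
  by (simp_all add: zero_ell2.rep_eq plus_ell2.rep_eq uminus_ell2.rep_eq scaleR_ell2.rep_eq
      diff_conv_add_uminus del: add_uminus_conv_diff)

lemma norm_ell2_sq: "(norm x)\<^sup>2 = (\<Sum>\<^sub>\<infinity>k. (cmod (coord x k))\<^sup>2)"
  by (simp add: power2_norm_eq_inner inner_ell2_def)

lemma has_sum_norm_ell2: "((\<lambda>k. (cmod (coord x k))\<^sup>2) has_sum (norm x)\<^sup>2) UNIV"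
  by (simp add: norm_ell2_sq coord_sq_summable)

lemma sum_coord_le: "finite F \<Longrightarrow> (\<Sum>k\<in>F. (cmod (coord x k))\<^sup>2) \<le> (norm x)\<^sup>2"
  unfolding norm_ell2_sq by (intro finite_sum_le_infsum coord_sq_summable) auto

lemma norm_coord_le: "cmod (coord x k) \<le> norm x"
  using sum_coord_le[of "{k}" x] power2_le_imp_le by fastforce

lemma bounded_linear_coord: "bounded_linear (\<lambda>x. coord x k)"
  by (rule bounded_linear_intro[of _ 1]) (simp_all add: norm_coord_le)

lemmas continuous_on_coord = bounded_linear.continuous_on[OF bounded_linear_coord]

text \<open>Finite sums decide both membership and norm. This is the entry point for vectors given
  by a formula, as \<open>Ell2\<close> has no meaning for other families.\<close>

lemma sq_summable_norm_leI:
  assumes "\<And>F. finite F \<Longrightarrow> (\<Sum>k\<in>F. (cmod (f k))\<^sup>2) \<le> C\<^sup>2" "C \<ge> 0"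
  shows "(\<lambda>k. (cmod (f k))\<^sup>2) summable_on UNIV" "norm (Ell2 f) \<le> C"
proof -
  show *: "(\<lambda>k. (cmod (f k))\<^sup>2) summable_on UNIV"
    by (rule nonneg_bdd_above_summable_on) (use assms in \<open>auto intro!: bdd_aboveI\<close>)
  have "(norm (Ell2 f))\<^sup>2 \<le> C\<^sup>2"
    unfolding norm_ell2_sq coord_Ell2[OF *] by (rule infsum_le_finite_sums[OF *]) (use assms in auto)
  then show "norm (Ell2 f) \<le> C" using assms(2) power2_le_imp_le by blast
qed

text \<open>The coordinatewise limit is the limit in norm: the Cauchy bound holds on every finite
  set of coordinates, survives the limit there, and is uniform in the set.\<close>

instance ell2 :: (type) banach
proof
  fix X :: "nat \<Rightarrow> 'a ell2"
  assume X: "Cauchy X"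
  have "Cauchy (\<lambda>n. coord (X n) k)" for k
    by (rule bounded_linear.Cauchy[OF bounded_linear_coord X])
  then have "\<forall>k. \<exists>l. (\<lambda>n. coord (X n) k) \<longlonglongrightarrow> l"
    by (simp add: Cauchy_convergent_iff convergent_def)
  then obtain f where f: "\<And>k. (\<lambda>n. coord (X n) k) \<longlonglongrightarrow> f k"
    by (auto simp: choice_iff)
  have bound: "(\<lambda>k. (cmod (coord (X m) k - f k))\<^sup>2) summable_on UNIV \<and> norm (Ell2 (\<lambda>k. coord (X m) k - f k)) \<le> e"
    if N: "\<And>m n. m \<ge> N \<Longrightarrow> n \<ge> N \<Longrightarrow> norm (X m - X n) < e" and m: "m \<ge> N" and "e > 0" for N e m
  proof -
    have "(\<Sum>k\<in>F. (cmod (coord (X m) k - f k))\<^sup>2) \<le> e\<^sup>2" if F: "finite F" for F :: "'a set"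
    proof -
    have "(\<lambda>n. \<Sum>k\<in>F. (cmod (coord (X m) k - coord (X n) k))\<^sup>2) \<longlonglongrightarrow> (\<Sum>k\<in>F. (cmod (coord (X m) k - f k))\<^sup>2)"
      by (intro tendsto_intros f)
    moreover have "(\<Sum>k\<in>F. (cmod (coord (X m) k - coord (X n) k))\<^sup>2) \<le> e\<^sup>2" if "n \<ge> N" for n
    proof -
      have "(\<Sum>k\<in>F. (cmod (coord (X m - X n) k))\<^sup>2) \<le> (norm (X m - X n))\<^sup>2"
        by (rule sum_coord_le[OF F])
      also have "\<dots> \<le> e\<^sup>2"
        using N[OF m that] by (intro power_mono) auto
      finally show ?thesis by simp
    qed
    ultimately show "(\<Sum>k\<in>F. (cmod (coord (X m) k - f k))\<^sup>2) \<le> e\<^sup>2"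
      using LIMSEQ_le_const2 by blast
    qed
    with \<open>e > 0\<close> show ?thesis by (intro conjI sq_summable_norm_leI) auto
  qed
  define L where "L = Ell2 f"
  \<comment> \<open>\<open>f\<close> is \<open>X N\<close> minus a square-summable family, hence
    square-summable itself.\<close>
  have f_sum: "(\<lambda>k. (cmod (f k))\<^sup>2) summable_on UNIV"
  proof -
    obtain N where "\<forall>m\<ge>N. \<forall>n\<ge>N. norm (X m - X n) < 1"
      using X[unfolded Cauchy_iff] zero_less_one by blast
    then have "(\<lambda>k. (cmod (- (coord (X N) k - f k)))\<^sup>2) summable_on UNIV"
      using bound[of N 1 N] by (simp only: norm_minus_cancel)
    from sq_summable_add[OF coord_sq_summable[of "X N"] this] show ?thesis by simp
  qed
  have cL: "coord L = f" using f_sum by (simp add: L_def coord_Ell2)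
  have "X \<longlonglongrightarrow> L"
  proof (rule LIMSEQ_I)
    fix e :: real assume "e > 0"
    obtain N where N: "\<And>m n. m \<ge> N \<Longrightarrow> n \<ge> N \<Longrightarrow> norm (X m - X n) < e / 2"
      using X[unfolded Cauchy_iff] \<open>e > 0\<close> half_gt_zero by metis
    have "norm (X m - L) < e" if "m \<ge> N" for m
    proof -
      have "X m - L = Ell2 (\<lambda>k. coord (X m) k - f k)"
        using bound[OF N that] \<open>e > 0\<close> by (intro ell2_eqI) (simp add: coord_Ell2 cL)
      then show ?thesis using bound[OF N that] \<open>e > 0\<close> by simp
    qed
    then show "\<exists>N. \<forall>m\<ge>N. norm (X m - L) < e" by blast
  qed
  then show "convergent X" by (auto simp: convergent_def)
qed

section \<open>Unit vectors, truncations and their density\<close>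

definition single :: "'a \<Rightarrow> complex \<Rightarrow> 'a ell2" where
  "single j c = Ell2 (\<lambda>k. if k = j then c else 0)"

lemma coord_single [simp]: "coord (single j c) k = (if k = j then c else 0)"
proof -
  have "(\<lambda>k. (cmod (if k = j then c else 0))\<^sup>2) summable_on {j}"
    by simp
  then have "(\<lambda>k. (cmod (if k = j then c else 0))\<^sup>2) summable_on UNIV"
    by (rule summable_on_cong_neutral[THEN iffD1, rotated -1]) auto
  then show ?thesis by (simp add: single_def coord_Ell2)
qed

lemma norm_ell2_finite_support:
  assumes "finite F" "\<And>k. k \<notin> F \<Longrightarrow> coord x k = 0"
  shows "(norm x)\<^sup>2 = (\<Sum>k\<in>F. (cmod (coord x k))\<^sup>2)"
proof -
  have "(norm x)\<^sup>2 = (\<Sum>\<^sub>\<infinity>k\<in>F. (cmod (coord x k))\<^sup>2)"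
    unfolding norm_ell2_sq by (rule infsum_cong_neutral) (use assms in auto)
  with assms show ?thesis by simp
qed

lemma norm_single [simp]: "norm (single j c) = cmod c"
proof -
  have "(norm (single j c))\<^sup>2 = (cmod c)\<^sup>2" by (subst norm_ell2_finite_support[of "{j}"]) auto
  then show ?thesis by simp
qed

lemma inner_single: "inner x (single j c) = inner (coord x j) c"
proof -
  have "inner x (single j c) = (\<Sum>\<^sub>\<infinity>k\<in>{j}. inner (coord x k) (coord (single j c) k))"
    unfolding inner_ell2_def by (rule infsum_cong_neutral) auto
  then show ?thesis by simp
qed

lemma bounded_linear_single: "bounded_linear (single j)"
  by (rule bounded_linear_intro[of _ 1]) (auto intro!: ell2_eqI)

lemma coord_sum [simp]: "coord (sum f F) k = (\<Sum>i\<in>F. coord (f i) k)"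
  by (induction F rule: infinite_finite_induct) auto

definition trunc :: "'a set \<Rightarrow> 'a ell2 \<Rightarrow> 'a ell2" where
  "trunc F x = (\<Sum>k\<in>F. single k (coord x k))"

lemma coord_trunc [simp]: "finite F \<Longrightarrow> coord (trunc F x) k = (if k \<in> F then coord x k else 0)"
  by (simp add: trunc_def)

lemma norm_trunc_le: "finite F \<Longrightarrow> norm (trunc F x) \<le> norm x"
  by (rule power2_le_imp_le) (simp_all add: norm_ell2_finite_support[of F] sum_coord_le)

text \<open>By Pythagoras the squared error of a truncation is the tail of the convergent series for
  \<open>(norm x)\<^sup>2\<close>.\<close>

lemma has_sum_single: "((\<lambda>k. single k (coord x k)) has_sum x) UNIV"
  unfolding has_sum_def
proof (rule tendstoI)
  fix e :: real assume "e > 0"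
  have "\<forall>\<^sub>F F in finite_subsets_at_top UNIV. dist (\<Sum>k\<in>F. (cmod (coord x k))\<^sup>2) ((norm x)\<^sup>2) < e\<^sup>2"
    using has_sum_norm_ell2[of x] \<open>e > 0\<close> unfolding has_sum_def by (intro tendstoD) auto
  moreover have "\<forall>\<^sub>F F in finite_subsets_at_top (UNIV :: 'a set). finite F"
    by (simp add: eventually_finite_subsets_at_top_weakI)
  ultimately show "\<forall>\<^sub>F F in finite_subsets_at_top UNIV. dist (\<Sum>k\<in>F. single k (coord x k)) x < e"
  proof eventually_elim
    case (elim F)
    have *: "(norm x)\<^sup>2 = (norm (trunc F x))\<^sup>2 + (norm (x - trunc F x))\<^sup>2"
    proof -
      have "inner (trunc F x) (x - trunc F x) = 0"
        by (subst trunc_def) (simp add: inner_sum_left inner_commute[of "single _ _"] inner_single elim)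
      then show ?thesis
        using norm_add_Pythagorean[of "trunc F x" "x - trunc F x"] by (simp add: orthogonal_def)
    qed
    have "(norm (trunc F x))\<^sup>2 = (\<Sum>k\<in>F. (cmod (coord x k))\<^sup>2)"
      using elim by (simp add: norm_ell2_finite_support[of F])
    with * elim have "(norm (x - trunc F x))\<^sup>2 < e\<^sup>2"
      by (simp add: dist_real_def)
    then have "norm (x - trunc F x) < e"
      using \<open>e > 0\<close> power_less_imp_less_base by fastforce
    then show ?case by (simp add: dist_norm norm_minus_commute flip: trunc_def)
  qed
qed

text \<open>Unordered sums are limits along all finite sets. This passes to symmetric partial sums,
  the form in which the pairing of a distribution with a test function is expanded below.\<close>

lemma filterlim_symmetric_intervals:
  "filterlim (\<lambda>n. {- int n..int n}) (finite_subsets_at_top UNIV) sequentially"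
proof (rule filterlim_finite_subsets_at_top[THEN iffD2], intro allI impI)
  fix X :: "int set" assume X: "finite X \<and> X \<subseteq> UNIV"
  then obtain N where N: "\<And>k. k \<in> X \<Longrightarrow> \<bar>k\<bar> \<le> N"
    by (metis finite_imageI Max_ge imageI)
  show "\<forall>\<^sub>F n in sequentially. finite {- int n..int n} \<and> X \<subseteq> {- int n..int n} \<and> {- int n..int n} \<subseteq> UNIV"
    using eventually_ge_at_top[of "nat N"] by eventually_elim (use N in force)
qed

lemma tendsto_trunc: "(\<lambda>n. trunc {- int n..int n} x) \<longlonglongrightarrow> x"
  using filterlim_compose[OF has_sum_single[unfolded has_sum_def] filterlim_symmetric_intervals]
  by (simp add: trunc_def)

text \<open>\<open>bounded_linear\<close> is real linearity, so all complex multiples of a unit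
  vector are tested, and not just \<open>c = 1\<close>.\<close>

lemma bounded_linear_eqI:
  fixes f g :: "'a ell2 \<Rightarrow> 'b::real_normed_vector"
  assumes "bounded_linear f" "bounded_linear g" "\<And>j c. f (single j c) = g (single j c)"
  shows "f x = g x"
proof -
  have "((\<lambda>k. f (single k (coord x k))) has_sum f x) UNIV"
    "((\<lambda>k. g (single k (coord x k))) has_sum g x) UNIV"
    using has_sum_bounded_linear[OF assms(1) has_sum_single]
      has_sum_bounded_linear[OF assms(2) has_sum_single] by (simp_all add: o_def)
  with assms(3) show ?thesis by (simp add: has_sum_unique)
qed

section \<open>Operators with summable off-diagonal decay\<close>

text \<open>Convolution-dominated matrices: a summable majorant in \<open>k - j\<close> controls all
  rows and columns at once. It survives the deletion of entries and the entrywise division by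
  separated eigenvalue differences, as the Lyapunov argument requires.\<close>

definition kernel :: "(int \<Rightarrow> real) \<Rightarrow> (int \<Rightarrow> int \<Rightarrow> complex) \<Rightarrow> bool" where
  "kernel h m \<longleftrightarrow> h summable_on UNIV \<and> (\<forall>k j. cmod (m k j) \<le> h (k - j))"

definition kop :: "(int \<Rightarrow> int \<Rightarrow> complex) \<Rightarrow> int ell2 \<Rightarrow> int ell2" where
  "kop m x = Ell2 (\<lambda>k. \<Sum>\<^sub>\<infinity>j. m k j * coord x j)"

lemma bij_reflect: "bij_betw (\<lambda>l. k - l :: int) UNIV UNIV"
  by (rule bij_betwI[of _ _ _ "\<lambda>l. k - l"]) auto

lemma kernelD: "kernel h m \<Longrightarrow> h summable_on UNIV" "kernel h m \<Longrightarrow> cmod (m k j) \<le> h (k - j)"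
  by (auto simp: kernel_def)

lemma kernel_bound_nonneg: "kernel h m \<Longrightarrow> h d \<ge> 0"
  using kernelD(2)[of h m d 0] by (simp add: order_trans[OF norm_ge_zero])

text \<open>The operator is the norm-convergent sum of its diagonals \<open>k - j = d\<close>; the diagonal number
  \<open>d\<close> is a multiplication followed by a shift, hence of norm at most \<open>h d\<close>.\<close>

lemma
  assumes "kernel h m"
  shows kop_has_sum: "((\<lambda>j. m k j * coord x j) has_sum coord (kop m x) k) UNIV"
    and norm_kop_le: "norm (kop m x) \<le> infsum h UNIV * norm x"
proof -
  define T where "T d = Ell2 (\<lambda>k. m k (k - d) * coord x (k - d))" for d
  have sq: "(\<Sum>k\<in>F. (cmod (m k (k - d) * coord x (k - d)))\<^sup>2) \<le> (h d * norm x)\<^sup>2" if "finite F" for F d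
  proof -
    have "(\<Sum>k\<in>F. (cmod (m k (k - d) * coord x (k - d)))\<^sup>2) \<le> (\<Sum>k\<in>F. (h d)\<^sup>2 * (cmod (coord x (k - d)))\<^sup>2)"
    proof (rule sum_mono)
      fix k
      have "cmod (m k (k - d)) \<le> h d" using kernelD(2)[OF assms, of k "k - d"] by simp
      then show "(cmod (m k (k - d) * coord x (k - d)))\<^sup>2 \<le> (h d)\<^sup>2 * (cmod (coord x (k - d)))\<^sup>2"
        by (auto simp: norm_mult power_mult_distrib intro!: mult_right_mono power_mono)
    qed
    also have "\<dots> = (h d)\<^sup>2 * (\<Sum>k\<in>(\<lambda>k. k - d) ` F. (cmod (coord x k))\<^sup>2)"
      by (subst sum.reindex) (auto simp: sum_distrib_left inj_on_def)
    also have "\<dots> \<le> (h d * norm x)\<^sup>2"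
      unfolding power_mult_distrib using that by (intro mult_left_mono sum_coord_le) auto
    finally show ?thesis .
  qed
  have nn: "h d * norm x \<ge> 0" for d using kernel_bound_nonneg[OF assms] by simp
  have T: "coord (T d) k = m k (k - d) * coord x (k - d)" for d k
    unfolding T_def by (subst coord_Ell2[OF sq_summable_norm_leI(1)[OF sq nn]]) auto
  have Tn: "norm (T d) \<le> h d * norm x" for d
    unfolding T_def by (rule sq_summable_norm_leI(2)[OF sq nn])
  have hs: "(\<lambda>d. h d * norm x) summable_on UNIV"
    by (intro summable_on_cmult_left kernelD(1)[OF assms])
  have Ts: "(\<lambda>d. norm (T d)) summable_on UNIV"
    by (rule summable_on_comparison_test[OF hs]) (use Tn in auto)
  define S where "S = infsum T UNIV"
  have "(T has_sum S) UNIV"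
    unfolding S_def by (rule has_sum_infsum[OF abs_summable_summable[OF Ts]])
  from has_sum_bounded_linear[OF bounded_linear_coord this]
  have "((\<lambda>d. m k (k - d) * coord x (k - d)) has_sum coord S k) UNIV" for k
    by (simp add: o_def T)
  then have *: "((\<lambda>j. m k j * coord x j) has_sum coord S k) UNIV" for k
    using has_sum_reindex_bij_betw[OF bij_reflect[of k], of "\<lambda>j. m k j * coord x j" "coord S k"]
    by auto
  have "coord S = (\<lambda>k. \<Sum>\<^sub>\<infinity>j. m k j * coord x j)"
    using infsumI[OF *, symmetric] by (rule ext)
  then have S: "kop m x = S" by (metis coord_inverse kop_def)
  show "((\<lambda>j. m k j * coord x j) has_sum coord (kop m x) k) UNIV"
    using * S by simp
  have "norm S \<le> (\<Sum>\<^sub>\<infinity>d. norm (T d))"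
    unfolding S_def by (rule norm_infsum_bound[OF Ts])
  also have "\<dots> \<le> (\<Sum>\<^sub>\<infinity>d. h d * norm x)"
    by (intro infsum_mono Ts hs Tn)
  finally show "norm (kop m x) \<le> infsum h UNIV * norm x"
    by (simp add: S infsum_cmult_left')
qed

lemma coord_kop: "kernel h m \<Longrightarrow> coord (kop m x) k = (\<Sum>\<^sub>\<infinity>j. m k j * coord x j)"
  by (simp add: infsumI[OF kop_has_sum])

lemma bounded_linear_kop:
  assumes "kernel h m"
  shows "bounded_linear (kop m)"
proof (rule bounded_linear_intro)
  show "kop m (x + y) = kop m x + kop m y" for x y
  proof (rule ell2_eqI)
    fix k
    have "((\<lambda>j. m k j * coord (x + y) j) has_sum coord (kop m x) k + coord (kop m y) k) UNIV"
      using has_sum_add[OF kop_has_sum[OF assms, of k x] kop_has_sum[OF assms, of k y]]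
      by (simp add: algebra_simps)
    then show "coord (kop m (x + y)) k = coord (kop m x + kop m y) k"
      using kop_has_sum[OF assms, of k "x + y"] has_sum_unique by auto
  qed
  show "kop m (r *\<^sub>R x) = r *\<^sub>R kop m x" for r x
  proof (rule ell2_eqI)
    fix k
    have "((\<lambda>j. m k j * coord (r *\<^sub>R x) j) has_sum r *\<^sub>R coord (kop m x) k) UNIV"
      using has_sum_scaleR[OF kop_has_sum[OF assms, of k x], of r] by simp
    then show "coord (kop m (r *\<^sub>R x)) k = coord (r *\<^sub>R kop m x) k"
      using kop_has_sum[OF assms, of k "r *\<^sub>R x"] has_sum_unique by fastforce
  qed
  show "norm (kop m x) \<le> norm x * infsum h UNIV" for x
    using norm_kop_le[OF assms] by (simp add: mult.commute)
qed

lemma coord_kop_single: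
  assumes "kernel h m"
  shows "coord (kop m (single j c)) k = m k j * c"
proof -
  have "coord (kop m (single j c)) k = (\<Sum>\<^sub>\<infinity>i\<in>{j}. m k i * coord (single j c) i)"
    unfolding coord_kop[OF assms] by (rule infsum_cong_neutral) auto
  then show ?thesis by simp
qed

text \<open>On a unit vector the outer sum runs over a single column of \<open>m'\<close>, so no
  interchange of sums occurs; density does the rest. That the product is again a kernel is supplied
  later by \<open>rapid_compose\<close>.\<close>

lemma kop_compose:
  assumes "kernel h m" "kernel h' m'" "kernel h'' (\<lambda>k j. \<Sum>\<^sub>\<infinity>l. m k l * m' l j)"
  shows "kop m (kop m' x) = kop (\<lambda>k j. \<Sum>\<^sub>\<infinity>l. m k l * m' l j) x"
proof (rule bounded_linear_eqI[of "\<lambda>x. kop m (kop m' x)"])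
  show "bounded_linear (\<lambda>x. kop m (kop m' x))"
    using bounded_linear_compose[OF bounded_linear_kop[OF assms(1)] bounded_linear_kop[OF assms(2)]] .
  show "bounded_linear (kop (\<lambda>k j. \<Sum>\<^sub>\<infinity>l. m k l * m' l j))"
    by (rule bounded_linear_kop[OF assms(3)])
  show "kop m (kop m' (single j c)) = kop (\<lambda>k j. \<Sum>\<^sub>\<infinity>l. m k l * m' l j) (single j c)" for j c
    by (rule ell2_eqI, subst coord_kop[OF assms(1)])
      (simp add: coord_kop_single[OF assms(2)] coord_kop_single[OF assms(3)] mult.assoc[symmetric] infsum_cmult_left')
qed

text \<open>Density is applied in both arguments, which reduces the claim to the Hermitian symmetry
  of single entries.\<close>

lemma kop_selfadjoint:
  assumes "kernel h m" "\<And>k j. m j k = cnj (m k j)"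
  shows "inner (kop m x) y = inner x (kop m y)"
proof (rule bounded_linear_eqI[of "\<lambda>x. inner (kop m x) y" "\<lambda>x. inner x (kop m y)"])
  note kop = bounded_linear_kop[OF assms(1)]
  show "bounded_linear (\<lambda>x. inner (kop m x) y)"
    by (rule bounded_linear_compose[OF bounded_linear_inner_left kop])
  show "bounded_linear (\<lambda>x. inner x (kop m y))"
    by (rule bounded_linear_inner_left)
  show "inner (kop m (single j c)) y = inner (single j c) (kop m y)" for j c
  proof (rule bounded_linear_eqI[of "\<lambda>y. inner (kop m (single j c)) y" "\<lambda>y. inner (single j c) (kop m y)"])
    show "bounded_linear (\<lambda>y. inner (single j c) (kop m y))"
      by (rule bounded_linear_compose[OF bounded_linear_inner_right kop])
    show "inner (kop m (single j c)) (single i e) = inner (single j c) (kop m (single i e))" for i e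
      by (simp add: inner_commute[of "single j c"] inner_single coord_kop_single[OF assms(1)]
          assms(2)[of i j] inner_complex_def algebra_simps)
  qed (rule bounded_linear_inner_right)
qed

section \<open>Diagonal operators\<close>

definition dop :: "(int \<Rightarrow> complex) \<Rightarrow> int ell2 \<Rightarrow> int ell2" where
  "dop d = kop (\<lambda>k j. if k = j then d k else 0)"

lemma kernel_diag:
  assumes "\<And>k. cmod (d k) \<le> C"
  shows "kernel (\<lambda>i. if i = 0 then C else 0) (\<lambda>k j. if k = j then d k else 0)"
proof -
  have "(\<lambda>i::int. if i = 0 then C else (0::real)) summable_on {0}" by simp
  then have "(\<lambda>i::int. if i = 0 then C else 0) summable_on UNIV"
    by (rule summable_on_cong_neutral[THEN iffD1, rotated -1]) auto
  with assms show ?thesis by (auto simp: kernel_def)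
qed

lemma
  fixes d :: "int \<Rightarrow> complex" and x :: "int ell2"
  assumes "\<And>k. cmod (d k) \<le> C"
  shows coord_dop: "coord (dop d x) k = d k * coord x k"
    and bounded_linear_dop: "bounded_linear (dop d)"
    and norm_dop_le: "norm (dop d x) \<le> C * norm x"
proof -
  note k = kernel_diag[of d C, OF assms]
  have "coord (dop d x) k = (\<Sum>\<^sub>\<infinity>j\<in>{k}. (if k = j then d k else 0) * coord x j)"
    unfolding dop_def coord_kop[OF k] by (rule infsum_cong_neutral) auto
  then show "coord (dop d x) k = d k * coord x k" by simp
  show "bounded_linear (dop d)" unfolding dop_def by (rule bounded_linear_kop[OF k])
  have "infsum (\<lambda>i::int. if i = 0 then C else 0) UNIV = infsum (\<lambda>i::int. if i = 0 then C else 0) {0}"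
    by (rule infsum_cong_neutral) auto
  then show "norm (dop d x) \<le> C * norm x" using norm_kop_le[OF k, of x] by (simp add: dop_def)
qed

text \<open>A finite truncation of \<open>x0\<close> sees only finitely many symbols, and the
  uniform bound controls the rest. Pointwise convergence thus gives strong convergence, which is all
  that a group with unbounded frequencies offers.\<close>

lemma tendsto_dop:
  assumes C: "\<And>t k. cmod (d t k) \<le> C" "\<And>k. cmod (d0 k) \<le> C"
    and lim: "\<And>k. ((\<lambda>t. d t k) \<longlongrightarrow> d0 k) F"
    and x: "(x \<longlongrightarrow> x0) F"
  shows "((\<lambda>t. dop (d t) (x t)) \<longlongrightarrow> dop d0 x0) F"
proof -
  have C0: "C \<ge> 0" using C(2)[of 0] norm_ge_zero order_trans by blast
  note bl = bounded_linear_dop[of "d _", OF C(1)] bounded_linear_dop[of d0, OF C(2)]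
  have *: "((\<lambda>t. dop (d t) x0) \<longlongrightarrow> dop d0 x0) F"
  proof (rule tendstoI)
    fix e :: real assume e: "e > 0"
    \<comment> \<open>Two tails cost \<open>C * e'\<close> each and the truncated part costs
      \<open>e'\<close>; the second \<open>e'\<close> in the denominator keeps the inequality
      strict, also for \<open>C = 0\<close>.\<close>
    define e' where "e' = e / (2 * C + 2)"
    have e': "e' > 0" "2 * (C * e') + 2 * e' = e"
    proof -
      show "e' > 0" using e C0 by (simp add: e'_def)
      have "(2 * C + 2) * e' = e" using C0 by (simp add: e'_def)
      then show "2 * (C * e') + 2 * e' = e" by (simp add: algebra_simps)
    qed
    obtain n where n: "norm (trunc {- int n..int n} x0 - x0) < e'"
      using LIMSEQ_D[OF tendsto_trunc[of x0] e'(1)] by blast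
    define y where "y = trunc {- int n..int n} x0"
    have dy: "dop d y = (\<Sum>k\<in>{- int n..int n}. single k (d k * coord x0 k))" if "\<And>k. cmod (d k) \<le> C" for d
      by (intro ell2_eqI) (simp add: coord_dop[of d, OF that] y_def)
    have "((\<lambda>t. dop (d t) y) \<longlongrightarrow> dop d0 y) F"
      unfolding dy[of "d _", OF C(1)] dy[of d0, OF C(2)]
      by (intro tendsto_sum bounded_linear.tendsto[OF bounded_linear_single] tendsto_intros lim)
    then have "\<forall>\<^sub>F t in F. dist (dop (d t) y) (dop d0 y) < e'"
      using e' tendstoD by blast
    then show "\<forall>\<^sub>F t in F. dist (dop (d t) x0) (dop d0 x0) < e"
    proof eventually_elim
      case (elim t)
      have "dop (d t) x0 - dop d0 x0
          = dop (d t) (x0 - y) + (dop (d t) y - dop d0 y) + dop d0 (y - x0)"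
        by (simp add: linear_diff bounded_linear.linear bl)
      also have "norm \<dots> \<le> C * norm (x0 - y) + norm (dop (d t) y - dop d0 y) + C * norm (y - x0)"
        by (intro norm_triangle_le add_mono order.refl norm_dop_le C)
      also have "\<dots> \<le> 2 * (C * e') + e'"
        using mult_left_mono[OF less_imp_le[OF n] C0] elim
        by (simp add: y_def norm_minus_commute dist_norm)
      also have "\<dots> < e" using e' by linarith
      finally show ?case by (simp add: dist_norm)
    qed
  qed
  have "((\<lambda>t. dop (d t) (x t) - dop (d t) x0) \<longlongrightarrow> 0) F"
  proof (rule Lim_null_comparison)
    show "\<forall>\<^sub>F t in F. norm (dop (d t) (x t) - dop (d t) x0) \<le> C * norm (x t - x0)"
      by (intro always_eventually allI)
        (simp add: norm_dop_le[OF C(1)] flip: linear_diff[OF bounded_linear.linear[OF bl(1)]])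
    show "((\<lambda>t. C * norm (x t - x0)) \<longlongrightarrow> 0) F"
      using tendsto_mult_right_zero[OF tendsto_norm_zero[OF LIM_zero[OF x]]] .
  qed
  from tendsto_add[OF this *] show ?thesis by simp
qed

subsection \<open>Rapidly decaying kernels and weights\<close>

definition inv_sq :: "int \<Rightarrow> real" where "inv_sq d = 1 / (1 + \<bar>real_of_int d\<bar>)\<^sup>2"

lemma inv_sq_nonneg [simp]: "inv_sq d \<ge> 0"
  by (simp add: inv_sq_def)

lemma inv_sq_summable: "inv_sq summable_on UNIV"
proof -
  have "summable (\<lambda>n. 1 / (1 + real n)\<^sup>2)"
    using inverse_squares_sums by (simp add: sums_iff add.commute)
  then have n: "(\<lambda>n. 1 / (1 + real n)\<^sup>2) summable_on UNIV"
    by (intro norm_summable_imp_summable_on) auto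
  have "inv_sq summable_on range int"
    by (subst summable_on_reindex) (use n in \<open>auto simp: o_def inv_sq_def\<close>)
  moreover have "inv_sq summable_on range (\<lambda>n. - int n)"
    by (subst summable_on_reindex) (use n in \<open>auto simp: o_def inv_sq_def inj_on_def\<close>)
  moreover have "range int \<union> range (\<lambda>n. - int n) = UNIV"
    by (auto intro: int_cases2)
  ultimately show ?thesis using summable_on_union by metis
qed

text \<open>Every polynomial rate is demanded because conjugation by a weight of order
  \<open>s\<close> costs about \<open>\<bar>s\<bar>\<close> powers, and \<open>s\<close> is
  arbitrary.\<close>

definition rapid :: "(int \<Rightarrow> int \<Rightarrow> complex) \<Rightarrow> bool" where
  "rapid m \<longleftrightarrow> (\<forall>N::nat. \<exists>C. \<forall>k j. cmod (m k j) * (1 + \<bar>real_of_int (k - j)\<bar>) ^ N \<le> C)"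

lemma rapidE:
  assumes "rapid m"
  obtains C where "C \<ge> 0" "\<And>k j. cmod (m k j) * (1 + \<bar>real_of_int (k - j)\<bar>) ^ N \<le> C"
proof -
  obtain C where C: "\<And>k j. cmod (m k j) * (1 + \<bar>real_of_int (k - j)\<bar>) ^ N \<le> C"
    using assms unfolding rapid_def by blast
  have "0 \<le> cmod (m 0 0) * (1 + \<bar>real_of_int (0 - 0)\<bar>) ^ N" by simp
  also have "\<dots> \<le> C" by (rule C)
  finally show ?thesis using C that by blast
qed

lemma kernel_inv_sqI:
  assumes "\<And>k j. cmod (m k j) * (1 + \<bar>real_of_int (k - j)\<bar>)\<^sup>2 \<le> C"
  shows "kernel (\<lambda>d. C * inv_sq d) m"
  unfolding kernel_def inv_sq_def
proof (intro conjI allI)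
  show "(\<lambda>d. C * (1 / (1 + \<bar>real_of_int d\<bar>)\<^sup>2)) summable_on UNIV"
    using summable_on_cmult_right[OF inv_sq_summable, of C] by (simp add: inv_sq_def)
  show "cmod (m k j) \<le> C * (1 / (1 + \<bar>real_of_int (k - j)\<bar>)\<^sup>2)" for k j
    using assms[of k j] by (simp add: field_simps add_pos_nonneg)
qed

lemma rapid_kernel:
  assumes "rapid m"
  obtains C where "C \<ge> 0" "kernel (\<lambda>d. C * inv_sq d) m"
  by (rule rapidE[OF assms, of 2]) (blast intro: kernel_inv_sqI)

lemma peetre_int: "1 + \<bar>real_of_int (k - j)\<bar> \<le> (1 + \<bar>real_of_int (k - l)\<bar>) * (1 + \<bar>real_of_int (l - j)\<bar>)"
proof -
  have "1 + \<bar>real_of_int (k - j)\<bar> \<le> 1 + \<bar>real_of_int (k - l)\<bar> + \<bar>real_of_int (l - j)\<bar>" by simp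
  also have "\<dots> \<le> (1 + \<bar>real_of_int (k - l)\<bar>) * (1 + \<bar>real_of_int (l - j)\<bar>)"
    using mult_nonneg_nonneg[of "\<bar>real_of_int (k - l)\<bar>" "\<bar>real_of_int (l - j)\<bar>"]
    by (simp only: ring_distribs) simp
  finally show ?thesis .
qed

text \<open>\<open>peetre_int\<close> distributes the powers of \<open>1 + \<bar>k - j\<bar>\<close>
  over both factors; the first factor spends two more powers on the sum over
  \<open>l\<close>.\<close>

lemma rapid_compose:
  assumes "rapid m" "rapid m'"
  shows "rapid (\<lambda>k j. \<Sum>\<^sub>\<infinity>l. m k l * m' l j)"
  unfolding rapid_def
proof
  fix N :: nat
  obtain C where C: "C \<ge> 0" "\<And>k j. cmod (m k j) * (1 + \<bar>real_of_int (k - j)\<bar>) ^ (N + 2) \<le> C"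
    by (rule rapidE[OF assms(1), of "N + 2"]) blast
  obtain C' where C': "C' \<ge> 0" "\<And>k j. cmod (m' k j) * (1 + \<bar>real_of_int (k - j)\<bar>) ^ N \<le> C'"
    by (rule rapidE[OF assms(2), of N]) blast
  have "cmod (\<Sum>\<^sub>\<infinity>l. m k l * m' l j) * (1 + \<bar>real_of_int (k - j)\<bar>) ^ N \<le> C * C' * infsum inv_sq UNIV" for k j
  proof -
    define p where "p = (1 + \<bar>real_of_int (k - j)\<bar>) ^ N"
    have "p > 0" by (simp add: p_def add_pos_nonneg)
    have bound: "norm (m k l * m' l j) \<le> C * C' / p * inv_sq (k - l)" for l
    proof -
      define a b where "a = 1 + \<bar>real_of_int (k - l)\<bar>" and "b = 1 + \<bar>real_of_int (l - j)\<bar>"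
      have ab: "a > 0" "b > 0" by (simp_all add: a_def b_def add_pos_nonneg)
      have "p \<le> (a * b) ^ N"
        unfolding p_def a_def b_def by (intro power_mono peetre_int) auto
      then have "cmod (m k l * m' l j) * p * a\<^sup>2 \<le> cmod (m k l * m' l j) * (a * b) ^ N * a\<^sup>2"
        by (intro mult_right_mono mult_left_mono) auto
      also have "\<dots> = (cmod (m k l) * a ^ (N + 2)) * (cmod (m' l j) * b ^ N)"
        by (simp add: norm_mult power_add power_mult_distrib power2_eq_square)
      also have "\<dots> \<le> C * C'"
        using C(2)[of k l] C'(2)[of l j] C(1) ab unfolding a_def[symmetric] b_def[symmetric]
        by (intro mult_mono) auto
      finally show ?thesis
        using ab \<open>p > 0\<close> unfolding inv_sq_def a_def[symmetric]
        by (simp add: field_simps del: mult_le_cancel_left mult_le_cancel_right)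
    qed
    have sm: "(\<lambda>l. C * C' / p * inv_sq (k - l)) summable_on UNIV"
      using summable_on_reindex_bij_betw[OF bij_reflect, of inv_sq k] inv_sq_summable
      by (intro summable_on_cmult_right) simp
    have "cmod (\<Sum>\<^sub>\<infinity>l. m k l * m' l j) \<le> (\<Sum>\<^sub>\<infinity>l. C * C' / p * inv_sq (k - l))"
    proof (rule norm_infsum_le[OF has_sum_infsum has_sum_infsum])
      have "(\<lambda>l. norm (m k l * m' l j)) summable_on UNIV"
        by (rule summable_on_comparison_test[OF sm]) (use bound in auto)
      then show "(\<lambda>l. m k l * m' l j) summable_on UNIV" by (rule abs_summable_summable)
    qed (use sm bound in auto)
    also have "\<dots> = C * C' / p * infsum inv_sq UNIV"
      by (subst infsum_cmult_right') (simp add: infsum_reindex_bij_betw[OF bij_reflect])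
    finally have "cmod (\<Sum>\<^sub>\<infinity>l. m k l * m' l j) * p \<le> C * C' * infsum inv_sq UNIV"
      using \<open>p > 0\<close> by (simp add: field_simps)
    then show ?thesis by (simp only: p_def)
  qed
  then show "\<exists>C. \<forall>k j. cmod (\<Sum>\<^sub>\<infinity>l. m k l * m' l j) * (1 + \<bar>real_of_int (k - j)\<bar>) ^ N \<le> C"
    by blast
qed

definition weight :: "real \<Rightarrow> real \<Rightarrow> int \<Rightarrow> real" where
  "weight R s k = (R + \<bar>real_of_int k\<bar>) powr s"

text \<open>The matrix of \<open>W m W^-1\<close> for the diagonal weight \<open>W\<close>. If
  \<open>m\<close> is an operator in Fourier modes, this is its action on \<open>H^s\<close>
  transported to square-summable sequences.\<close>

definition conj_weight :: "real \<Rightarrow> real \<Rightarrow> (int \<Rightarrow> int \<Rightarrow> complex) \<Rightarrow> int \<Rightarrow> int \<Rightarrow> complex" where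
  "conj_weight R s m k j = m k j * of_real (weight R s k / weight R s j)"

lemma weight_pos: "R > 0 \<Longrightarrow> weight R s k > 0"
  by (simp add: weight_def add_pos_nonneg)

text \<open>The bounds of the ratio are uniform in \<open>R\<close> and let rapid decay absorb a
  weight; the bound of its distance to 1 carries the factor \<open>1 / R\<close> that makes
  commutators small.\<close>

lemma weight_ratio:
  assumes "R \<ge> 1"
  defines "\<rho> \<equiv> (\<lambda>k j. (R + \<bar>real_of_int k\<bar>) / (R + \<bar>real_of_int j\<bar>))"
  shows "weight R s k / weight R s j = \<rho> k j powr s" "\<rho> k j > 0"
    "\<rho> k j \<le> 1 + \<bar>real_of_int (k - j)\<bar>" "1 / (1 + \<bar>real_of_int (k - j)\<bar>) \<le> \<rho> k j"
    "\<bar>\<rho> k j - 1\<bar> \<le> \<bar>real_of_int (k - j)\<bar> / R"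
proof -
  have R: "R + \<bar>real_of_int k\<bar> > 0" for k using assms by (simp add: add_pos_nonneg)
  show "weight R s k / weight R s j = \<rho> k j powr s"
    using R[of k] R[of j] by (simp add: weight_def \<rho>_def powr_divide)
  show pos: "\<rho> k j > 0" using R by (simp add: \<rho>_def)
  have le: "\<rho> k j \<le> 1 + \<bar>real_of_int (k - j)\<bar>" for k j
  proof -
    have "R + \<bar>real_of_int k\<bar> \<le> (R + \<bar>real_of_int j\<bar>) + 1 * \<bar>real_of_int (k - j)\<bar>" by simp
    also have "\<dots> \<le> (R + \<bar>real_of_int j\<bar>) + (R + \<bar>real_of_int j\<bar>) * \<bar>real_of_int (k - j)\<bar>"
      using assms by (intro add_left_mono mult_right_mono) auto
    finally show ?thesis using R[of j] by (simp add: \<rho>_def field_simps)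
  qed
  show "\<rho> k j \<le> 1 + \<bar>real_of_int (k - j)\<bar>" by (rule le)
  have "1 / \<rho> k j \<le> 1 + \<bar>real_of_int (k - j)\<bar>"
    using le[of j k] by (simp add: \<rho>_def abs_minus_commute)
  then show "1 / (1 + \<bar>real_of_int (k - j)\<bar>) \<le> \<rho> k j"
    using pos by (simp add: field_simps add_pos_nonneg)
  have "\<bar>\<rho> k j - 1\<bar> = \<bar>\<bar>real_of_int k\<bar> - \<bar>real_of_int j\<bar>\<bar> / (R + \<bar>real_of_int j\<bar>)"
    using R[of j] by (simp add: \<rho>_def field_simps flip: abs_of_pos)
  also have "\<dots> \<le> \<bar>real_of_int (k - j)\<bar> / R"
    using assms by (intro frac_le) auto
  finally show "\<bar>\<rho> k j - 1\<bar> \<le> \<bar>real_of_int (k - j)\<bar> / R" .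
qed

text \<open>The interval from \<open>1 / b\<close> to \<open>b\<close> is symmetric under inversion,
  so both signs of the exponent obey the same bound.\<close>

lemma powr_between:
  fixes x b p :: real
  assumes "b \<ge> 1" "1 / b \<le> x" "x \<le> b"
  shows "x powr p \<le> b powr \<bar>p\<bar>"
proof (cases "p \<ge> 0")
  case True
  then show ?thesis using assms by (auto intro!: powr_mono2 order_trans[OF _ assms(2)])
next
  case False
  have "x powr p = (1 / x) powr \<bar>p\<bar>"
    using False assms by (simp add: powr_divide powr_minus_divide)
  also have "\<dots> \<le> b powr \<bar>p\<bar>"
  proof (rule powr_mono2)
    have "x > 0" using assms by (smt (verit) divide_pos_pos)
    with assms show "1 / x \<le> b" "0 \<le> 1 / x" by (simp_all add: field_simps)
  qed simp
  finally show ?thesis .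
qed

lemma powr_le_natpower:
  fixes b p :: real
  assumes "b \<ge> 1"
  shows "b powr p \<le> b ^ nat \<lceil>p\<rceil>"
proof -
  have "b powr p \<le> b powr real (nat \<lceil>p\<rceil>)" using assms by (intro powr_mono) linarith+
  then show ?thesis using assms by (simp add: powr_realpow)
qed

lemma rapid_conj_weight:
  assumes "rapid m" "R \<ge> 1"
  shows "rapid (conj_weight R s m)"
  unfolding rapid_def
proof
  fix N :: nat
  define P where "P = nat \<lceil>\<bar>s\<bar>\<rceil>"
  obtain C where C: "C \<ge> 0" "\<And>k j. cmod (m k j) * (1 + \<bar>real_of_int (k - j)\<bar>) ^ (P + N) \<le> C"
    by (rule rapidE[OF assms(1), of "P + N"]) blast
  have "cmod (conj_weight R s m k j) * (1 + \<bar>real_of_int (k - j)\<bar>) ^ N \<le> C" for k j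
  proof -
    define b where "b = 1 + \<bar>real_of_int (k - j)\<bar>"
    have "b \<ge> 1" by (simp add: b_def)
    have "weight R s k / weight R s j \<le> b powr \<bar>s\<bar>"
      unfolding weight_ratio(1)[OF assms(2)] b_def
      by (intro powr_between weight_ratio assms) auto
    also have "\<dots> \<le> b ^ P" unfolding P_def by (rule powr_le_natpower[OF \<open>b \<ge> 1\<close>])
    finally have le: "weight R s k / weight R s j \<le> b ^ P" .
    have "cmod (conj_weight R s m k j) = cmod (m k j) * (weight R s k / weight R s j)"
      using weight_pos[of R s] assms(2) by (simp add: conj_weight_def norm_mult norm_divide abs_of_pos)
    also have "\<dots> \<le> cmod (m k j) * b ^ P" by (intro mult_left_mono le) auto
    finally have "cmod (conj_weight R s m k j) * b ^ N \<le> cmod (m k j) * b ^ P * b ^ N"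
      using \<open>b \<ge> 1\<close> by (intro mult_right_mono) auto
    also have "\<dots> \<le> C" using C(2)[of k j] by (simp add: power_add b_def mult.assoc)
    finally show ?thesis by (simp add: b_def)
  qed
  then show "\<exists>C. \<forall>k j. cmod (conj_weight R s m k j) * (1 + \<bar>real_of_int (k - j)\<bar>) ^ N \<le> C" by blast
qed

text \<open>The mean value inequality, with the derivative bounded by
  \<open>powr_between\<close>.\<close>

lemma powr_diff_one:
  fixes x b p :: real
  assumes "b \<ge> 1" "1 / b \<le> x" "x \<le> b"
  shows "\<bar>x powr p - 1\<bar> \<le> \<bar>p\<bar> * b powr \<bar>p - 1\<bar> * \<bar>x - 1\<bar>"
proof -
  have pos: "0 < 1 / b" using assms(1) by simp
  have "norm (x powr p - 1 powr p) \<le> (\<bar>p\<bar> * b powr \<bar>p - 1\<bar>) * norm (x - 1)"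
  proof (rule field_differentiable_bound[of "{1 / b..b}" "\<lambda>x. x powr p" "\<lambda>x. p * x powr (p - 1)"])
    fix y assume y: "y \<in> {1 / b..b}"
    with pos have "y > 0" using less_le_trans[of 0 "1 / b" y] by auto
    then show "((\<lambda>x. x powr p) has_field_derivative p * y powr (p - 1)) (at y within {1 / b..b})"
      by (rule has_field_derivative_at_within[OF has_real_derivative_powr])
    show "norm (p * y powr (p - 1)) \<le> \<bar>p\<bar> * b powr \<bar>p - 1\<bar>"
      using mult_left_mono[OF powr_between[OF assms(1), of y "p - 1"], of "\<bar>p\<bar>"] y
      by (simp add: abs_mult)
  qed (use assms in auto)
  then show ?thesis by simp
qed

text \<open>Shifting the weight by a large \<open>R\<close> makes the commutator with the weight small.\<close>

lemma conj_weight_close: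
  assumes "rapid m"
  obtains C where "C \<ge> 0"
    "\<And>R. R \<ge> 1 \<Longrightarrow> kernel (\<lambda>d. C / R * inv_sq d) (\<lambda>k j. conj_weight R s m k j - m k j)"
proof -
  define P where "P = nat \<lceil>\<bar>s - 1\<bar>\<rceil>"
  \<comment> \<open>Of the powers, \<open>P\<close> pays for
    \<open>b powr \<bar>s - 1\<bar>\<close>, one for
    \<open>\<bar>\<rho> - 1\<bar> \<le> b / R\<close>, and two for summability.\<close>
  obtain C where C: "C \<ge> 0" "\<And>k j. cmod (m k j) * (1 + \<bar>real_of_int (k - j)\<bar>) ^ (P + 1 + 2) \<le> C"
    by (rule rapidE[OF assms(1), of "P + 1 + 2"]) blast
  show ?thesis
  proof (rule that)
    show "0 \<le> \<bar>s\<bar> * C" using C by simp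
    fix R :: real assume R: "R \<ge> 1"
    show "kernel (\<lambda>d. \<bar>s\<bar> * C / R * inv_sq d) (\<lambda>k j. conj_weight R s m k j - m k j)"
    proof (rule kernel_inv_sqI)
      fix k j
      define b where "b = 1 + \<bar>real_of_int (k - j)\<bar>"
      define \<rho> where "\<rho> = (R + \<bar>real_of_int k\<bar>) / (R + \<bar>real_of_int j\<bar>)"
      have b: "b \<ge> 1" by (simp add: b_def)
      note wr = weight_ratio[OF R, of k j, folded b_def \<rho>_def]
      have "\<bar>\<rho> powr s - 1\<bar> \<le> \<bar>s\<bar> * b powr \<bar>s - 1\<bar> * \<bar>\<rho> - 1\<bar>"
        by (rule powr_diff_one[OF b wr(4) wr(3)])
      also have "\<dots> \<le> \<bar>s\<bar> * b ^ P * (b / R)"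
      proof (intro mult_mono order.refl)
        show "b powr \<bar>s - 1\<bar> \<le> b ^ P" unfolding P_def by (rule powr_le_natpower[OF b])
        show "\<bar>\<rho> - 1\<bar> \<le> b / R"
          by (rule order_trans[OF wr(5)]) (use R in \<open>auto simp: b_def intro!: divide_right_mono\<close>)
      qed (use b in auto)
      finally have le: "\<bar>\<rho> powr s - 1\<bar> \<le> \<bar>s\<bar> * b ^ (P + 1) / R" by (simp add: mult_ac)
      have "conj_weight R s m k j - m k j = m k j * of_real (\<rho> powr s - 1)"
        unfolding conj_weight_def weight_ratio(1)[OF R] \<rho>_def by (simp add: algebra_simps)
      then have "cmod (conj_weight R s m k j - m k j) = cmod (m k j) * \<bar>\<rho> powr s - 1\<bar>"
        by (simp only: norm_mult norm_of_real)
      also have "\<dots> \<le> cmod (m k j) * (\<bar>s\<bar> * b ^ (P + 1) / R)"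
        by (intro mult_left_mono le) auto
      finally have "cmod (conj_weight R s m k j - m k j) * b\<^sup>2 \<le> cmod (m k j) * (\<bar>s\<bar> * b ^ (P + 1) / R) * b\<^sup>2"
        by (intro mult_right_mono) auto
      also have "\<dots> = \<bar>s\<bar> / R * (cmod (m k j) * b ^ (P + 1 + 2))"
        by (simp add: power_add power2_eq_square field_simps)
      also have "\<dots> \<le> \<bar>s\<bar> / R * C"
        using C(2)[of k j] R by (intro mult_left_mono) (auto simp: b_def)
      finally show "cmod (conj_weight R s m k j - m k j) * (1 + \<bar>real_of_int (k - j)\<bar>)\<^sup>2 \<le> \<bar>s\<bar> * C / R"
        by (simp add: b_def)
    qed
  qed
qed

section \<open>Evolution equations in \<open>\<ell>\<^sup>2\<close>\<close>

text \<open>Continuity is in norm, but the equation is imposed mode by mode: for unbounded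
  \<open>lam\<close> the curve need not be differentiable in norm, and the term with
  \<open>lam\<close> need not be square-summable.\<close>

definition mode_solution :: "(int \<Rightarrow> real) \<Rightarrow> (int ell2 \<Rightarrow> int ell2) \<Rightarrow> (real \<Rightarrow> int ell2) \<Rightarrow> bool" where
  "mode_solution lam T x \<longleftrightarrow> continuous_on {0..} x \<and>
     (\<forall>t>0. \<forall>k. ((\<lambda>t. coord (x t) k) has_vector_derivative
        (\<i> * of_real (lam k) * coord (x t) k - coord (T (x t)) k)) (at t))"

lemma bounded_linear_trunc: "bounded_linear (trunc F)"
  unfolding trunc_def
  by (intro bounded_linear_sum bounded_linear_compose[OF bounded_linear_single bounded_linear_coord])

lemma kop_sum_single:
  assumes "kernel h m" "finite F"
  shows "kop m (\<Sum>j\<in>F. single j (f j)) = (\<Sum>j\<in>F. kop m (single j (f j)))"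
  using linear_sum[OF bounded_linear.linear[OF bounded_linear_kop[OF assms(1)]]] by blast

lemma inner_kop_sum_single:
  assumes "kernel h m" "finite F"
  shows "inner (kop m (\<Sum>j\<in>F. single j (f j))) (\<Sum>k\<in>F. single k (g k))
    = (\<Sum>k\<in>F. \<Sum>j\<in>F. inner (m k j * f j) (g k))"
  by (simp add: kop_sum_single[OF assms] inner_sum_right inner_sum_left inner_single
      coord_kop_single[OF assms(1)])

text \<open>With \<open>L = diag (i lam)\<close>, skew-symmetry of \<open>L\<close> turns the left
  side into the quadratic form of \<open>p L - L p\<close>. The sums are finite because
  \<open>L\<close> is unbounded.\<close>

lemma kop_diagonal_commutator:
  fixes c :: "int \<Rightarrow> complex"
  assumes p: "kernel h p" and e: "kernel h' e" and "finite F"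
    and ep: "\<And>k j. e k j = \<i> * of_real (lam j - lam k) * p k j"
  defines "y \<equiv> \<Sum>k\<in>F. single k (c k)" and "Ly \<equiv> \<Sum>k\<in>F. single k (\<i> * of_real (lam k) * c k)"
  shows "inner (kop p Ly) y + inner (kop p y) Ly = inner (kop e y) y"
  unfolding y_def Ly_def inner_kop_sum_single[OF p \<open>finite F\<close>] inner_kop_sum_single[OF e \<open>finite F\<close>]
    sum.distrib[symmetric]
  by (intro sum.cong refl) (simp add: ep inner_complex_def algebra_simps)

text \<open>The frequencies enter the derivative of the quadratic form only through the commutator
  \<open>e\<close>, which is assumed bounded. The identity holds for truncations; integration in
  time and dominated convergence carry it to \<open>x\<close>, and continuity of the limit integrand
  allows differentiating back.\<close>

lemma energy_identity:
  assumes sol: "mode_solution lam T x" and T: "bounded_linear T"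
    and p: "kernel h p" and e: "kernel h' e"
    and ep: "\<And>k j. e k j = \<i> * of_real (lam j - lam k) * p k j"
  defines "\<phi> \<equiv> \<lambda>t. inner (kop e (x t)) (x t) - inner (kop p (T (x t))) (x t) - inner (kop p (x t)) (T (x t))"
  shows "continuous_on {0..} (\<lambda>t. inner (kop p (x t)) (x t))"
    and "t > 0 \<Longrightarrow> ((\<lambda>t. inner (kop p (x t)) (x t)) has_real_derivative \<phi> t) (at t)"
proof -
  note lp = bounded_linear_kop[OF p] and le = bounded_linear_kop[OF e]
  have cx: "continuous_on {0..} x" using sol by (simp add: mode_solution_def)
  note cont = continuous_on_inner bounded_linear.continuous_on[OF lp]
    bounded_linear.continuous_on[OF le] bounded_linear.continuous_on[OF T]
    bounded_linear.continuous_on[OF bounded_linear_trunc] continuous_on_diff continuous_on_add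
    continuous_on_mult continuous_on_const continuous_on_norm
  show cV: "continuous_on {0..} (\<lambda>t. inner (kop p (x t)) (x t))"
    by (intro cont cx)
  have c\<phi>: "continuous_on {0..} \<phi>"
    unfolding \<phi>_def by (intro cont cx)
  define F where "F = (\<lambda>n::nat. {- int n..int n})"
  have F: "finite (F n)" for n by (simp add: F_def)
  define X where "X = (\<lambda>n t. trunc (F n) (x t))"
  \<comment> \<open>The coordinate equations produce the truncation of \<open>T (x t)\<close>, which
    differs from \<open>T\<close> applied to the truncated curve.\<close>
  define Z where "Z = (\<lambda>n t. trunc (F n) (T (x t)))"
  define V where "V = (\<lambda>n t. inner (kop p (X n t)) (X n t))"
  define \<psi> where "\<psi> = (\<lambda>n t. inner (kop e (X n t)) (X n t) - inner (kop p (Z n t)) (X n t) - inner (kop p (X n t)) (Z n t))"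
  have dV: "(V n has_vector_derivative \<psi> n t) (at t)" if "t > 0" for n t
  proof -
    define LX where "LX = (\<Sum>k\<in>F n. single k (\<i> * of_real (lam k) * coord (x t) k))"
    have "(X n has_vector_derivative (\<Sum>k\<in>F n. single k (\<i> * of_real (lam k) * coord (x t) k - coord (T (x t)) k))) (at t)"
      unfolding X_def trunc_def
      by (intro has_vector_derivative_sum bounded_linear.has_vector_derivative[OF bounded_linear_single])
        (use sol that in \<open>auto simp: mode_solution_def\<close>)
    also have "(\<Sum>k\<in>F n. single k (\<i> * of_real (lam k) * coord (x t) k - coord (T (x t)) k)) = LX - Z n t"
      by (simp add: LX_def Z_def trunc_def linear_diff[OF bounded_linear.linear[OF bounded_linear_single]] sum_subtractf)
    finally have dX: "(X n has_vector_derivative (LX - Z n t)) (at t)" .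
    have "(V n has_vector_derivative
        (inner (kop p (X n t)) (LX - Z n t) + inner (kop p (LX - Z n t)) (X n t))) (at t)"
      unfolding V_def
      by (rule bounded_bilinear.has_vector_derivative[OF bounded_bilinear_inner
            bounded_linear.has_vector_derivative[OF lp dX] dX])
    also have "inner (kop p (X n t)) (LX - Z n t) + inner (kop p (LX - Z n t)) (X n t)
       = (inner (kop p LX) (X n t) + inner (kop p (X n t)) LX) - inner (kop p (Z n t)) (X n t) - inner (kop p (X n t)) (Z n t)"
      by (simp add: linear_diff[OF bounded_linear.linear[OF lp]] inner_diff_left inner_diff_right)
    also have "inner (kop p LX) (X n t) + inner (kop p (X n t)) LX = inner (kop e (X n t)) (X n t)"
      unfolding X_def trunc_def LX_def by (rule kop_diagonal_commutator[OF p e F ep])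
    finally show ?thesis by (simp add: \<psi>_def)
  qed
  have cX: "continuous_on {0..} (X n)" and cZ: "continuous_on {0..} (Z n)" for n
    unfolding X_def Z_def by (intro cont cx)+
  have cVn: "continuous_on {0..} (V n)" and c\<psi>: "continuous_on {0..} (\<psi> n)" for n
    unfolding V_def \<psi>_def by (intro cont cX cZ)+
  have limX: "(\<lambda>n. X n t) \<longlonglongrightarrow> x t" and limZ: "(\<lambda>n. Z n t) \<longlonglongrightarrow> T (x t)" for t
    unfolding X_def Z_def F_def by (rule tendsto_trunc)+
  have limV: "(\<lambda>n. V n t) \<longlonglongrightarrow> inner (kop p (x t)) (x t)" for t
    unfolding V_def by (intro tendsto_inner bounded_linear.tendsto[OF lp] limX)
  have lim\<psi>: "(\<lambda>n. \<psi> n t) \<longlonglongrightarrow> \<phi> t" for t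
    unfolding \<phi>_def \<psi>_def
    by (intro tendsto_diff tendsto_inner bounded_linear.tendsto[OF lp] bounded_linear.tendsto[OF le] limX limZ)
  obtain Cp where Cp: "\<And>y. norm (kop p y) \<le> norm y * Cp" "Cp \<ge> 0"
    using bounded_linear.nonneg_bounded[OF lp] by auto
  obtain Ce where Ce: "\<And>y. norm (kop e y) \<le> norm y * Ce" "Ce \<ge> 0"
    using bounded_linear.nonneg_bounded[OF le] by auto
  \<comment> \<open>A majorant for all \<open>n\<close> at once, since truncation does not increase
    norms; it is continuous on bounded intervals, hence integrable there.\<close>
  define H where "H = (\<lambda>t. norm (x t) * Ce * norm (x t) + norm (T (x t)) * Cp * norm (x t)
     + norm (x t) * Cp * norm (T (x t)))"
  have bound: "norm (\<psi> n t) \<le> H t" for n t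
  proof -
    have Xn: "norm (X n t) \<le> norm (x t)" "norm (Z n t) \<le> norm (T (x t))"
      unfolding X_def Z_def by (rule norm_trunc_le[OF F])+
    have in_le: "\<bar>inner (kop m u) v\<bar> \<le> norm u' * C * norm v'"
      if "\<And>y. norm (kop m y) \<le> norm y * C" "C \<ge> 0" "norm u \<le> norm u'" "norm v \<le> norm v'" for m C u v u' v'
    proof -
      have "\<bar>inner (kop m u) v\<bar> \<le> norm (kop m u) * norm v" by (rule Cauchy_Schwarz_ineq2)
      also have "\<dots> \<le> (norm u * C) * norm v" by (intro mult_right_mono that) auto
      also have "\<dots> \<le> norm u' * C * norm v'" by (intro mult_mono that) (use that in auto)
      finally show ?thesis .
    qed
    show ?thesis
      using in_le[OF Ce Xn(1) Xn(1)] in_le[OF Cp Xn(2) Xn(1)] in_le[OF Cp Xn(1) Xn(2)]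
      unfolding \<psi>_def H_def real_norm_def by linarith
  qed
  have int\<phi>: "integral {0..b} \<phi> = inner (kop p (x b)) (x b) - inner (kop p (x 0)) (x 0)" if "b \<ge> 0" for b
  proof -
    have sub: "{0..b} \<subseteq> {0..}" by auto
    have *: "(\<psi> n has_integral (V n b - V n 0)) {0..b}" for n
      by (rule fundamental_theorem_of_calculus_interior)
        (use that dV in \<open>auto intro: continuous_on_subset[OF cVn sub]\<close>)
    have "(\<lambda>n. integral {0..b} (\<psi> n)) \<longlonglongrightarrow> integral {0..b} \<phi>"
    proof (rule dominated_convergence(2))
      show "\<psi> n integrable_on {0..b}" for n using * by blast
      have "continuous_on {0..b} H"
        unfolding H_def by (intro cont continuous_on_subset[OF cx sub])
      then show "H integrable_on {0..b}" by (rule integrable_continuous_real)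
    qed (use bound lim\<psi> in auto)
    then have "(\<lambda>n. V n b - V n 0) \<longlonglongrightarrow> integral {0..b} \<phi>"
      using integral_unique[OF *] by simp
    then show ?thesis using tendsto_diff[OF limV limV] LIMSEQ_unique by blast
  qed
  assume t: "t > 0"
  have "((\<lambda>u. integral {0..u} \<phi>) has_vector_derivative \<phi> t) (at t within {0..t+1})"
    by (rule integral_has_vector_derivative[OF continuous_on_subset[OF c\<phi>]]) (use t in auto)
  then have "((\<lambda>u. integral {0..u} \<phi>) has_vector_derivative \<phi> t) (at t)"
    using t by (simp add: at_within_Icc_at)
  then have "((\<lambda>u. integral {0..u} \<phi> + inner (kop p (x 0)) (x 0)) has_vector_derivative \<phi> t) (at t)"
    by (rule has_vector_derivative_add_const[THEN iffD2])
  then have "((\<lambda>t. inner (kop p (x t)) (x t)) has_vector_derivative \<phi> t) (at t)"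
    by (rule has_vector_derivative_transform_within_open[where S = "{0<..}"]) (use t int\<phi> in auto)
  then show "((\<lambda>t. inner (kop p (x t)) (x t)) has_real_derivative \<phi> t) (at t)"
    by (simp add: has_real_derivative_iff_has_vector_derivative)
qed

text \<open>\<open>exp (\<kappa> * t) * V t\<close> has nonpositive derivative at positive times,
  and continuity extends the comparison to time 0.\<close>

lemma exponential_decayI:
  fixes V \<phi> :: "real \<Rightarrow> real"
  assumes "continuous_on {0..} V"
    and "\<And>t. t > 0 \<Longrightarrow> (V has_real_derivative \<phi> t) (at t)"
    and "\<And>t. t > 0 \<Longrightarrow> \<phi> t \<le> - (\<kappa> * V t)"
    and "t \<ge> 0"
  shows "V t \<le> exp (- \<kappa> * t) * V 0"
proof (cases "t = 0")
  case False
  have "exp (\<kappa> * t) * V t \<le> exp (\<kappa> * 0) * V 0"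
  proof (rule DERIV_nonpos_imp_decreasing_open[of 0 t "\<lambda>t. exp (\<kappa> * t) * V t"])
    show "0 \<le> t" by (fact assms(4))
    show "continuous_on {0..t} (\<lambda>t. exp (\<kappa> * t) * V t)"
      by (intro continuous_intros continuous_on_subset[OF assms(1)]) auto
    fix u :: real assume "0 < u"
    have "((\<lambda>t. exp (\<kappa> * t) * V t) has_real_derivative exp (\<kappa> * u) * (\<kappa> * V u + \<phi> u)) (at u)"
      using \<open>0 < u\<close> by (auto intro!: derivative_eq_intros assms(2) simp: algebra_simps)
    moreover have "exp (\<kappa> * u) * (\<kappa> * V u + \<phi> u) \<le> 0"
      using assms(3)[OF \<open>0 < u\<close>] by (simp add: mult_le_0_iff)
    ultimately show "\<exists>y. ((\<lambda>t. exp (\<kappa> * t) * V t) has_real_derivative y) (at u) \<and> y \<le> 0" by blast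
  qed
  then show ?thesis by (simp add: exp_minus field_simps)
qed simp

text \<open>The Lyapunov function is \<open>N * inner x x + inner (kop q x) x\<close>, where the commutator of
  \<open>kop q\<close> with \<open>diag (i lam)\<close> is the part of \<open>b\<close> off the blocks of equal eigenvalues.\<close>

lemma lyapunov_decay:
  assumes m: "kernel hm m" and b: "kernel hb b" and herm: "\<And>k j. m j k = cnj (m k j)"
    and bm: "\<And>x. kop b x = kop m (kop m x)"
    and \<gamma>: "\<gamma> > 0" "\<And>k j. lam k = lam j \<or> \<bar>lam k - lam j\<bar> \<ge> \<gamma>"
    and c: "c > 0"
      "\<And>x. coord x 0 = 0 \<Longrightarrow> inner (kop (\<lambda>k j. if lam k = lam j then b k j else 0) x) x \<ge> c * (norm x)\<^sup>2"
  obtains \<alpha> \<epsilon> where "\<alpha> > 0" "\<epsilon> > 0"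
    "\<And>T x t. bounded_linear T \<Longrightarrow> (\<And>y. norm (T y - kop b y) \<le> \<epsilon> * norm y) \<Longrightarrow> mode_solution lam T x \<Longrightarrow>
       (\<And>t. t \<ge> 0 \<Longrightarrow> coord (x t) 0 = 0) \<Longrightarrow> t \<ge> 0 \<Longrightarrow> norm (x t) \<le> 2 * exp (- \<alpha> * t) * norm (x 0)"
proof -
  define d where "d = (\<lambda>k j. if lam k = lam j then b k j else 0)"
  define e where "e = (\<lambda>k j. if lam k = lam j then 0 else b k j)"
  define q where "q = (\<lambda>k j. if lam k = lam j then 0 else b k j / (\<i> * of_real (lam j - lam k)))"
  \<comment> \<open>The identity matrix commutes with \<open>diag (i lam)\<close>; through it,
    \<open>energy_identity\<close> also covers the plain energy, with commutator 0.\<close>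
  define I where "I = (\<lambda>k j::int. if k = j then 1 else 0 :: complex)"
  note hb = kernelD(1)[OF b]
  have kd: "kernel hb d" and ke: "kernel hb e"
    using b kernel_bound_nonneg[OF b] by (auto simp: kernel_def d_def e_def)
  \<comment> \<open>Off the blocks the denominators are at least \<open>\<gamma>\<close> in modulus,
    so the majorant persists up to the factor \<open>1 / \<gamma>\<close>.\<close>
  have kq: "kernel (\<lambda>i. hb i / \<gamma>) q"
    unfolding kernel_def
  proof (intro conjI allI)
    show "(\<lambda>i. hb i / \<gamma>) summable_on UNIV"
      using summable_on_cmult_left[OF hb, of "inverse \<gamma>"] by (simp add: divide_inverse)
    fix k j
    show "cmod (q k j) \<le> hb (k - j) / \<gamma>"
    proof (cases "lam k = lam j")
      case False
      then have "\<bar>lam j - lam k\<bar> \<ge> \<gamma>" using \<gamma>(2)[of j k] by auto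
      then have "cmod (b k j) / \<bar>lam j - lam k\<bar> \<le> hb (k - j) / \<gamma>"
        using kernelD(2)[OF b] \<gamma>(1) by (intro frac_le) (auto simp: kernel_bound_nonneg[OF b])
      then show ?thesis using False by (simp add: q_def norm_divide norm_mult flip: of_real_diff)
    qed (use \<gamma> kernel_bound_nonneg[OF b] in \<open>simp add: q_def\<close>)
  qed
  have eq: "e k j = \<i> * of_real (lam j - lam k) * q k j" for k j
    by (simp add: e_def q_def)
  have kI: "kernel (\<lambda>i. if i = 0 then 1 else 0) I"
    unfolding I_def using kernel_diag[of "\<lambda>_. 1" 1] by simp
  have kopI: "kop I y = y" for y
    using coord_dop[of "\<lambda>_. 1" 1] by (intro ell2_eqI) (simp add: I_def dop_def)
  have k0: "kernel (\<lambda>i. 0) (\<lambda>k j. 0)" by (simp add: kernel_def)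
  have kop0: "kop (\<lambda>k j. 0) y = 0" for y
    by (rule ell2_eqI) (simp add: coord_kop[OF k0])
  have e_split: "kop e y = kop b y - kop d y" for y
    by (rule bounded_linear_eqI[OF bounded_linear_kop[OF ke] bounded_linear_sub[OF bounded_linear_kop[OF b] bounded_linear_kop[OF kd]]],
        rule ell2_eqI)
      (simp add: coord_kop_single[OF ke] coord_kop_single[OF b] coord_kop_single[OF kd], simp add: e_def d_def)
  have b_inner: "inner (kop b y) y = (norm (kop m y))\<^sup>2" for y
    by (simp add: bm kop_selfadjoint[OF m herm] power2_norm_eq_inner)
  define Q where "Q = infsum (\<lambda>i. hb i / \<gamma>) UNIV"
  have Q: "norm (kop q y) \<le> Q * norm y" for y unfolding Q_def by (rule norm_kop_le[OF kq])
  have Q0: "Q \<ge> 0" unfolding Q_def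
    by (rule infsum_nonneg) (use \<gamma> kernel_bound_nonneg[OF b] in simp)
  define \<beta> where "\<beta> = infsum hm UNIV"
  have \<beta>: "norm (kop m y) \<le> \<beta> * norm y" for y unfolding \<beta>_def by (rule norm_kop_le[OF m])
  have \<beta>0: "\<beta> \<ge> 0" unfolding \<beta>_def by (rule infsum_nonneg) (rule kernel_bound_nonneg[OF m])
  \<comment> \<open>\<open>2 * Q\<close> makes the Lyapunov function comparable to
    \<open>N * (norm x)\<^sup>2\<close>; the fraction comes from Young's inequality below, and 1
    absorbs the term \<open>g\<^sup>2\<close> contributed by
    \<open>inner (kop e x) x\<close>.\<close>
  define N where "N = 1 + Q\<^sup>2 * \<beta>\<^sup>2 / c + 2 * Q"
  \<comment> \<open>Of the coercivity \<open>c\<close>, Young's inequality spends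
    \<open>c / 2\<close> and the perturbation of the feedback \<open>c / 4\<close> by this choice;
    the remaining \<open>c / 4\<close> becomes the decay rate through
    \<open>\<kappa>\<close>.\<close>
  define \<epsilon> where "\<epsilon> = c / (8 * (N + Q))"
  define \<kappa> where "\<kappa> = c / (6 * N)"
  have N: "N \<ge> 1" "N \<ge> 2 * Q" "2 * N \<ge> 1 + 2 * Q\<^sup>2 * \<beta>\<^sup>2 / c"
    using Q0 c(1) by (auto simp: N_def)
  have \<epsilon>: "\<epsilon> > 0" "2 * (N + Q) * \<epsilon> = c / 4"
    using N Q0 c(1) by (auto simp: \<epsilon>_def field_simps)
  have \<kappa>: "\<kappa> > 0" "\<kappa> * (3 / 2 * N) = c / 4"
    using N c(1) by (auto simp: \<kappa>_def field_simps)
  show thesis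
  proof (rule that)
    show "\<kappa> / 2 > 0" "\<epsilon> > 0" using \<kappa> \<epsilon> by auto
    fix T x and t :: real
    assume T: "bounded_linear T" and Tb: "\<And>y. norm (T y - kop b y) \<le> \<epsilon> * norm y"
      and sol: "mode_solution lam T x" and x0: "\<And>t. t \<ge> 0 \<Longrightarrow> coord (x t) 0 = 0" and t: "t \<ge> 0"
    define V where "V = (\<lambda>t. N * inner (x t) (x t) + inner (kop q (x t)) (x t))"
    define \<phi> where "\<phi> = (\<lambda>t. N * (- inner (T (x t)) (x t) - inner (x t) (T (x t)))
       + (inner (kop e (x t)) (x t) - inner (kop q (T (x t))) (x t) - inner (kop q (x t)) (T (x t))))"
    note EI = energy_identity[OF sol T kI k0, unfolded kopI kop0]
    note EQ = energy_identity[OF sol T kq ke eq]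
    have I0: "0 = \<i> * of_real (lam j - lam k) * I k j" for k j by (simp add: I_def)
    have cV: "continuous_on {0..} V"
      unfolding V_def by (intro continuous_on_add continuous_on_mult continuous_on_const EI(1) EQ(1) I0)
    have dV: "(V has_real_derivative \<phi> t) (at t)" if "t > 0" for t
      unfolding V_def \<phi>_def
      using DERIV_add[OF DERIV_cmult[OF EI(2)[OF I0 that], of N] EQ(2)[OF that]] by simp
    have qV: "\<bar>inner (kop q y) y\<bar> \<le> Q * (norm y)\<^sup>2" for y
      using order_trans[OF Cauchy_Schwarz_ineq2 mult_right_mono[OF Q norm_ge_zero]]
      by (simp add: power2_eq_square mult.assoc)
    have V_upper: "V t \<le> 3 / 2 * N * (norm (x t))\<^sup>2" for t
    proof -
      have "Q * (norm (x t))\<^sup>2 \<le> N / 2 * (norm (x t))\<^sup>2" using N by (intro mult_right_mono) auto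
      then show ?thesis using qV[of "x t"] by (simp add: V_def flip: power2_norm_eq_inner)
    qed
    have V_lower: "V t \<ge> 1 / 2 * N * (norm (x t))\<^sup>2" for t
    proof -
      have "Q * (norm (x t))\<^sup>2 \<le> N / 2 * (norm (x t))\<^sup>2" using N by (intro mult_right_mono) auto
      then show ?thesis using qV[of "x t"] by (simp add: V_def flip: power2_norm_eq_inner)
    qed
    have "\<phi> t \<le> - (\<kappa> * V t)" if "t > 0" for t
    proof -
      define X g r where "X = norm (x t)" and "g = norm (kop m (x t))" and "r = T (x t) - kop b (x t)"
      have nn: "X \<ge> 0" "g \<ge> 0" by (simp_all add: X_def g_def)
      have Tx: "T (x t) = kop b (x t) + r" by (simp add: r_def)
      have r: "norm r \<le> \<epsilon> * X" using Tb by (simp add: r_def X_def)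
      have nT: "norm (T (x t)) \<le> \<beta> * g + \<epsilon> * X"
        unfolding Tx using r \<beta>[of "kop m (x t)"] by (intro norm_triangle_le) (simp add: bm g_def)
      have rx: "\<bar>inner r (x t)\<bar> \<le> \<epsilon> * X\<^sup>2"
        using order_trans[OF Cauchy_Schwarz_ineq2 mult_right_mono[OF r norm_ge_zero]]
        by (simp add: power2_eq_square X_def mult.assoc)
      have Tin: "inner (T (x t)) (x t) \<ge> g\<^sup>2 - \<epsilon> * X\<^sup>2"
        using rx by (simp add: Tx inner_add_left b_inner g_def)
      \<comment> \<open>Here coercivity enters: \<open>e\<close> is \<open>b\<close> minus its
        block-diagonal part \<open>d\<close>.\<close>
      have ein: "inner (kop e (x t)) (x t) \<le> g\<^sup>2 - c * X\<^sup>2"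
        using c(2)[of "x t"] x0 that by (simp add: e_split inner_diff_left b_inner g_def X_def flip: d_def)
      have q1: "\<bar>inner (kop q (T (x t))) (x t)\<bar> \<le> Q * (\<beta> * g + \<epsilon> * X) * X"
        using Cauchy_Schwarz_ineq2[of "kop q (T (x t))" "x t"]
          mult_right_mono[OF order_trans[OF Q mult_left_mono[OF nT Q0]] nn(1)]
        by (simp add: X_def)
      have q2: "\<bar>inner (kop q (x t)) (T (x t))\<bar> \<le> Q * (\<beta> * g + \<epsilon> * X) * X"
        using Cauchy_Schwarz_ineq2[of "kop q (x t)" "T (x t)"]
          mult_mono[OF Q[of "x t"] nT] nn Q0 by (simp add: X_def mult_ac)
      have young: "2 * Q * \<beta> * g * X \<le> 2 * Q\<^sup>2 * \<beta>\<^sup>2 / c * g\<^sup>2 + c / 2 * X\<^sup>2"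
      proof -
        have "0 \<le> (2 * Q * \<beta> * g - c * X)\<^sup>2 / (2 * c)" using c(1) by simp
        also have "\<dots> = 2 * Q\<^sup>2 * \<beta>\<^sup>2 / c * g\<^sup>2 + c / 2 * X\<^sup>2 - 2 * Q * \<beta> * g * X"
          using c(1) by (simp add: power2_eq_square field_simps)
        finally show ?thesis by simp
      qed
      have "\<phi> t = - (2 * N * inner (T (x t)) (x t)) + inner (kop e (x t)) (x t)
          - inner (kop q (T (x t))) (x t) - inner (kop q (x t)) (T (x t))"
        by (simp add: \<phi>_def inner_commute algebra_simps)
      also have "\<dots> \<le> - (2 * N * (g\<^sup>2 - \<epsilon> * X\<^sup>2)) + (g\<^sup>2 - c * X\<^sup>2) + 2 * (Q * (\<beta> * g + \<epsilon> * X) * X)"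
        using mult_left_mono[OF Tin, of "2 * N"] N(1) ein q1 q2 by linarith
      also have "\<dots> = (1 - 2 * N) * g\<^sup>2 - c * X\<^sup>2 + 2 * Q * \<beta> * g * X + (2 * (N + Q) * \<epsilon>) * X\<^sup>2"
        by (simp add: power2_eq_square algebra_simps)
      also have "\<dots> \<le> (1 + 2 * Q\<^sup>2 * \<beta>\<^sup>2 / c - 2 * N) * g\<^sup>2 - c / 2 * X\<^sup>2 + c / 4 * X\<^sup>2"
        using young unfolding \<epsilon>(2) by (simp add: algebra_simps)
      also have "\<dots> \<le> - (c / 4 * X\<^sup>2)"
        using mult_nonpos_nonneg[of "1 + 2 * Q\<^sup>2 * \<beta>\<^sup>2 / c - 2 * N" "g\<^sup>2"] N(3) by simp
      also have "\<dots> \<le> - (\<kappa> * V t)"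
      proof -
        have "\<kappa> * V t \<le> \<kappa> * (3 / 2 * N * X\<^sup>2)"
          using \<kappa>(1) V_upper[of t] unfolding X_def by (intro mult_left_mono) auto
        also have "\<dots> = (\<kappa> * (3 / 2 * N)) * X\<^sup>2" by (simp only: mult.assoc)
        finally show ?thesis unfolding \<kappa>(2) by simp
      qed
      finally show ?thesis .
    qed
    from exponential_decayI[OF cV dV this t]
    have "V t \<le> exp (- \<kappa> * t) * V 0" .
    also have "\<dots> \<le> exp (- \<kappa> * t) * (3 / 2 * N * (norm (x 0))\<^sup>2)"
      by (intro mult_left_mono V_upper) auto
    finally have "1 / 2 * N * (norm (x t))\<^sup>2 \<le> exp (- \<kappa> * t) * (3 / 2 * N * (norm (x 0))\<^sup>2)"
      using V_lower[of t] by linarith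
    then have "N * (norm (x t))\<^sup>2 \<le> N * (3 * (exp (- \<kappa> * t) * (norm (x 0))\<^sup>2))"
      by (simp add: mult_ac)
    then have "(norm (x t))\<^sup>2 \<le> 3 * (exp (- \<kappa> * t) * (norm (x 0))\<^sup>2)"
      using N(1) by (subst (asm) mult_le_cancel_left_pos) auto
    also have "\<dots> \<le> 4 * (exp (- \<kappa> * t) * (norm (x 0))\<^sup>2)"
      by (intro mult_right_mono) auto
    also have "\<dots> = (2 * exp (- (\<kappa> / 2) * t) * norm (x 0))\<^sup>2"
      by (simp add: power_mult_distrib flip: exp_double)
    finally show "norm (x t) \<le> 2 * exp (- (\<kappa> / 2) * t) * norm (x 0)"
      by (rule power2_le_imp_le) simp
  qed
qed

section \<open>Picard series and existence of mode solutions\<close>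

lemma continuous_on_atLeastI:
  fixes f :: "real \<Rightarrow> 'a::topological_space"
  assumes "\<And>b. b > a \<Longrightarrow> continuous_on {a..b} f"
  shows "continuous_on {a..} f"
  unfolding continuous_on_eq_continuous_within
proof
  fix t assume t: "t \<in> {a..}"
  have "at t within {a..} = at t within {a..t + 1}"
    by (rule at_within_nhd[of _ "{..<t + 1}"]) auto
  moreover have "continuous (at t within {a..t + 1}) f"
    using assms[of "t + 1"] t by (auto simp: continuous_on_eq_continuous_within)
  ultimately show "continuous (at t within {a..}) f" by simp
qed

text \<open>The terms of the Dyson series and not the successive approximations; the latter are the
  partial sums of these terms.\<close>

primrec picard :: "(real \<Rightarrow> 'a \<Rightarrow> 'a) \<Rightarrow> 'a \<Rightarrow> nat \<Rightarrow> real \<Rightarrow> 'a::banach" where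
  "picard F x0 0 = (\<lambda>t. x0)"
| "picard F x0 (Suc n) = (\<lambda>t. integral {0..t} (\<lambda>\<tau>. F \<tau> (picard F x0 n \<tau>)))"

text \<open>The terms are dominated by an exponential series, hence converge uniformly on bounded
  intervals. Time continuity of \<open>F\<close> is demanded along continuous curves only, because
  the free group is merely strongly continuous.\<close>

lemma linear_integral_equation:
  fixes F :: "real \<Rightarrow> 'a::banach \<Rightarrow> 'a"
  assumes lin: "\<And>t. bounded_linear (F t)" and bound: "\<And>t y. norm (F t y) \<le> \<beta> * norm y"
    and cont: "\<And>y. continuous_on {0..} y \<Longrightarrow> continuous_on {0..} (\<lambda>t. F t (y t))" and "\<beta> \<ge> 0"
  obtains y where "continuous_on {0..} y"
    "\<And>t. t \<ge> 0 \<Longrightarrow> ((\<lambda>\<tau>. F \<tau> (y \<tau>)) has_integral (y t - x0)) {0..t}"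
proof -
  define E where "E = picard F x0"
  have E0: "E 0 t = x0" and ES: "E (Suc n) t = integral {0..t} (\<lambda>\<tau>. F \<tau> (E n \<tau>))" for n t
    by (simp_all add: E_def)
  have sub: "{0..b} \<subseteq> {0..}" for b :: real by auto
  have cE: "continuous_on {0..} (E n)" for n
  proof (induction n)
    case (Suc n)
    show ?case
    proof (rule continuous_on_atLeastI)
      fix b :: real
      have "(\<lambda>\<tau>. F \<tau> (E n \<tau>)) integrable_on {0..b}"
        by (rule integrable_continuous_real[OF continuous_on_subset[OF cont[OF Suc] sub]])
      then show "continuous_on {0..b} (E (Suc n))"
        unfolding ES[abs_def] by (rule indefinite_integral_continuous_1)
    qed
  qed (simp add: E0[abs_def])
  have iFE: "(\<lambda>\<tau>. F \<tau> (E n \<tau>)) integrable_on {0..b}" for n b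
    by (rule integrable_continuous_real[OF continuous_on_subset[OF cont[OF cE] sub]])
  have E_le: "norm (E n t) \<le> (\<beta> * t) ^ n / fact n * norm x0" if "t \<ge> 0" for n t
    using that
  proof (induction n arbitrary: t)
    case (Suc n)
    define G where "G = (\<lambda>\<tau>. (\<beta> * \<tau>) ^ Suc n / fact (Suc n) * norm x0)"
    define g where "g = (\<lambda>\<tau>. \<beta> * ((\<beta> * \<tau>) ^ n / fact n * norm x0))"
    have "(G has_vector_derivative g \<tau>) (at \<tau> within {0..t})" for \<tau>
    proof -
      have "(G has_real_derivative (real (Suc n) * (\<beta> * \<tau>) ^ n * \<beta>) / fact (Suc n) * norm x0) (at \<tau> within {0..t})"
        unfolding G_def by (auto intro!: derivative_eq_intros simp del: power_Suc fact_Suc)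
      also have "(real (Suc n) * (\<beta> * \<tau>) ^ n * \<beta>) / fact (Suc n) * norm x0 = g \<tau>"
      proof -
        have "fact (Suc n) = real (Suc n) * fact n" by simp
        then show ?thesis by (simp only: g_def) (simp add: field_simps del: of_nat_Suc)
      qed
      finally show ?thesis by (simp add: has_real_derivative_iff_has_vector_derivative)
    qed
    then have gG: "(g has_integral (G t - G 0)) {0..t}"
      by (rule fundamental_theorem_of_calculus[OF Suc.prems])
    have "norm (E (Suc n) t) \<le> integral {0..t} g"
      unfolding ES
    proof (rule integral_norm_bound_integral[OF iFE])
      show "g integrable_on {0..t}" using gG by blast
      show "norm (F \<tau> (E n \<tau>)) \<le> g \<tau>" if "\<tau> \<in> {0..t}" for \<tau>
        unfolding g_def using that \<open>\<beta> \<ge> 0\<close>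
        by (intro order_trans[OF bound] mult_left_mono Suc.IH) auto
    qed
    also have "\<dots> = G t" using gG by (simp add: integral_unique G_def)
    finally show ?case by (simp only: G_def)
  qed (simp add: E0)
  define y where "y = (\<lambda>t. \<Sum>n. E n t)"
  have unif: "uniform_limit {0..b} (\<lambda>n t. \<Sum>i<n. E i t) y sequentially" for b
    unfolding y_def
  proof (rule Weierstrass_m_test)
    show "norm (E n t) \<le> (\<beta> * b) ^ n / fact n * norm x0" if "t \<in> {0..b}" for n t
      using that \<open>\<beta> \<ge> 0\<close>
      by (intro order_trans[OF E_le] mult_right_mono divide_right_mono power_mono mult_left_mono) auto
    have "summable (\<lambda>n. (\<beta> * b) ^ n / fact n)"
      using summable_exp_generic[of "\<beta> * b"] by (simp add: divide_inverse mult.commute)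
    then show "summable (\<lambda>n. (\<beta> * b) ^ n / fact n * norm x0)" by (rule summable_mult2)
  qed
  show ?thesis
  proof (rule that[of y])
    show cy: "continuous_on {0..} y"
    proof (rule continuous_on_atLeastI)
      fix b :: real
      show "continuous_on {0..b} y"
        by (rule uniform_limit_theorem[OF _ unif])
          (auto intro!: always_eventually continuous_on_sum continuous_on_subset[OF cE sub])
    qed
    fix t :: real assume t: "t \<ge> 0"
    have "uniform_limit {0..t} (\<lambda>n \<tau>. F \<tau> (\<Sum>i<n. E i \<tau>)) (\<lambda>\<tau>. F \<tau> (y \<tau>)) sequentially"
    proof (rule uniform_limitI)
      fix e :: real assume "e > 0"
      then have "\<forall>\<^sub>F n in sequentially. \<forall>\<tau>\<in>{0..t}. dist (\<Sum>i<n. E i \<tau>) (y \<tau>) < e / (\<beta> + 1)"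
        using \<open>\<beta> \<ge> 0\<close> by (intro uniform_limitD[OF unif]) auto
      then show "\<forall>\<^sub>F n in sequentially. \<forall>\<tau>\<in>{0..t}. dist (F \<tau> (\<Sum>i<n. E i \<tau>)) (F \<tau> (y \<tau>)) < e"
      proof eventually_elim
        case (elim n)
        show ?case
        proof
          fix \<tau> assume \<tau>: "\<tau> \<in> {0..t}"
          have "dist (F \<tau> (\<Sum>i<n. E i \<tau>)) (F \<tau> (y \<tau>)) \<le> \<beta> * dist (\<Sum>i<n. E i \<tau>) (y \<tau>)"
            unfolding dist_norm linear_diff[OF bounded_linear.linear[OF lin], symmetric] by (rule bound)
          also have "\<dots> \<le> \<beta> * (e / (\<beta> + 1))"
            using elim \<tau> \<open>\<beta> \<ge> 0\<close> by (intro mult_left_mono) (auto intro: less_imp_le)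
          also have "\<dots> < e" using \<open>e > 0\<close> \<open>\<beta> \<ge> 0\<close> by (simp add: field_simps)
          finally show "dist (F \<tau> (\<Sum>i<n. E i \<tau>)) (F \<tau> (y \<tau>)) < e" .
        qed
      qed
    qed
    then obtain I J where I: "\<And>n. ((\<lambda>\<tau>. F \<tau> (\<Sum>i<n. E i \<tau>)) has_integral I n) {0..t}"
      and J: "((\<lambda>\<tau>. F \<tau> (y \<tau>)) has_integral J) {0..t}" and IJ: "I \<longlonglongrightarrow> J"
      by (rule uniform_limit_integral)
        (auto intro!: continuous_on_subset[OF cont sub] continuous_on_sum cE)
    \<comment> \<open>Applying \<open>F\<close> and integrating shifts the index by one; the term
      that is lost is \<open>E 0 t = x0\<close>.\<close>
    have "I n = (\<Sum>i<Suc n. E i t) - x0" for n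
    proof -
      have "I n = integral {0..t} (\<lambda>\<tau>. \<Sum>i<n. F \<tau> (E i \<tau>))"
        using integral_unique[OF I[of n]] by (simp add: linear_sum[OF bounded_linear.linear[OF lin]])
      also have "\<dots> = (\<Sum>i<n. E (Suc i) t)"
        by (simp add: integral_sum iFE ES)
      also have "\<dots> = (\<Sum>i<Suc n. E i t) - x0"
        by (simp add: sum.lessThan_Suc_shift E0 del: sum.lessThan_Suc)
      finally show ?thesis .
    qed
    moreover have "(\<lambda>n. (\<Sum>i<Suc n. E i t) - x0) \<longlonglongrightarrow> y t - x0"
      using tendsto_uniform_limitI[OF unif[of t]] t
      by (intro tendsto_diff tendsto_const LIMSEQ_Suc[of "\<lambda>n. \<Sum>i<n. E i t"]) auto
    ultimately have "I \<longlonglongrightarrow> y t - x0" by presburger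
    then have "J = y t - x0" by (rule LIMSEQ_unique[OF IJ])
    with J show "((\<lambda>\<tau>. F \<tau> (y \<tau>)) has_integral (y t - x0)) {0..t}" by simp
  qed
qed

lemma has_integral_imp_vector_derivative:
  fixes f :: "real \<Rightarrow> 'a::banach"
  assumes "continuous_on {0..} f" "\<And>t. t \<ge> 0 \<Longrightarrow> (f has_integral (y t - y0)) {0..t}" "t > 0"
  shows "(y has_vector_derivative f t) (at t)"
proof -
  have "((\<lambda>u. integral {0..u} f) has_vector_derivative f t) (at t within {0..t+1})"
    by (rule integral_has_vector_derivative[OF continuous_on_subset[OF assms(1)]]) (use assms(3) in auto)
  then have "((\<lambda>u. integral {0..u} f + y0) has_vector_derivative f t) (at t)"
    using assms(3) by (simp add: at_within_Icc_at has_vector_derivative_add_const)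
  then show ?thesis
    by (rule has_vector_derivative_transform_within_open[where S = "{0<..}"])
      (use assms(3) integral_unique[OF assms(2)] in auto)
qed

text \<open>In the interaction picture \<open>y t = U (- t) (x t)\<close>, where \<open>U\<close> is the unitary group with
  frequencies \<open>lam\<close>, the equation has bounded coefficients.\<close>

lemma mode_solution_exists:
  assumes T: "bounded_linear T"
  obtains x where "mode_solution lam T x" "x 0 = x0"
proof -
  define U where "U = (\<lambda>t. dop (\<lambda>k. cis (lam k * t)))"
  have U1: "cmod (cis (lam k * t)) \<le> 1" for t k by simp

  have coU: "coord (U t y) k = cis (lam k * t) * coord y k" for t y k
    unfolding U_def by (rule coord_dop[OF U1])
  have blU: "bounded_linear (U t)" for t unfolding U_def by (rule bounded_linear_dop[OF U1])
  have nU: "norm (U t y) \<le> norm y" for t y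
    using norm_dop_le[of "\<lambda>k. cis (lam k * t)" 1 y] by (simp add: U_def)
  \<comment> \<open>The factor \<open>c\<close> serves both directions of time: 1 for
    \<open>U t\<close> and -1 for \<open>U (- t)\<close>.\<close>
  have cU: "continuous_on {0..} (\<lambda>t. U (c * t) (y t))" if "continuous_on {0..} y" for y and c :: real
    unfolding continuous_on_def
  proof
    fix t :: real assume t: "t \<in> {0..}"
    show "((\<lambda>t. U (c * t) (y t)) \<longlongrightarrow> U (c * t) (y t)) (at t within {0..})"
      unfolding U_def
      by (rule tendsto_dop[where C = 1]) (use that t in \<open>auto simp: continuous_on_def cis_conv_exp intro!: tendsto_intros\<close>)
  qed
  obtain \<beta> where \<beta>: "\<beta> \<ge> 0" "\<And>y. norm (T y) \<le> norm y * \<beta>"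
    using bounded_linear.nonneg_bounded[OF T] by auto
  define F where "F = (\<lambda>t y. - U (- t) (T (U t y)))"
  obtain y where cy: "continuous_on {0..} y"
    and y: "\<And>t. t \<ge> 0 \<Longrightarrow> ((\<lambda>\<tau>. F \<tau> (y \<tau>)) has_integral (y t - x0)) {0..t}"
  proof (rule linear_integral_equation[of F \<beta> x0])
    show "bounded_linear (F t)" for t
      unfolding F_def
      by (intro bounded_linear_minus bounded_linear_compose[OF blU] bounded_linear_compose[OF T] blU)
    show "norm (F t y) \<le> \<beta> * norm y" for t y
    proof -
      have "norm (F t y) \<le> norm (T (U t y))" by (simp add: F_def nU)
      also have "\<dots> \<le> norm (U t y) * \<beta>" by (rule \<beta>)
      also have "\<dots> \<le> norm y * \<beta>" by (intro mult_right_mono nU \<beta>)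
      finally show ?thesis by (simp add: mult.commute)
    qed
    show "continuous_on {0..} (\<lambda>t. F t (y t))" if "continuous_on {0..} y" for y
      unfolding F_def
      using cU[OF bounded_linear.continuous_on[OF T cU[OF that, of 1]], of "-1"]
      by (simp add: continuous_on_minus)
  qed (use \<beta> in auto)
  have cF: "continuous_on {0..} (\<lambda>t. F t (y t))"
    unfolding F_def
    using cU[OF bounded_linear.continuous_on[OF T cU[OF cy, of 1]], of "-1"]
    by (simp add: continuous_on_minus)
  have y0: "y 0 = x0" using integral_unique[OF y[of 0]] by simp
  define x where "x = (\<lambda>t. U t (y t))"
  show ?thesis
  proof (rule that)
    have "coord (x 0) k = coord x0 k" for k by (simp add: x_def coU y0)
    then show "x 0 = x0" by (rule ell2_eqI)
    show "mode_solution lam T x"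
      unfolding mode_solution_def
    proof (intro conjI allI impI)
      show "continuous_on {0..} x" using cU[OF cy, of 1] by (simp add: x_def)
      fix t :: real and k assume t: "t > 0"
      have dy: "((\<lambda>t. coord (y t) k) has_vector_derivative coord (F t (y t)) k) (at t)"
        by (rule bounded_linear.has_vector_derivative[OF bounded_linear_coord
              has_integral_imp_vector_derivative[OF cF y t]])
      have dc: "((\<lambda>t. cis (lam k * t)) has_vector_derivative (\<i> * of_real (lam k)) * cis (lam k * t)) (at t)"
        unfolding cis_conv_exp
        by (auto intro!: derivative_eq_intros has_vector_derivative_real_field)
      have "((\<lambda>t. cis (lam k * t) * coord (y t) k) has_vector_derivative
          (cis (lam k * t) * coord (F t (y t)) k + (\<i> * of_real (lam k)) * cis (lam k * t) * coord (y t) k)) (at t)"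
        by (rule has_vector_derivative_mult[OF dc dy])
      moreover have "cis (lam k * t) * coord (F t (y t)) k = - coord (T (x t)) k"
        by (simp add: F_def coU x_def cis_mult mult.assoc[symmetric])
      ultimately show "((\<lambda>t. coord (x t) k) has_vector_derivative
          \<i> * of_real (lam k) * coord (x t) k - coord (T (x t)) k) (at t)"
        by (simp add: x_def coU mult.assoc)
    qed
  qed
qed

text \<open>A multiplier \<open>d\<close> that tames the frequencies makes the right-hand side
  continuous in norm, and its vector-valued integral is identified coordinate by coordinate. With
  \<open>d\<close> the loss of \<open>r\<close> derivatives, this is the time derivative in
  \<open>Hs (s - r)\<close>.\<close>

lemma mode_solution_weak_derivative:
  assumes sol: "mode_solution lam T x" and T: "bounded_linear T"
    and d: "\<And>k. cmod (d k) \<le> C" "\<And>k. cmod (d k * (\<i> * of_real (lam k))) \<le> C" and "t > 0"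
  shows "((\<lambda>t. dop d (x t)) has_vector_derivative
      dop (\<lambda>k. d k * (\<i> * of_real (lam k))) (x t) - dop d (T (x t))) (at t)"
proof -
  define f where "f = (\<lambda>t. dop (\<lambda>k. d k * (\<i> * of_real (lam k))) (x t) - dop d (T (x t)))"
  note bl = bounded_linear_dop[of d, OF d(1)] bounded_linear_dop[of "\<lambda>k. d k * (\<i> * of_real (lam k))", OF d(2)]
  have cx: "continuous_on {0..} x" using sol by (simp add: mode_solution_def)
  have cf: "continuous_on {0..} f"
    unfolding f_def
    by (intro continuous_on_diff bounded_linear.continuous_on[OF bl(1)]
        bounded_linear.continuous_on[OF bl(2)] bounded_linear.continuous_on[OF T] cx)
  have "(f has_integral (dop d (x t) - dop d (x 0))) {0..t}" if "t \<ge> 0" for t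
  proof -
    have sub: "{0..t} \<subseteq> {0..}" by auto
    have int: "(f has_integral integral {0..t} f) {0..t}"
      by (intro integrable_integral integrable_continuous_real continuous_on_subset[OF cf sub])
    have "integral {0..t} f = dop d (x t) - dop d (x 0)"
    proof (rule ell2_eqI)
      fix k
      have "((\<lambda>\<tau>. coord (f \<tau>) k) has_integral coord (dop d (x t)) k - coord (dop d (x 0)) k) {0..t}"
      proof (rule fundamental_theorem_of_calculus_interior[OF that])
        show "continuous_on {0..t} (\<lambda>t. coord (dop d (x t)) k)"
          by (intro continuous_on_coord bounded_linear.continuous_on[OF bl(1)] continuous_on_subset[OF cx sub])
        fix \<tau> assume "\<tau> \<in> {0<..<t}"
        then have "((\<lambda>t. coord (x t) k) has_vector_derivative
             (\<i> * of_real (lam k) * coord (x \<tau>) k - coord (T (x \<tau>)) k)) (at \<tau>)"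
          using sol by (simp add: mode_solution_def)
        from bounded_linear.has_vector_derivative[OF bounded_linear_mult_right this, of "d k"]
        show "((\<lambda>t. coord (dop d (x t)) k) has_vector_derivative coord (f \<tau>) k) (at \<tau>)"
          unfolding f_def coord_simps coord_dop[of d, OF d(1)]
            coord_dop[of "\<lambda>k. d k * (\<i> * of_real (lam k))", OF d(2)]
          by (simp add: algebra_simps)
      qed
      moreover have "((\<lambda>\<tau>. coord (f \<tau>) k) has_integral coord (integral {0..t} f) k) {0..t}"
        using has_integral_linear[OF int bounded_linear_coord] by (simp add: o_def)
      ultimately show "coord (integral {0..t} f) k = coord (dop d (x t) - dop d (x 0)) k"
        unfolding coord_simps by (rule has_integral_unique[symmetric])
    qed
    with int show ?thesis by simp
  qed
  from has_integral_imp_vector_derivative[OF cf this \<open>t > 0\<close>] show ?thesis by (simp add: f_def)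
qed

section \<open>Periodic test functions\<close>

lemma test_periodic: "\<phi> \<in> \<P> \<Longrightarrow> \<phi> (x + 2 * pi) = \<phi> x"
  by (simp add: test_functions_def)

lemma test_has_derivative: "\<phi> \<in> \<P> \<Longrightarrow> (\<phi> has_vector_derivative Dx \<phi> x) (at x)"
  using vector_derivative_works[of \<phi> "at x"] by (auto simp: test_functions_def Dx_def dest: spec[of _ 0])

lemma Dx_eqI: "(\<And>x. (f has_vector_derivative f' x) (at x)) \<Longrightarrow> Dx f = f'"
  by (auto simp: Dx_def vector_derivative_at)

text \<open>By induction all iterated derivatives remain in \<open>S\<close>. Smoothness then needs
  no formula for the n-th derivative, only a set closed under one differentiation.\<close>

lemma test_coinduct:
  assumes "f \<in> S"
    and step: "\<And>f. f \<in> S \<Longrightarrow> (\<forall>x. f (x + 2 * pi) = f x) \<and> (\<exists>f'\<in>S. \<forall>x. (f has_vector_derivative f' x) (at x))"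
  shows "f \<in> \<P>"
proof -
  have "(Dx ^^ n) f \<in> S" for n
  proof (induction n)
    case (Suc n)
    from step[OF this] show ?case using Dx_eqI by fastforce
  qed (simp add: assms(1))
  then have "(Dx ^^ n) f differentiable (at x)" for n x
    using step differentiableI_vector by blast
  then show ?thesis using step[OF assms(1)] by (simp add: test_functions_def)
qed

lemma test_Dx: "\<phi> \<in> \<P> \<Longrightarrow> Dx \<phi> \<in> \<P>"
proof -
  assume \<phi>: "\<phi> \<in> \<P>"
  have "Dx \<phi> (x + 2 * pi) = Dx \<phi> x" for x
  proof -
    have "((\<phi> \<circ> (\<lambda>x. x + 2 * pi)) has_vector_derivative (1 *\<^sub>R Dx \<phi> (x + 2 * pi))) (at x)"
      by (rule vector_diff_chain_at) (auto intro!: derivative_eq_intros test_has_derivative[OF \<phi>])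
    moreover have "\<phi> \<circ> (\<lambda>x. x + 2 * pi) = \<phi>" using test_periodic[OF \<phi>] by auto
    ultimately show ?thesis
      using test_has_derivative[OF \<phi>, of x] vector_derivative_unique_at by fastforce
  qed
  moreover have "(Dx ^^ n) (Dx \<phi>) differentiable (at x)" for n x
  proof -
    have "(Dx ^^ Suc n) \<phi> differentiable (at x)" using \<phi> unfolding test_functions_def by blast
    then show ?thesis by (simp only: funpow_Suc_right o_apply)
  qed
  ultimately show "Dx \<phi> \<in> \<P>" by (simp add: test_functions_def)
qed

lemma test_funpow_Dx: "\<phi> \<in> \<P> \<Longrightarrow> (Dx ^^ n) \<phi> \<in> \<P>"
  by (induction n) (auto simp: test_Dx)

lemma test_continuous: "\<phi> \<in> \<P> \<Longrightarrow> continuous_on S \<phi>"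
  by (intro continuous_at_imp_continuous_on ballI has_vector_derivative_continuous[OF test_has_derivative])

lemma test_bounded: "\<phi> \<in> \<P> \<Longrightarrow> bounded (range \<phi>)"
proof -
  assume \<phi>: "\<phi> \<in> \<P>"
  interpret periodic_fun_simple \<phi> "2 * pi"
    by unfold_locales (rule test_periodic[OF \<phi>])
  have "range \<phi> \<subseteq> \<phi> ` {0..2 * pi}"
  proof
    fix y assume "y \<in> range \<phi>"
    then obtain x where x: "y = \<phi> x" by blast
    define n where "n = \<lfloor>x / (2 * pi)\<rfloor>"
    have "y = \<phi> (x - of_int n * (2 * pi))" by (simp add: x minus_of_int)
    moreover have "of_int n \<le> x / (2 * pi)" "x / (2 * pi) < of_int n + 1"
      by (simp_all add: n_def)
    then have "x - of_int n * (2 * pi) \<in> {0..2 * pi}"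
      by (simp add: field_simps)
    ultimately show "y \<in> \<phi> ` {0..2 * pi}" by blast
  qed
  moreover have "bounded (\<phi> ` {0..2 * pi})"
    by (intro compact_imp_bounded compact_continuous_image test_continuous[OF \<phi>]) auto
  ultimately show ?thesis using bounded_subset by blast
qed

lemma test_const: "(\<lambda>_. c) \<in> \<P>"
  by (rule test_coinduct[of _ "range (\<lambda>c _. c)"]) (auto intro!: bexI[of _ "\<lambda>_. 0"] derivative_eq_intros)

text \<open>A product is not stable under differentiation, but sums of products are, which is what
  \<open>test_coinduct\<close> needs.\<close>

inductive_set test_products :: "(real \<Rightarrow> complex) set" where
  prod: "f \<in> \<P> \<Longrightarrow> g \<in> \<P> \<Longrightarrow> (\<lambda>x. f x * g x) \<in> test_products"
| add: "f \<in> test_products \<Longrightarrow> g \<in> test_products \<Longrightarrow> (\<lambda>x. f x + g x) \<in> test_products"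

lemma test_products_subset: "test_products \<subseteq> \<P>"
proof
  fix f assume "f \<in> test_products"
  then show "f \<in> \<P>"
  proof (rule test_coinduct)
    fix f assume "f \<in> test_products"
    then show "(\<forall>x. f (x + 2 * pi) = f x) \<and>
        (\<exists>f'\<in>test_products. \<forall>x. (f has_vector_derivative f' x) (at x))"
    proof (induction rule: test_products.induct)
      case (prod f g)
      have 1: "(\<lambda>x. f x * Dx g x + Dx f x * g x) \<in> test_products"
        by (intro test_products.intros test_Dx prod)
      have 2: "((\<lambda>x. f x * g x) has_vector_derivative f x * Dx g x + Dx f x * g x) (at x)" for x
        by (intro has_vector_derivative_mult test_has_derivative prod)
      show ?case using prod
        by (intro conjI bexI[OF _ 1] allI 2) (simp add: test_periodic)
    next
      case (add f g)
      then obtain f' g' where "f' \<in> test_products" "g' \<in> test_products"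
        "\<And>x. (f has_vector_derivative f' x) (at x)" "\<And>x. (g has_vector_derivative g' x) (at x)"
        by blast
      then show ?case using add
        by (auto intro!: bexI[of _ "\<lambda>x. f' x + g' x"] test_products.add has_vector_derivative_add)
    qed
  qed
qed

lemma test_mult: "f \<in> \<P> \<Longrightarrow> g \<in> \<P> \<Longrightarrow> (\<lambda>x. f x * g x) \<in> \<P>"
  using test_products.prod test_products_subset by blast

lemma test_add:
  assumes "f \<in> \<P>" "g \<in> \<P>"
  shows "(\<lambda>x. f x + g x) \<in> \<P>"
proof -
  have "(\<lambda>x. f x * 1 + g x * 1) \<in> test_products"
    by (intro test_products.intros test_const assms)
  then show ?thesis using test_products_subset by auto
qed

lemma test_scale: "f \<in> \<P> \<Longrightarrow> (\<lambda>x. c * f x) \<in> \<P>"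
  by (rule test_mult[OF test_const])

lemma test_diff: "f \<in> \<P> \<Longrightarrow> g \<in> \<P> \<Longrightarrow> (\<lambda>x. f x - g x) \<in> \<P>"
  using test_add[OF _ test_scale[of g "-1"], of f] by simp

lemma test_sum: "(\<And>k. k \<in> F \<Longrightarrow> f k \<in> \<P>) \<Longrightarrow> (\<lambda>x. \<Sum>k\<in>F. f k x) \<in> \<P>"
  by (induction F rule: infinite_finite_induct) (auto intro: test_const test_add)

lemma test_cnj: "f \<in> \<P> \<Longrightarrow> (\<lambda>x. cnj (f x)) \<in> \<P>"
  by (rule test_coinduct[of _ "(\<lambda>f x. cnj (f x)) ` \<P>"])
    (auto simp: test_periodic intro!: test_Dx bounded_linear.has_vector_derivative[OF bounded_linear_cnj] test_has_derivative)

section \<open>Trigonometric monomials and convergence of test functions\<close>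

definition trig :: "int \<Rightarrow> real \<Rightarrow> complex" where
  "trig k x = exp (\<i> * of_int k * of_real x)"

lemma trig_add: "trig (j + k) x = trig j x * trig k x"
  by (simp add: trig_def exp_add ring_distribs)

lemma trig_0 [simp]: "trig 0 x = 1" "trig k 0 = 1"
  by (simp_all add: trig_def)

lemma norm_trig [simp]: "cmod (trig k x) = 1"
  by (simp add: trig_def)

lemma trig_cnj: "cnj (trig k x) = trig (- k) x"
  by (simp add: trig_def exp_cnj)

lemma trig_nonzero [simp]: "trig k x \<noteq> 0"
  by (simp add: trig_def)

lemma trig_period: "trig k (x + 2 * pi) = trig k x"
proof -
  have "trig k (x + 2 * pi) = trig k x * exp (\<i> * of_int k * (of_real pi * 2))"
    by (simp add: trig_def ring_distribs exp_add mult_ac)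
  also have "exp (\<i> * of_int k * (of_real pi * 2)) = 1"
    using exp_integer_2pi[of "of_int k"] by (simp add: mult_ac)
  finally show ?thesis by simp
qed

lemma trig_2pi [simp]: "trig k (2 * pi) = 1"
  using trig_period[of k 0] by simp

lemma trig_derivative: "(trig k has_vector_derivative \<i> * of_int k * trig k x) (at x within S)"
  unfolding trig_def[abs_def]
  by (rule has_vector_derivative_real_field) (auto intro!: derivative_eq_intros)

lemma test_trig: "trig k \<in> \<P>"
proof (rule test_coinduct[of _ "range (\<lambda>c x. c * trig k x)"])
  show "trig k \<in> range (\<lambda>c x. c * trig k x)" by (auto intro!: image_eqI[of _ _ 1])
  fix f assume "f \<in> range (\<lambda>c x. c * trig k x)"
  then obtain c where f: "f = (\<lambda>x. c * trig k x)" by blast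
  have "(f has_vector_derivative (c * (\<i> * of_int k)) * trig k x) (at x)" for x
    unfolding f by (auto intro!: derivative_eq_intros trig_derivative)
  then show "(\<forall>x. f (x + 2 * pi) = f x) \<and>
      (\<exists>f'\<in>range (\<lambda>c x. c * trig k x). \<forall>x. (f has_vector_derivative f' x) (at x))"
    by (auto simp: f trig_period intro!: exI[of _ "c * (\<i> * of_int k)"])
qed

lemma Dx_add: "f \<in> \<P> \<Longrightarrow> g \<in> \<P> \<Longrightarrow> Dx (\<lambda>x. f x + g x) = (\<lambda>x. Dx f x + Dx g x)"
  by (intro Dx_eqI has_vector_derivative_add test_has_derivative)

lemma Dx_mult: "f \<in> \<P> \<Longrightarrow> g \<in> \<P> \<Longrightarrow> Dx (\<lambda>x. f x * g x) = (\<lambda>x. f x * Dx g x + Dx f x * g x)"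
  by (intro Dx_eqI has_vector_derivative_mult test_has_derivative)

lemma Dx_scale: "f \<in> \<P> \<Longrightarrow> Dx (\<lambda>x. c * f x) = (\<lambda>x. c * Dx f x)"
  by (intro Dx_eqI bounded_linear.has_vector_derivative[OF bounded_linear_mult_right] test_has_derivative)

lemma Dx_trig: "Dx (trig k) = (\<lambda>x. \<i> * of_int k * trig k x)"
  by (intro Dx_eqI trig_derivative)

lemma funpow_Dx_add:
  "f \<in> \<P> \<Longrightarrow> g \<in> \<P> \<Longrightarrow> (Dx ^^ n) (\<lambda>x. f x + g x) = (\<lambda>x. (Dx ^^ n) f x + (Dx ^^ n) g x)"
  by (induction n) (auto simp: Dx_add test_funpow_Dx)

lemma funpow_Dx_scale: "f \<in> \<P> \<Longrightarrow> (Dx ^^ n) (\<lambda>x. c * f x) = (\<lambda>x. c * (Dx ^^ n) f x)"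
  by (induction n) (auto simp: Dx_scale test_funpow_Dx)

lemma funpow_Dx_diff:
  "f \<in> \<P> \<Longrightarrow> g \<in> \<P> \<Longrightarrow> (Dx ^^ n) (\<lambda>x. f x - g x) = (\<lambda>x. (Dx ^^ n) f x - (Dx ^^ n) g x)"
  using funpow_Dx_add[OF _ test_scale[of g "-1"], of f n] funpow_Dx_scale[of g n "-1"] by simp

lemma funpow_Dx_trig: "(Dx ^^ n) (trig k) = (\<lambda>x. (\<i> * of_int k) ^ n * trig k x)"
proof (induction n)
  case (Suc n)
  then show ?case by (simp add: Dx_scale[OF test_trig] Dx_trig) (simp add: mult_ac)
qed simp

lemma funpow_Dx_sum:
  assumes "\<And>k. k \<in> F \<Longrightarrow> f k \<in> \<P>"
  shows "(Dx ^^ n) (\<lambda>x. \<Sum>k\<in>F. f k x) = (\<lambda>x. \<Sum>k\<in>F. (Dx ^^ n) (f k) x)"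
  using assms
proof (induction F rule: infinite_finite_induct)
  case (insert k F)
  then show ?case by (simp add: funpow_Dx_add test_sum)
qed (use funpow_Dx_scale[OF test_const, of n 0 0] in \<open>simp_all\<close>)

text \<open>The premise of sequential continuity in the definition of periodic distributions,
  bundled so that its stability can be stated.\<close>

definition test_tendsto :: "(nat \<Rightarrow> real \<Rightarrow> complex) \<Rightarrow> (real \<Rightarrow> complex) \<Rightarrow> bool" where
  "test_tendsto \<Phi> \<phi> \<longleftrightarrow> (\<forall>n. \<Phi> n \<in> \<P>) \<and> \<phi> \<in> \<P>
     \<and> (\<forall>j. uniform_limit UNIV (\<lambda>n. (Dx ^^ j) (\<Phi> n)) ((Dx ^^ j) \<phi>) sequentially)"

lemma test_tendsto_Dx:
  assumes "test_tendsto \<Phi> \<phi>"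
  shows "test_tendsto (\<lambda>n. Dx (\<Phi> n)) (Dx \<phi>)"
proof -
  have "uniform_limit UNIV (\<lambda>n. (Dx ^^ Suc j) (\<Phi> n)) ((Dx ^^ Suc j) \<phi>) sequentially" for j
    using assms unfolding test_tendsto_def by blast
  then have "uniform_limit UNIV (\<lambda>n. (Dx ^^ j) (Dx (\<Phi> n))) ((Dx ^^ j) (Dx \<phi>)) sequentially" for j
    by (simp only: funpow_Suc_right o_apply)
  then show ?thesis using assms by (auto simp: test_tendsto_def test_Dx)
qed

lemma test_tendsto_mult:
  assumes "test_tendsto \<Phi> \<phi>" "f \<in> \<P>"
  shows "test_tendsto (\<lambda>n x. f x * \<Phi> n x) (\<lambda>x. f x * \<phi> x)"
proof -
  have "uniform_limit UNIV (\<lambda>n. (Dx ^^ j) (\<lambda>x. f x * \<Phi> n x)) ((Dx ^^ j) (\<lambda>x. f x * \<phi> x)) sequentially" for j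
    using assms
  \<comment> \<open>The induction ranges over all \<open>f\<close> and \<open>\<Phi>\<close>, as the
    Leibniz rule leads to the pairs \<open>f\<close>, \<open>Dx (\<Phi> n)\<close> and
    \<open>Dx f\<close>, \<open>\<Phi> n\<close>.\<close>
  proof (induction j arbitrary: f \<Phi> \<phi>)
    case 0
    then have "uniform_limit UNIV \<Phi> \<phi> sequentially" "\<phi> \<in> \<P>"
      unfolding test_tendsto_def by (auto dest: spec[of _ 0])
    with 0 show ?case
      using uniform_lim_mult[where S = UNIV and f = "\<lambda>_. f" and l = f and F = sequentially and g = \<Phi> and m = \<phi>]
      by (simp add: test_bounded uniform_limit_const)
  next
    case (Suc j)
    have \<Phi>: "\<Phi> n \<in> \<P>" "\<phi> \<in> \<P>" for n using Suc.prems by (auto simp: test_tendsto_def)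
    have *: "(Dx ^^ Suc j) (\<lambda>x. f x * g x) = (\<lambda>x. (Dx ^^ j) (\<lambda>x. f x * Dx g x) x + (Dx ^^ j) (\<lambda>x. Dx f x * g x) x)"
      if "g \<in> \<P>" for g
      using that Suc.prems(2)
      by (simp add: Dx_mult funpow_Dx_add test_mult test_Dx funpow_Suc_right del: funpow.simps)
    show ?case
      unfolding *[OF \<Phi>(1)] *[OF \<Phi>(2)]
      by (intro uniform_limit_add Suc.IH test_tendsto_Dx Suc.prems test_Dx)
  qed
  then show ?thesis using assms by (auto simp: test_tendsto_def test_mult)
qed

section \<open>Fourier series of test functions\<close>

abbreviation hat :: "(real \<Rightarrow> complex) \<Rightarrow> int \<Rightarrow> complex" where
  "hat f k \<equiv> fourier_coeff (dist_of f) k"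

lemma fourier_coeff_trig: "fourier_coeff v k = v (trig (- k)) / of_real (2 * pi)"
proof -
  have "(\<lambda>x. exp (- (\<i> * of_int k * of_real x))) = trig (- k)" by (auto simp: trig_def)
  then show ?thesis by (simp add: fourier_coeff_def)
qed

lemma hat_eq: "hat f k = integral {0..2 * pi} (\<lambda>x. f x * trig (- k) x) / of_real (2 * pi)"
  by (simp add: fourier_coeff_trig dist_of_def test_trig)

lemma integrable_mult_trig:
  "continuous_on {0..2 * pi} f \<Longrightarrow> (\<lambda>x. f x * trig k x) integrable_on {0..2 * pi}"
  by (intro integrable_continuous_real continuous_on_mult test_continuous[OF test_trig])

lemma hat_add:
  "continuous_on {0..2 * pi} f \<Longrightarrow> continuous_on {0..2 * pi} g \<Longrightarrow> hat (\<lambda>x. f x + g x) k = hat f k + hat g k"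
  by (simp add: hat_eq ring_distribs integral_add integrable_mult_trig add_divide_distrib)

lemma hat_scale: "hat (\<lambda>x. c * f x) k = c * hat f k"
  by (simp add: hat_eq mult.assoc)

lemma hat_diff:
  "continuous_on {0..2 * pi} f \<Longrightarrow> continuous_on {0..2 * pi} g \<Longrightarrow> hat (\<lambda>x. f x - g x) k = hat f k - hat g k"
  by (simp add: hat_eq ring_distribs integral_diff integrable_mult_trig diff_divide_distrib)

lemma hat_mult_trig: "hat (\<lambda>x. f x * trig j x) k = hat f (k - j)"
proof -
  have "f x * trig j x * trig (- k) x = f x * trig (- (k - j)) x" for x
    by (simp add: mult.assoc flip: trig_add)
  then show ?thesis by (simp only: hat_eq)
qed

lemma integral_trig: "(trig k has_integral (if k = 0 then 2 * of_real pi else 0)) {0..2 * pi}"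
proof (cases "k = 0")
  case True
  have "((\<lambda>x. 1 :: complex) has_integral (2 * pi - 0) *\<^sub>R 1) {0..2 * pi}"
    by (rule has_integral_const_real[THEN has_integral_eq_rhs]) simp
  with True show ?thesis by (simp add: trig_def[abs_def] scaleR_conv_of_real)
next
  case False
  have "((\<lambda>x. trig k x) has_integral (trig k (2 * pi) / (\<i> * of_int k) - trig k 0 / (\<i> * of_int k))) {0..2 * pi}"
  proof (rule fundamental_theorem_of_calculus)
    fix x
    have "((\<lambda>x. trig k x / (\<i> * of_int k)) has_vector_derivative (\<i> * of_int k * trig k x) / (\<i> * of_int k)) (at x within {0..2 * pi})"
      by (rule has_vector_derivative_divide[OF trig_derivative])
    then show "((\<lambda>x. trig k x / (\<i> * of_int k)) has_vector_derivative trig k x) (at x within {0..2 * pi})"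
      using False by simp
  qed simp
  with False show ?thesis by simp
qed

lemma hat_trig: "hat (trig j) k = (if k = j then 1 else 0)"
proof -
  have "trig j x * trig (- k) x = trig (j - k) x" for x by (simp flip: trig_add)
  then show ?thesis using integral_unique[OF integral_trig[of "j - k"]] by (simp add: hat_eq)
qed

lemma hat_const: "hat (\<lambda>_. c) k = (if k = 0 then c else 0)"
  using hat_scale[of c "trig 0" k] by (simp add: hat_trig)

lemma hat_sum:
  assumes "\<And>k. k \<in> F \<Longrightarrow> f k \<in> \<P>"
  shows "hat (\<lambda>x. \<Sum>k\<in>F. f k x) j = (\<Sum>k\<in>F. hat (f k) j)"
  using assms
  by (induction F rule: infinite_finite_induct) (auto simp: hat_const hat_add test_continuous test_sum)

lemma norm_hat_le:
  assumes "continuous_on {0..2 * pi} f" "\<And>x. cmod (f x) \<le> A"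
  shows "cmod (hat f k) \<le> A"
proof -
  have "norm (integral {0..2 * pi} (\<lambda>x. f x * trig (- k) x)) \<le> A * (2 * pi - 0)"
    by (rule integral_bound)
      (use assms in \<open>auto simp: norm_mult intro!: continuous_on_mult test_continuous[OF test_trig]\<close>)
  then show ?thesis by (simp add: hat_eq norm_divide norm_mult field_simps)
qed

lemma hat_Dx:
  assumes "f \<in> \<P>"
  shows "hat (Dx f) k = \<i> * of_int k * hat f k"
proof -
  have 1: "((\<lambda>x. f x * (\<i> * of_int (- k) * trig (- k) x) + Dx f x * trig (- k) x) has_integral
      (f (2 * pi) * trig (- k) (2 * pi) - f 0 * trig (- k) 0)) {0..2 * pi}"
    by (rule fundamental_theorem_of_calculus[OF _ has_vector_derivative_mult[OF
            has_vector_derivative_at_within[OF test_has_derivative[OF assms]] trig_derivative]]) simp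
  have 2: "f (2 * pi) * trig (- k) (2 * pi) - f 0 * trig (- k) 0 = 0"
    using test_periodic[OF assms, of 0] by simp
  have 3: "f x * (\<i> * of_int (- k) * trig (- k) x) = (\<i> * of_int (- k)) * (f x * trig (- k) x)" for x
    by (simp add: mult_ac)
  have "((\<lambda>x. (\<i> * of_int (- k)) * (f x * trig (- k) x) + Dx f x * trig (- k) x) has_integral 0) {0..2 * pi}"
    using 1 unfolding 2 3 .
  moreover have "((\<lambda>x. (\<i> * of_int (- k)) * (f x * trig (- k) x) + Dx f x * trig (- k) x) has_integral
      ((\<i> * of_int (- k)) * integral {0..2 * pi} (\<lambda>x. f x * trig (- k) x)
        + integral {0..2 * pi} (\<lambda>x. Dx f x * trig (- k) x))) {0..2 * pi}"
    by (intro has_integral_add has_integral_mult_right integrable_integral integrable_mult_trig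
        test_continuous test_Dx assms)
  ultimately have "(\<i> * of_int (- k)) * integral {0..2 * pi} (\<lambda>x. f x * trig (- k) x)
      + integral {0..2 * pi} (\<lambda>x. Dx f x * trig (- k) x) = 0"
    using has_integral_unique by blast
  then show ?thesis by (simp add: hat_eq field_simps add_eq_0_iff)
qed

lemma hat_funpow_Dx: "f \<in> \<P> \<Longrightarrow> hat ((Dx ^^ n) f) k = (\<i> * of_int k) ^ n * hat f k"
  by (induction n) (auto simp: hat_Dx test_funpow_Dx)

text \<open>The \<open>n\<close>-th derivative controls \<open>\<bar>k\<bar> ^ n * hat f k\<close>,
  and \<open>f\<close> itself covers small \<open>k\<close>. The explicit linear dependence on
  \<open>A\<close> later yields the continuity of \<open>synth\<close>.\<close>

lemma hat_decay:
  assumes f: "f \<in> \<P>" and A: "\<And>x. cmod (f x) \<le> A" "\<And>x. cmod ((Dx ^^ n) f x) \<le> A"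
  shows "cmod (hat f k) * (1 + \<bar>real_of_int k\<bar>) ^ n \<le> 2 ^ (n + 1) * A"
proof -
  have 1: "cmod (hat f k) \<le> A" by (rule norm_hat_le[OF test_continuous[OF f] A(1)])
  have "cmod (hat ((Dx ^^ n) f) k) \<le> A"
    by (rule norm_hat_le[OF test_continuous[OF test_funpow_Dx[OF f]] A(2)])
  then have 2: "\<bar>real_of_int k\<bar> ^ n * cmod (hat f k) \<le> A"
    by (simp add: hat_funpow_Dx[OF f] norm_mult norm_power)
  have "(1 + \<bar>real_of_int k\<bar>) ^ n \<le> (2 * max 1 \<bar>real_of_int k\<bar>) ^ n"
    by (intro power_mono) auto
  also have "\<dots> \<le> 2 ^ n * (1 + \<bar>real_of_int k\<bar> ^ n)"
    by (auto simp: power_mult_distrib max_def)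
  finally have "cmod (hat f k) * (1 + \<bar>real_of_int k\<bar>) ^ n
      \<le> cmod (hat f k) * (2 ^ n * (1 + \<bar>real_of_int k\<bar> ^ n))"
    by (intro mult_left_mono) auto
  also have "\<dots> = 2 ^ n * (cmod (hat f k) + \<bar>real_of_int k\<bar> ^ n * cmod (hat f k))"
    by (simp add: algebra_simps)
  also have "\<dots> \<le> 2 ^ n * (A + A)" using 1 2 by (intro mult_left_mono add_mono) auto
  finally show ?thesis by simp
qed

lemma test_bounded_funpow:
  assumes "f \<in> \<P>"
  obtains A where "A \<ge> 0" "\<And>x. cmod (f x) \<le> A" "\<And>x. cmod ((Dx ^^ n) f x) \<le> A"
proof -
  obtain A B where "\<And>x. cmod (f x) \<le> A" "\<And>x. cmod ((Dx ^^ n) f x) \<le> B"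
    using test_bounded[OF assms] test_bounded[OF test_funpow_Dx[OF assms, of n]]
    unfolding bounded_iff by blast
  then show ?thesis
    using that[of "max A B"] norm_ge_zero[of "f 0"] by (meson max.coboundedI1 max.coboundedI2 order_trans)
qed

lemma hat_rapid:
  assumes "f \<in> \<P>"
  obtains C where "C \<ge> 0" "\<And>k. cmod (hat f k) * (1 + \<bar>real_of_int k\<bar>) ^ n \<le> C"
proof -
  obtain A where "A \<ge> 0" "\<And>x. cmod (f x) \<le> A" "\<And>x. cmod ((Dx ^^ n) f x) \<le> A"
    using test_bounded_funpow[OF assms] by blast
  then show ?thesis using hat_decay[OF assms] that[of "2 ^ (n + 1) * A"] by simp
qed

lemma hat_abs_summable:
  assumes "f \<in> \<P>"
  shows "(\<lambda>k. cmod (hat f k)) summable_on UNIV"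
proof -
  obtain C where C: "C \<ge> 0" "\<And>k. cmod (hat f k) * (1 + \<bar>real_of_int k\<bar>)\<^sup>2 \<le> C"
    using hat_rapid[OF assms] by blast
  show ?thesis
  proof (rule summable_on_comparison_test)
    show "(\<lambda>k. C * inv_sq k) summable_on UNIV" by (rule summable_on_cmult_right[OF inv_sq_summable])
    show "cmod (hat f k) \<le> C * inv_sq k" for k
      using C(2)[of k] by (simp add: inv_sq_def field_simps add_pos_nonneg)
  qed auto
qed

text \<open>The remainder after projection to the modes in \<open>F\<close> is orthogonal to the
  projection and has nonnegative energy. Mere continuity is assumed, since \<open>q\<close> will be
  the quotient in \<open>chernoff\<close>.\<close>

lemma bessel:
  assumes q: "continuous_on {0..2 * pi} q" and F: "finite F"
  shows "(\<Sum>k\<in>F. (cmod (hat q k))\<^sup>2) \<le> integral {0..2 * pi} (\<lambda>x. (cmod (q x))\<^sup>2) / (2 * pi)"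
proof -
  define S where "S = (\<lambda>x. \<Sum>k\<in>F. hat q k * trig k x)"
  define r where "r = (\<lambda>x. q x - S x)"
  have cS: "continuous_on {0..2 * pi} S"
    unfolding S_def by (intro continuous_intros test_continuous test_trig)
  have cr: "continuous_on {0..2 * pi} r" unfolding r_def by (intro continuous_intros q cS)
  have hS: "hat S k = (if k \<in> F then hat q k else 0)" for k
    unfolding S_def
    by (subst hat_sum) (simp_all add: test_scale test_trig hat_scale hat_trig F if_distrib cong: if_cong)
  have orth: "integral {0..2 * pi} (\<lambda>x. r x * cnj (S x)) = 0"
  proof -
    have "(\<lambda>x. r x * cnj (S x)) = (\<lambda>x. \<Sum>k\<in>F. cnj (hat q k) * (r x * trig (- k) x))"
      by (auto simp: S_def sum_distrib_left trig_cnj mult_ac)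
    then have "integral {0..2 * pi} (\<lambda>x. r x * cnj (S x))
        = (\<Sum>k\<in>F. cnj (hat q k) * integral {0..2 * pi} (\<lambda>x. r x * trig (- k) x))"
      by (simp add: integral_sum[OF F] integrable_on_mult_right integrable_mult_trig[OF cr])
    also have "\<dots> = (\<Sum>k\<in>F. cnj (hat q k) * (of_real (2 * pi) * hat r k))"
      by (simp add: hat_eq)
    also have "\<dots> = 0"
      by (intro sum.neutral) (simp add: r_def hat_diff[OF q cS] hS)
    finally show ?thesis .
  qed
  have SS: "integral {0..2 * pi} (\<lambda>x. S x * cnj (S x)) = of_real (2 * pi * (\<Sum>k\<in>F. (cmod (hat q k))\<^sup>2))"
  proof -
    have "(\<lambda>x. S x * cnj (S x)) = (\<lambda>x. \<Sum>k\<in>F. cnj (hat q k) * (S x * trig (- k) x))"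
      by (subst (2) S_def) (auto simp: sum_distrib_left trig_cnj mult_ac)
    then have "integral {0..2 * pi} (\<lambda>x. S x * cnj (S x))
        = (\<Sum>k\<in>F. cnj (hat q k) * integral {0..2 * pi} (\<lambda>x. S x * trig (- k) x))"
      by (simp add: integral_sum[OF F] integrable_on_mult_right integrable_mult_trig[OF cS])
    also have "\<dots> = (\<Sum>k\<in>F. cnj (hat q k) * (of_real (2 * pi) * hat S k))"
      by (simp add: hat_eq)
    also have "\<dots> = (\<Sum>k\<in>F. complex_of_real (2 * pi * (cmod (hat q k))\<^sup>2))"
      by (intro sum.cong refl) (simp add: hS complex_norm_square mult_ac flip: of_real_power)
    finally show ?thesis by (simp add: sum_distrib_left)
  qed
  have "0 \<le> integral {0..2 * pi} (\<lambda>x. (cmod (r x))\<^sup>2)"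
    by (rule integral_nonneg) (auto intro!: integrable_continuous_real continuous_intros cr)
  also have "\<dots> = integral {0..2 * pi} (\<lambda>x. (cmod (q x))\<^sup>2 - 2 * Re (r x * cnj (S x)) - Re (S x * cnj (S x)))"
  proof (intro integral_cong)
    fix x
    have q: "q x = r x + S x" by (simp add: r_def)
    show "(cmod (r x))\<^sup>2 = (cmod (q x))\<^sup>2 - 2 * Re (r x * cnj (S x)) - Re (S x * cnj (S x))"
      unfolding q cmod_power2 by (simp add: power2_eq_square algebra_simps)
  qed
  also have "\<dots> = integral {0..2 * pi} (\<lambda>x. (cmod (q x))\<^sup>2)
      - 2 * Re (integral {0..2 * pi} (\<lambda>x. r x * cnj (S x))) - Re (integral {0..2 * pi} (\<lambda>x. S x * cnj (S x)))"
  proof -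
    have i: "(\<lambda>x. (cmod (q x))\<^sup>2) integrable_on {0..2 * pi}"
      "(\<lambda>x. r x * cnj (S x)) integrable_on {0..2 * pi}" "(\<lambda>x. S x * cnj (S x)) integrable_on {0..2 * pi}"
      by (intro integrable_continuous_real continuous_intros q cS cr)+
    have ir: "(\<lambda>x. Re (r x * cnj (S x))) integrable_on {0..2 * pi}"
      "(\<lambda>x. Re (S x * cnj (S x))) integrable_on {0..2 * pi}"
      "integral {0..2 * pi} (\<lambda>x. Re (r x * cnj (S x))) = Re (integral {0..2 * pi} (\<lambda>x. r x * cnj (S x)))"
      "integral {0..2 * pi} (\<lambda>x. Re (S x * cnj (S x))) = Re (integral {0..2 * pi} (\<lambda>x. S x * cnj (S x)))"
      using i(2,3)[THEN integrable_linear, OF bounded_linear_Re] i(2,3)[THEN integral_linear, OF bounded_linear_Re]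
      by (simp_all add: o_def)
    show ?thesis
      by (simp only: integral_diff integral_mult_right ir i integrable_diff integrable_on_mult_right)
  qed
  also have "\<dots> = integral {0..2 * pi} (\<lambda>x. (cmod (q x))\<^sup>2) - 2 * pi * (\<Sum>k\<in>F. (cmod (hat q k))\<^sup>2)"
    by (simp only: orth SS Re_complex_of_real) simp
  finally show ?thesis by (simp add: field_simps)
qed

text \<open>By \<open>bessel\<close> the squares are summable along any injective sequence of modes,
  so they tend to 0.\<close>

lemma riemann_lebesgue:
  assumes "continuous_on {0..2 * pi} q"
  shows "(\<lambda>n. hat q (int n + c)) \<longlonglongrightarrow> 0" "(\<lambda>n. hat q (c - int n)) \<longlonglongrightarrow> 0"
proof -
  have *: "(\<lambda>n. hat q (f n)) \<longlonglongrightarrow> 0" if "inj f" for f :: "nat \<Rightarrow> int"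
  proof -
    have "summable (\<lambda>n. (cmod (hat q (f n)))\<^sup>2)"
    proof (rule summableI_nonneg_bounded)
      fix n
      have "(\<Sum>i<n. (cmod (hat q (f i)))\<^sup>2) = (\<Sum>k\<in>f ` {..<n}. (cmod (hat q k))\<^sup>2)"
        using that by (subst sum.reindex) (auto simp: inj_on_def)
      also have "\<dots> \<le> integral {0..2 * pi} (\<lambda>x. (cmod (q x))\<^sup>2) / (2 * pi)"
        by (rule bessel[OF assms]) simp
      finally show "(\<Sum>i<n. (cmod (hat q (f i)))\<^sup>2) \<le> integral {0..2 * pi} (\<lambda>x. (cmod (q x))\<^sup>2) / (2 * pi)" .
    qed simp
    then have "(\<lambda>n. (cmod (hat q (f n)))\<^sup>2) \<longlonglongrightarrow> 0" by (rule summable_LIMSEQ_zero)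
    then have "(\<lambda>n. sqrt ((cmod (hat q (f n)))\<^sup>2)) \<longlonglongrightarrow> sqrt 0" by (rule tendsto_real_sqrt)
    then show ?thesis by (simp add: tendsto_norm_zero_iff)
  qed
  show "(\<lambda>n. hat q (int n + c)) \<longlonglongrightarrow> 0" by (rule *) (simp add: inj_on_def)
  show "(\<lambda>n. hat q (c - int n)) \<longlonglongrightarrow> 0" by (rule *) (simp add: inj_on_def)
qed

text \<open>Matches the difference quotients by which time derivatives enter the definition of the
  closed loop.\<close>

lemma has_vector_derivative_iff_quotient:
  "(f has_vector_derivative D) (at t) \<longleftrightarrow> ((\<lambda>h. (1 / h) *\<^sub>R (f (t + h) - f t) - D) \<longlongrightarrow> 0) (at 0)"
proof -
  have e: "norm (f (t + h) - f t - h *\<^sub>R D) / norm h = norm ((1 / h) *\<^sub>R (f (t + h) - f t) - D)" if "h \<noteq> 0" for h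
  proof -
    have "(1 / h) *\<^sub>R (f (t + h) - f t) - D = (1 / h) *\<^sub>R (f (t + h) - f t - h *\<^sub>R D)"
      using that by (simp add: scaleR_diff_right)
    then show ?thesis by simp
  qed
  have "(f has_vector_derivative D) (at t) \<longleftrightarrow> ((\<lambda>h. norm (f (t + h) - f t - h *\<^sub>R D) / norm h) \<longlongrightarrow> 0) (at 0)"
    by (simp add: has_vector_derivative_def has_derivative_at bounded_linear_scaleR_left)
  also have "\<dots> \<longleftrightarrow> ((\<lambda>h. norm ((1 / h) *\<^sub>R (f (t + h) - f t) - D)) \<longlongrightarrow> 0) (at 0)"
    by (rule filterlim_cong[OF refl refl], unfold eventually_at_filter)
      (intro always_eventually allI impI e)
  finally show ?thesis by (simp add: tendsto_norm_zero_iff)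
qed

lemma vector_derivative_quotient:
  fixes f :: "real \<Rightarrow> complex"
  assumes "(f has_vector_derivative D) (at x)"
  shows "((\<lambda>y. (f y - f x) / of_real (y - x)) \<longlongrightarrow> D) (at x)"
proof (rule LIM_offset_zero_cancel)
  have "((\<lambda>h. (1 / h) *\<^sub>R (f (x + h) - f x)) \<longlongrightarrow> D) (at 0)"
    using assms unfolding has_vector_derivative_iff_quotient by (rule LIM_zero_cancel)
  then show "((\<lambda>h. (f (x + h) - f x) / of_real (x + h - x)) \<longlongrightarrow> D) (at 0)"
    by (simp add: scaleR_conv_of_real)
qed

lemma integral_shift_periodic:
  assumes h: "h \<in> \<P>" and a: "0 \<le> a" "a \<le> 2 * pi"
  shows "integral {0..2 * pi} (\<lambda>x. h (x + a)) = integral {0..2 * pi} h"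
proof -
  have i: "h integrable_on {u..v}" for u v
    by (rule integrable_continuous_real[OF test_continuous[OF h]])
  have "integral {0..2 * pi} (\<lambda>x. h (x + a)) = integral {a..2 * pi + a} h"
    using integral_shift_Icc_real[of 0 "2 * pi" h a] by (simp add: o_def add.commute)
  also have "\<dots> = integral {a..2 * pi} h + integral {2 * pi..2 * pi + a} h"
    using a by (subst Henstock_Kurzweil_Integration.integral_combine[OF _ _ i]) auto
  also have "integral {2 * pi..2 * pi + a} h = integral {0..a} h"
    using integral_shift_Icc_real[of 0 a h "2 * pi"] test_periodic[OF h] by (simp add: o_def add.commute)
  also have "integral {a..2 * pi} h + integral {0..a} h = integral {0..2 * pi} h"
    using Henstock_Kurzweil_Integration.integral_combine[OF a i] by (simp add: add.commute)
  finally show ?thesis .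
qed

text \<open>Chernoff's argument: if \<open>\<psi>\<close> vanishes at \<open>0\<close>, then \<open>\<psi> x / (e\<^sup>i\<^sup>x - 1)\<close> is continuous and
  expresses the Fourier coefficients of \<open>\<psi>\<close> as differences, so that their sum telescopes.\<close>

lemma chernoff:
  assumes \<psi>: "\<psi> \<in> \<P>" and "\<psi> 0 = 0"
  shows "(\<lambda>n. \<Sum>k\<in>{- int n..int n}. hat \<psi> k) \<longlonglongrightarrow> 0"
proof -
  \<comment> \<open>At zeros of the denominator the value is the limit there, because
    \<open>trig 1\<close> has derivative \<open>\<i>\<close> at these points.\<close>
  define q where "q = (\<lambda>x. if trig 1 x = 1 then Dx \<psi> x / \<i> else \<psi> x / (trig 1 x - 1))"
  have trig_eq_1: "\<psi> x = 0" if "trig 1 x = 1" for x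
  proof -
    have e: "exp (\<i> * of_real x) = 1" using that by (simp add: trig_def)
    obtain n :: int where n: "x = 2 * of_int n * pi"
      using e unfolding exp_eq_1 by (auto simp: mult_ac)
    interpret periodic_fun_simple \<psi> "2 * pi" by unfold_locales (rule test_periodic[OF \<psi>])
    show ?thesis using plus_of_int[of 0 n] \<open>\<psi> 0 = 0\<close> by (simp add: n mult_ac)
  qed
  have cq: "isCont q p" for p
  proof (cases "trig 1 p = 1")
    case True
    have t1: "((\<lambda>y. (trig 1 y - trig 1 p) / of_real (y - p)) \<longlongrightarrow> \<i> * of_int 1 * trig 1 p) (at p)"
      by (rule vector_derivative_quotient[OF trig_derivative])
    then have t: "((\<lambda>y. (trig 1 y - 1) / of_real (y - p)) \<longlongrightarrow> \<i>) (at p)" by (simp add: True)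
    have f: "((\<lambda>y. \<psi> y / of_real (y - p)) \<longlongrightarrow> Dx \<psi> p) (at p)"
      using vector_derivative_quotient[OF test_has_derivative[OF \<psi>], of p] by (simp add: trig_eq_1[OF True])
    have "((\<lambda>y. (\<psi> y / of_real (y - p)) / ((trig 1 y - 1) / of_real (y - p))) \<longlongrightarrow> Dx \<psi> p / \<i>) (at p)"
      by (rule tendsto_divide[OF f t]) simp
    moreover have "\<forall>\<^sub>F y in at p. (\<psi> y / of_real (y - p)) / ((trig 1 y - 1) / of_real (y - p)) = q y"
    proof -
      have "\<forall>\<^sub>F y in at p. (trig 1 y - 1) / of_real (y - p) \<noteq> 0"
        using tendsto_imp_eventually_ne[OF t, of 0] complex_i_not_zero by blast
      then show ?thesis
        by eventually_elim (auto simp: q_def simp flip: of_real_diff)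
    qed
    ultimately have "(q \<longlongrightarrow> Dx \<psi> p / \<i>) (at p)" by (rule Lim_transform_eventually)
    then show ?thesis by (simp add: isCont_def q_def True)
  next
    case False
    have ct: "isCont f p" if "f \<in> \<P>" for f
      using test_has_derivative[OF that] has_vector_derivative_continuous by blast
    have 1: "isCont (\<lambda>x. \<psi> x / (trig 1 x - 1)) p"
      using False by (intro continuous_intros ct \<psi> test_trig) auto
    have "\<forall>\<^sub>F x in at p. trig 1 x \<noteq> 1"
      using ct[OF test_trig, of 1] False unfolding isCont_def by (rule tendsto_imp_eventually_ne)
    then have "\<forall>\<^sub>F x in nhds p. q x = \<psi> x / (trig 1 x - 1)"
      unfolding eventually_at_filter by eventually_elim (use False in \<open>auto simp: q_def\<close>)
    from isCont_cong[OF this] 1 show ?thesis by simp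
  qed
  then have cq': "continuous_on {0..2 * pi} q" by (simp add: continuous_at_imp_continuous_on)
  have "\<psi> x = q x * trig 1 x - q x" for x
    using trig_eq_1[of x] by (auto simp: q_def field_simps)
  then have "hat \<psi> k = hat (\<lambda>x. q x * trig 1 x - q x) k" for k by presburger
  then have hat: "hat \<psi> k = hat q (k - 1) - hat q k" for k
    by (simp add: hat_diff hat_mult_trig cq' continuous_on_mult test_continuous test_trig)
  have "(\<Sum>k\<in>{- int n..int n}. hat \<psi> k) = hat q (- 1 - int n) - hat q (int n)" for n
  proof (induction n)
    case (Suc n)
    have "{- int (Suc n)..int (Suc n)} = insert (- int (Suc n)) (insert (int (Suc n)) {- int n..int n})" by auto
    then show ?case using Suc by (simp add: hat algebra_simps)
  qed (simp add: hat)
  moreover have "(\<lambda>n. hat q (- 1 - int n) - hat q (int n)) \<longlonglongrightarrow> 0 - 0"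
    using riemann_lebesgue[OF cq', of 0] riemann_lebesgue[OF cq', of "-1"] by (intro tendsto_diff) simp_all
  ultimately show ?thesis by simp
qed

lemma test_shift: "\<phi> \<in> \<P> \<Longrightarrow> (\<lambda>x. \<phi> (x + a)) \<in> \<P>"
proof (rule test_coinduct[of _ "(\<lambda>f x. f (x + a)) ` \<P>"])
  fix f assume "f \<in> (\<lambda>f x. f (x + a)) ` \<P>"
  then obtain g where g: "g \<in> \<P>" "f = (\<lambda>x. g (x + a))" by blast
  have 1: "(f has_vector_derivative Dx g (x + a)) (at x)" for x
    using vector_diff_chain_at[of "\<lambda>x. x + a" 1 x g "Dx g (x + a)"] test_has_derivative[OF g(1)]
    by (simp add: g o_def has_vector_derivative_add_const)
  have 2: "f (x + 2 * pi) = f x" for x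
    using test_periodic[OF g(1), of "x + a"] by (simp add: g(2) add_ac)
  have 3: "(\<lambda>x. Dx g (x + a)) \<in> (\<lambda>f x. f (x + a)) ` \<P>"
    using test_Dx[OF g(1)] by (rule imageI)
  show "(\<forall>x. f (x + 2 * pi) = f x) \<and>
      (\<exists>f'\<in>(\<lambda>f x. f (x + a)) ` \<P>. \<forall>x. (f has_vector_derivative f' x) (at x))"
    by (intro conjI bexI[OF _ 3] allI 1 2)
qed auto

text \<open>\<open>chernoff\<close> for the function \<open>\<phi> (x + a) - \<phi> a\<close> gives
  convergence of the symmetric partial sums at \<open>a\<close>; absolute summability of the
  coefficients upgrades it to an unordered sum.\<close>

lemma fourier_inversion:
  assumes \<phi>: "\<phi> \<in> \<P>"
  shows "((\<lambda>k. hat \<phi> k * trig k x) has_sum \<phi> x) UNIV"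
proof -
  have *: "(\<lambda>n. \<Sum>k\<in>{- int n..int n}. hat \<phi> k * trig k a) \<longlonglongrightarrow> \<phi> a" if a: "0 \<le> a" "a \<le> 2 * pi" for a
  proof -
    define \<psi> where "\<psi> = (\<lambda>x. \<phi> (x + a) - \<phi> a)"
    have \<psi>: "\<psi> \<in> \<P>" unfolding \<psi>_def by (rule test_diff[OF test_shift[OF \<phi>] test_const])
    have hs: "hat (\<lambda>x. \<phi> (x + a)) k = hat \<phi> k * trig k a" for k
    proof -
      have t: "trig (- k) (x + a) * trig k a = trig (- k) x" for x
        unfolding trig_def exp_add[symmetric] by (rule arg_cong[of _ _ exp]) (simp add: algebra_simps)
      have "hat \<phi> k * trig k a = integral {0..2 * pi} (\<lambda>x. \<phi> (x + a) * trig (- k) (x + a)) * trig k a / of_real (2 * pi)"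
        using integral_shift_periodic[OF test_mult[OF \<phi> test_trig] a, of "- k"] by (simp add: hat_eq)
      also have "integral {0..2 * pi} (\<lambda>x. \<phi> (x + a) * trig (- k) (x + a)) * trig k a
          = integral {0..2 * pi} (\<lambda>x. \<phi> (x + a) * trig (- k) x)"
        unfolding integral_mult_left[symmetric] mult.assoc t ..
      finally show ?thesis by (simp add: hat_eq)
    qed
    have h: "hat \<psi> k = hat \<phi> k * trig k a - (if k = 0 then \<phi> a else 0)" for k
      unfolding \<psi>_def
      by (subst hat_diff) (simp_all add: hs hat_const test_continuous[OF test_shift[OF \<phi>]])
    have "(\<lambda>n. \<Sum>k\<in>{- int n..int n}. hat \<psi> k) \<longlonglongrightarrow> 0"
      by (rule chernoff[OF \<psi>]) (simp add: \<psi>_def)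
    then have "(\<lambda>n. (\<Sum>k\<in>{- int n..int n}. hat \<phi> k * trig k a) - \<phi> a) \<longlonglongrightarrow> 0"
      by (simp add: h sum_subtractf)
    then show ?thesis by (rule LIM_zero_cancel)
  qed
  \<comment> \<open>Shift invariance of the integral is available for shifts within one period, so
    \<open>x\<close> is reduced to that range.\<close>
  define n where "n = \<lfloor>x / (2 * pi)\<rfloor>"
  define a where "a = x - of_int n * (2 * pi)"
  have "of_int n \<le> x / (2 * pi)" "x / (2 * pi) < of_int n + 1" by (simp_all add: n_def)
  then have a: "0 \<le> a" "a \<le> 2 * pi" by (simp_all add: a_def field_simps)
  have per: "f a = f x" if "f \<in> \<P>" for f
  proof -
    interpret periodic_fun_simple f "2 * pi" by unfold_locales (rule test_periodic[OF that])
    show ?thesis by (simp add: a_def minus_of_int)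
  qed
  have lim: "(\<lambda>n. \<Sum>k\<in>{- int n..int n}. hat \<phi> k * trig k x) \<longlonglongrightarrow> \<phi> x"
    using *[OF a] by (simp add: per[OF \<phi>] per[OF test_trig])
  have "(\<lambda>k. hat \<phi> k * trig k x) summable_on UNIV"
    by (rule abs_summable_summable) (simp add: norm_mult hat_abs_summable[OF \<phi>])
  then have hs: "((\<lambda>k. hat \<phi> k * trig k x) has_sum (\<Sum>\<^sub>\<infinity>k. hat \<phi> k * trig k x)) UNIV"
    by (rule has_sum_infsum)
  then have "(\<lambda>n. \<Sum>k\<in>{- int n..int n}. hat \<phi> k * trig k x) \<longlonglongrightarrow> (\<Sum>\<^sub>\<infinity>k. hat \<phi> k * trig k x)"
    unfolding has_sum_def by (rule filterlim_compose[OF _ filterlim_symmetric_intervals])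
  from LIMSEQ_unique[OF this lim] hs show ?thesis by simp
qed

lemma test_eqI: "\<phi> \<in> \<P> \<Longrightarrow> \<eta> \<in> \<P> \<Longrightarrow> (\<And>k. hat \<phi> k = hat \<eta> k) \<Longrightarrow> \<phi> = \<eta>"
  by (rule ext, rule has_sum_unique[OF fourier_inversion]) (simp_all add: fourier_inversion)

text \<open>Derivatives of the partial sums are partial sums for the derivatives, and these converge
  uniformly by the Weierstrass test. Convergence in this strong sense lets distributions be
  evaluated termwise.\<close>

lemma fourier_test_tendsto:
  assumes \<phi>: "\<phi> \<in> \<P>"
  shows "test_tendsto (\<lambda>n x. \<Sum>k\<in>{- int n..int n}. hat \<phi> k * trig k x) \<phi>"
  unfolding test_tendsto_def
proof (intro conjI allI)
  show "(\<lambda>x. \<Sum>k\<in>{- int n..int n}. hat \<phi> k * trig k x) \<in> \<P>" for n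
    by (intro test_sum test_scale test_trig)
  fix j
  define f where "f = (Dx ^^ j) \<phi>"
  have f: "f \<in> \<P>" unfolding f_def by (rule test_funpow_Dx[OF \<phi>])
  have "uniform_limit UNIV (\<lambda>F x. \<Sum>k\<in>F. hat f k * trig k x) f (finite_subsets_at_top UNIV)"
    by (rule Weierstrass_m_test_general'[of _ _ _ "\<lambda>k. cmod (hat f k)"])
      (auto simp: norm_mult hat_abs_summable[OF f] fourier_inversion[OF f])
  then have "uniform_limit UNIV (\<lambda>n x. \<Sum>k\<in>{- int n..int n}. hat f k * trig k x) f sequentially"
    by (rule filterlim_compose[OF _ filterlim_symmetric_intervals])
  moreover have "(Dx ^^ j) (\<lambda>x. \<Sum>k\<in>{- int n..int n}. hat \<phi> k * trig k x) = (\<lambda>x. \<Sum>k\<in>{- int n..int n}. hat f k * trig k x)" for n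
    by (subst funpow_Dx_sum)
      (simp_all only: test_scale test_trig funpow_Dx_scale funpow_Dx_trig f_def hat_funpow_Dx[OF \<phi>], simp add: mult_ac)
  ultimately show "uniform_limit UNIV (\<lambda>n. (Dx ^^ j) (\<lambda>x. \<Sum>k\<in>{- int n..int n}. hat \<phi> k * trig k x))
      ((Dx ^^ j) \<phi>) sequentially" by (simp add: f_def)
qed (rule \<phi>)

section \<open>Periodic distributions and their Fourier coefficients\<close>

lemma
  assumes "v \<in> \<P>'"
  shows pd_outside: "\<phi> \<notin> \<P> \<Longrightarrow> v \<phi> = 0"
    and pd_add: "\<phi> \<in> \<P> \<Longrightarrow> \<eta> \<in> \<P> \<Longrightarrow> v (\<lambda>x. \<phi> x + \<eta> x) = v \<phi> + v \<eta>"
    and pd_scale: "\<phi> \<in> \<P> \<Longrightarrow> v (\<lambda>x. c * \<phi> x) = c * v \<phi>"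
    and pd_tendsto: "test_tendsto \<Phi> \<phi> \<Longrightarrow> (\<lambda>n. v (\<Phi> n)) \<longlonglongrightarrow> v \<phi>"
  using assms unfolding periodic_distributions_def test_tendsto_def by blast+

lemma periodic_distributionI:
  assumes "\<And>\<phi>. \<phi> \<notin> \<P> \<Longrightarrow> v \<phi> = 0"
    and "\<And>\<phi> \<eta>. \<phi> \<in> \<P> \<Longrightarrow> \<eta> \<in> \<P> \<Longrightarrow> v (\<lambda>x. \<phi> x + \<eta> x) = v \<phi> + v \<eta>"
    and "\<And>c \<phi>. \<phi> \<in> \<P> \<Longrightarrow> v (\<lambda>x. c * \<phi> x) = c * v \<phi>"
    and "\<And>\<Phi> \<phi>. test_tendsto \<Phi> \<phi> \<Longrightarrow> (\<lambda>n. v (\<Phi> n)) \<longlonglongrightarrow> v \<phi>"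
  shows "v \<in> \<P>'"
  using assms unfolding periodic_distributions_def test_tendsto_def by blast

lemma pd_diff: "v \<in> \<P>' \<Longrightarrow> \<phi> \<in> \<P> \<Longrightarrow> \<eta> \<in> \<P> \<Longrightarrow> v (\<lambda>x. \<phi> x - \<eta> x) = v \<phi> - v \<eta>"
  using pd_add[of v \<phi> "\<lambda>x. - 1 * \<eta> x"] pd_scale[of v \<eta> "-1"] test_scale[of \<eta> "-1"] by simp

lemma pd_sum:
  assumes "v \<in> \<P>'" "\<And>k. k \<in> F \<Longrightarrow> f k \<in> \<P>"
  shows "v (\<lambda>x. \<Sum>k\<in>F. f k x) = (\<Sum>k\<in>F. v (f k))"
  using assms(2)
proof (induction F rule: infinite_finite_induct)
  case (insert k F)
  then show ?case by (simp add: pd_add[OF assms(1)] test_sum)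
qed (use pd_scale[OF assms(1) test_const, of 0 0] in \<open>simp_all\<close>)

text \<open>Parseval in bilinear form: the pairing has no conjugation, so the coefficients of
  \<open>\<phi>\<close> occur at \<open>- k\<close>.\<close>

lemma pd_fourier_series:
  assumes v: "v \<in> \<P>'" and \<phi>: "\<phi> \<in> \<P>"
  shows "(\<lambda>n. of_real (2 * pi) * (\<Sum>k\<in>{- int n..int n}. hat \<phi> (- k) * fourier_coeff v k)) \<longlonglongrightarrow> v \<phi>"
proof -
  have "v (\<lambda>x. \<Sum>k\<in>{- int n..int n}. hat \<phi> k * trig k x)
      = of_real (2 * pi) * (\<Sum>k\<in>{- int n..int n}. hat \<phi> (- k) * fourier_coeff v k)" for n
  proof -
    have fc: "v (trig k) = of_real (2 * pi) * fourier_coeff v (- k)" for k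
      by (simp add: fourier_coeff_trig)
    have "v (\<lambda>x. \<Sum>k\<in>{- int n..int n}. hat \<phi> k * trig k x)
        = (\<Sum>k\<in>{- int n..int n}. v (\<lambda>x. hat \<phi> k * trig k x))"
      by (rule pd_sum[OF v]) (intro test_scale test_trig)
    also have "\<dots> = (\<Sum>k\<in>{- int n..int n}. of_real (2 * pi) * (hat \<phi> k * fourier_coeff v (- k)))"
      by (intro sum.cong refl) (simp only: pd_scale[OF v test_trig] fc mult.left_commute)
    also have "\<dots> = (\<Sum>k\<in>{- int n..int n}. of_real (2 * pi) * (hat \<phi> (- k) * fourier_coeff v k))"
      by (rule sum.reindex_bij_witness[of _ uminus uminus]) auto
    finally show ?thesis by (simp add: sum_distrib_left)
  qed
  with pd_tendsto[OF v fourier_test_tendsto[OF \<phi>]] show ?thesis by simp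
qed

lemma pd_eqI:
  assumes "u \<in> \<P>'" "v \<in> \<P>'" "\<And>k. fourier_coeff u k = fourier_coeff v k"
  shows "u = v"
proof
  fix \<phi>
  show "u \<phi> = v \<phi>"
  proof (cases "\<phi> \<in> \<P>")
    case True
    from LIMSEQ_unique[OF pd_fourier_series[OF assms(1) this]] pd_fourier_series[OF assms(2) True]
    show ?thesis by (simp add: assms(3))
  qed (simp add: pd_outside assms)
qed

lemma pd_minus_closed:
  assumes "u \<in> \<P>'" "v \<in> \<P>'"
  shows "u - v \<in> \<P>'"
proof (rule periodic_distributionI)
  fix \<Phi> \<phi> assume "test_tendsto \<Phi> \<phi>"
  from tendsto_diff[OF pd_tendsto[OF assms(1) this] pd_tendsto[OF assms(2) this]]
  show "(\<lambda>n. (u - v) (\<Phi> n)) \<longlonglongrightarrow> (u - v) \<phi>" by simp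
qed (use assms in \<open>auto simp: pd_outside pd_add pd_scale algebra_simps\<close>)

lemma pd_scale_closed:
  assumes "v \<in> \<P>'"
  shows "dist_scale c v \<in> \<P>'"
proof (rule periodic_distributionI)
  fix \<Phi> \<phi> assume "test_tendsto \<Phi> \<phi>"
  from tendsto_mult_left[OF pd_tendsto[OF assms this]]
  show "(\<lambda>n. dist_scale c v (\<Phi> n)) \<longlonglongrightarrow> dist_scale c v \<phi>" by (simp add: dist_scale_def)
qed (use assms in \<open>auto simp: dist_scale_def pd_outside pd_add pd_scale algebra_simps\<close>)

lemma pd_deriv_closed: "v \<in> \<P>' \<Longrightarrow> dist_deriv v \<in> \<P>'"
proof (rule periodic_distributionI)
  assume v: "v \<in> \<P>'"
  fix \<Phi> \<phi> assume \<Phi>: "test_tendsto \<Phi> \<phi>"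
  then have "\<Phi> n \<in> \<P>" "\<phi> \<in> \<P>" for n by (auto simp: test_tendsto_def)
  then show "(\<lambda>n. dist_deriv v (\<Phi> n)) \<longlonglongrightarrow> dist_deriv v \<phi>"
    using tendsto_minus[OF pd_tendsto[OF v test_tendsto_Dx[OF \<Phi>]]] by (simp add: dist_deriv_def)
qed (auto simp: dist_deriv_def Dx_add Dx_scale pd_add pd_scale test_Dx test_add test_scale)

lemma pd_mult_closed:
  assumes v: "v \<in> \<P>'" and f: "f \<in> \<P>"
  shows "dist_mult f v \<in> \<P>'"
proof (rule periodic_distributionI)
  fix \<phi> \<eta> assume "\<phi> \<in> \<P>" "\<eta> \<in> \<P>"
  then show "dist_mult f v (\<lambda>x. \<phi> x + \<eta> x) = dist_mult f v \<phi> + dist_mult f v \<eta>"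
    using pd_add[OF v test_mult[OF f] test_mult[OF f], of \<phi> \<eta>]
    by (simp add: dist_mult_def test_add ring_distribs)
next
  fix c \<phi> assume "\<phi> \<in> \<P>"
  then show "dist_mult f v (\<lambda>x. c * \<phi> x) = c * dist_mult f v \<phi>"
    using pd_scale[OF v test_mult[OF f], of \<phi> c]
    by (simp add: dist_mult_def test_scale mult.left_commute)
next
  fix \<Phi> \<phi> assume \<Phi>: "test_tendsto \<Phi> \<phi>"
  then have "\<Phi> n \<in> \<P>" "\<phi> \<in> \<P>" for n by (auto simp: test_tendsto_def)
  then show "(\<lambda>n. dist_mult f v (\<Phi> n)) \<longlonglongrightarrow> dist_mult f v \<phi>"
    using pd_tendsto[OF v test_tendsto_mult[OF \<Phi> f]] by (simp add: dist_mult_def)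
qed (simp add: dist_mult_def)

lemma pd_of_closed:
  assumes f: "f \<in> \<P>"
  shows "dist_of f \<in> \<P>'"
proof (rule periodic_distributionI)
  have int: "(\<lambda>x. f x * \<phi> x) integrable_on {0..2 * pi}" if "\<phi> \<in> \<P>" for \<phi>
    using that by (intro integrable_continuous_real continuous_on_mult test_continuous f)
  fix \<phi> \<eta> assume "\<phi> \<in> \<P>" "\<eta> \<in> \<P>"
  then show "dist_of f (\<lambda>x. \<phi> x + \<eta> x) = dist_of f \<phi> + dist_of f \<eta>"
    by (simp add: dist_of_def test_add ring_distribs integral_add int)
next
  fix c \<phi> assume "\<phi> \<in> \<P>"
  then show "dist_of f (\<lambda>x. c * \<phi> x) = c * dist_of f \<phi>"
    by (simp add: dist_of_def test_scale mult.left_commute[of _ c])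
next
  fix \<Phi> \<phi> assume "test_tendsto \<Phi> \<phi>"
  from test_tendsto_mult[OF this f]
  have \<Phi>: "test_tendsto (\<lambda>n x. f x * \<Phi> n x) (\<lambda>x. f x * \<phi> x)" .
  then have "uniform_limit UNIV (\<lambda>n x. f x * \<Phi> n x) (\<lambda>x. f x * \<phi> x) sequentially"
    unfolding test_tendsto_def by (auto dest: spec[of _ 0])
  then have u: "uniform_limit {0..2 * pi} (\<lambda>n x. f x * \<Phi> n x) (\<lambda>x. f x * \<phi> x) sequentially"
    by (rule uniform_limit_on_subset) simp
  obtain I J where IJ: "\<And>n. ((\<lambda>x. f x * \<Phi> n x) has_integral I n) {0..2 * pi}"
    "((\<lambda>x. f x * \<phi> x) has_integral J) {0..2 * pi}" "I \<longlonglongrightarrow> J"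
    by (rule uniform_limit_integral[OF u]) (use \<Phi> in \<open>auto simp: test_tendsto_def intro: test_continuous\<close>)
  have "\<Phi> n \<in> \<P>" "\<phi> \<in> \<P>" for n using \<open>test_tendsto \<Phi> \<phi>\<close> by (auto simp: test_tendsto_def)
  then show "(\<lambda>n. dist_of f (\<Phi> n)) \<longlonglongrightarrow> dist_of f \<phi>"
    using IJ(3) by (simp add: dist_of_def integral_unique[OF IJ(1)] integral_unique[OF IJ(2)])
qed (simp add: dist_of_def)

lemma fourier_coeff_minus: "fourier_coeff (u - v) k = fourier_coeff u k - fourier_coeff v k"
  by (simp add: fourier_coeff_def diff_divide_distrib)

lemma fourier_coeff_scale: "fourier_coeff (dist_scale c v) k = c * fourier_coeff v k"
  by (simp add: fourier_coeff_def dist_scale_def)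

lemma fourier_coeff_deriv:
  "v \<in> \<P>' \<Longrightarrow> fourier_coeff (dist_deriv v) k = \<i> * of_int k * fourier_coeff v k"
  using pd_scale[of v "trig (- k)" "\<i> * of_int (- k)"]
  by (simp add: fourier_coeff_trig dist_deriv_def test_trig Dx_trig)

text \<open>Parseval's formula turned into a definition, to realise prescribed coefficients by a
  distribution.\<close>

definition synth :: "(int \<Rightarrow> complex) \<Rightarrow> pdist" where
  "synth c = (\<lambda>\<phi>. if \<phi> \<in> \<P> then of_real (2 * pi) * (\<Sum>\<^sub>\<infinity>k. c k * hat \<phi> (- k)) else 0)"

text \<open>Growth of order \<open>p\<close> is outweighed by \<open>p + 2\<close> derivatives of
  the test function, the two extra ones giving summability. The bound is linear in the sup norms,
  hence sequential continuity.\<close>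

lemma
  assumes c: "\<And>k. cmod (c k) \<le> C * (1 + \<bar>real_of_int k\<bar>) ^ p"
  shows synth_closed: "synth c \<in> \<P>'"
    and fourier_coeff_synth: "fourier_coeff (synth c) k = c k"
proof -
  have C: "C \<ge> 0" using order_trans[OF norm_ge_zero c[of 0]] by simp
  have term_le: "cmod (c k * hat \<phi> (- k)) \<le> (C * (2 ^ (p + 3) * A)) * inv_sq k"
    if \<phi>: "\<phi> \<in> \<P>" and A: "\<And>x. cmod (\<phi> x) \<le> A" "\<And>x. cmod ((Dx ^^ (p + 2)) \<phi> x) \<le> A" for \<phi> A k
  proof -
    define b where "b = 1 + \<bar>real_of_int k\<bar>"
    have b: "b > 0" by (simp add: b_def add_pos_nonneg)
    have "cmod (hat \<phi> (- k)) * b ^ (p + 2) \<le> 2 ^ (p + 2 + 1) * A"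
      using hat_decay[OF \<phi> A, of "- k"] by (simp add: b_def)
    then have "C * (cmod (hat \<phi> (- k)) * b ^ (p + 2)) \<le> C * (2 ^ (p + 3) * A)"
      using C by (intro mult_left_mono) (simp_all add: numeral_3_eq_3)
    moreover have "cmod (c k * hat \<phi> (- k)) * b\<^sup>2 \<le> C * (cmod (hat \<phi> (- k)) * b ^ (p + 2))"
    proof -
      have "cmod (c k) * (cmod (hat \<phi> (- k)) * b\<^sup>2) \<le> (C * b ^ p) * (cmod (hat \<phi> (- k)) * b\<^sup>2)"
        using c[of k] by (intro mult_right_mono) (simp_all add: b_def)
      then show ?thesis by (simp add: norm_mult power_add power2_eq_square mult_ac)
    qed
    ultimately have "cmod (c k * hat \<phi> (- k)) * b\<^sup>2 \<le> C * (2 ^ (p + 3) * A)" by simp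
    then show ?thesis using b by (simp add: inv_sq_def field_simps flip: b_def)
  qed
  have sum_inv: "(\<lambda>k. D * inv_sq k) summable_on UNIV" for D
    by (rule summable_on_cmult_right[OF inv_sq_summable])
  have norm_sum: "(\<lambda>k. norm (c k * hat \<phi> (- k))) summable_on UNIV" if \<phi>: "\<phi> \<in> \<P>" for \<phi>
  proof -
    obtain A where "\<And>x. cmod (\<phi> x) \<le> A" "\<And>x. cmod ((Dx ^^ (p + 2)) \<phi> x) \<le> A"
      using test_bounded_funpow[OF \<phi>] by metis
    from term_le[OF \<phi> this] show ?thesis
      by (intro summable_on_comparison_test[OF sum_inv]) auto
  qed
  note smm = abs_summable_summable[OF norm_sum]
  have sub: "synth c (\<lambda>x. \<phi> x - \<eta> x) = synth c \<phi> - synth c \<eta>" if "\<phi> \<in> \<P>" "\<eta> \<in> \<P>" for \<phi> \<eta>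
  proof -
    have "((\<lambda>k. c k * hat \<phi> (- k) - c k * hat \<eta> (- k)) has_sum
        (\<Sum>\<^sub>\<infinity>k. c k * hat \<phi> (- k)) - (\<Sum>\<^sub>\<infinity>k. c k * hat \<eta> (- k))) UNIV"
      using has_sum_add[OF has_sum_infsum[OF smm[OF that(1)]]
          has_sum_cmult_right[OF has_sum_infsum[OF smm[OF that(2)]], of "-1"]] by simp
    from infsumI[OF this] show ?thesis
      using that by (simp add: synth_def test_diff hat_diff test_continuous ring_distribs)
  qed
  show "synth c \<in> \<P>'"
  proof (rule periodic_distributionI)
    fix \<phi> \<eta> assume "\<phi> \<in> \<P>" "\<eta> \<in> \<P>"
    then show "synth c (\<lambda>x. \<phi> x + \<eta> x) = synth c \<phi> + synth c \<eta>"
      using sub[OF test_add, of \<phi> \<eta> \<eta>] by simp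
  next
    fix e \<phi> assume "\<phi> \<in> \<P>"
    then show "synth c (\<lambda>x. e * \<phi> x) = e * synth c \<phi>"
      by (simp add: synth_def test_scale hat_scale mult.left_commute[of _ e] infsum_cmult_right')
  next
    fix \<Phi> \<phi> assume \<Phi>: "test_tendsto \<Phi> \<phi>"
    then have mem: "\<Phi> n \<in> \<P>" "\<phi> \<in> \<P>" for n by (auto simp: test_tendsto_def)
    \<comment> \<open>\<open>K * A\<close> bounds the functional on test functions for which they
      and their derivatives of order \<open>p + 2\<close> are at most \<open>A\<close> in
      modulus.\<close>
    define K where "K = 2 * pi * (C * 2 ^ (p + 3) * infsum inv_sq UNIV)"
    have K: "K \<ge> 0" using C by (simp add: K_def infsum_nonneg)
    show "(\<lambda>n. synth c (\<Phi> n)) \<longlonglongrightarrow> synth c \<phi>"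
    proof (rule LIMSEQ_I)
      fix e :: real assume "e > 0"
      define A where "A = e / (K + 1)"
      have A: "A > 0" "K * A < e" using \<open>e > 0\<close> K by (auto simp: A_def field_simps)
      have "\<forall>\<^sub>F n in sequentially. \<forall>x\<in>UNIV. dist ((Dx ^^ j) (\<Phi> n) x) ((Dx ^^ j) \<phi> x) < A" for j
        using \<Phi> A(1) unfolding test_tendsto_def by (intro uniform_limitD) auto
      from this[of 0] this[of "p + 2"]
      have "\<forall>\<^sub>F n in sequentially. norm (synth c (\<Phi> n) - synth c \<phi>) < e"
      proof eventually_elim
        case (elim n)
        define \<eta> where "\<eta> = (\<lambda>x. \<Phi> n x - \<phi> x)"
        have \<eta>: "\<eta> \<in> \<P>" unfolding \<eta>_def by (rule test_diff[OF mem])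
        have "cmod (\<eta> x) \<le> A" "cmod ((Dx ^^ (p + 2)) \<eta> x) \<le> A" for x
          using elim unfolding \<eta>_def funpow_Dx_diff[OF mem] by (auto simp: dist_norm less_imp_le)
        note t = term_le[OF \<eta> this]
        have "cmod (\<Sum>\<^sub>\<infinity>k. c k * hat \<eta> (- k)) \<le> (\<Sum>\<^sub>\<infinity>k. (C * (2 ^ (p + 3) * A)) * inv_sq k)"
          by (rule norm_infsum_le[OF has_sum_infsum[OF smm[OF \<eta>]] has_sum_infsum[OF sum_inv] t])
        then have "cmod (synth c \<eta>) \<le> K * A"
          unfolding infsum_cmult_right' by (simp add: synth_def \<eta> norm_mult K_def mult_ac)
        then show ?case using A(2) sub[OF mem] by (simp add: \<eta>_def)
      qed
      then show "\<exists>N. \<forall>n\<ge>N. norm (synth c (\<Phi> n) - synth c \<phi>) < e"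
        by (simp add: eventually_sequentially)
    qed
  qed (simp add: synth_def)
  have "(\<Sum>\<^sub>\<infinity>j. c j * hat (trig (- k)) (- j)) = (\<Sum>\<^sub>\<infinity>j\<in>{k}. c j * hat (trig (- k)) (- j))"
    by (rule infsum_cong_neutral) (auto simp: hat_trig)
  then have "synth c (trig (- k)) = of_real (2 * pi) * c k"
    by (simp add: synth_def test_trig hat_trig)
  then show "fourier_coeff (synth c) k = c k"
    by (subst fourier_coeff_trig) simp
qed

section \<open>Sobolev spaces as weighted sequence spaces\<close>

text \<open>The value \<open>R = 1\<close> gives the norm of \<open>Hs s\<close> up to the factor \<open>sqrt (2 * pi)\<close>; larger \<open>R\<close> give
  equivalent norms.\<close>

definition emb :: "real \<Rightarrow> real \<Rightarrow> pdist \<Rightarrow> int ell2" where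
  "emb R s v = Ell2 (\<lambda>k. of_real (weight R s k) * fourier_coeff v k)"

lemma weight_square: "(1 + \<bar>real_of_int k\<bar>) powr (2 * s) = (weight 1 s k)\<^sup>2"
  by (simp add: weight_def powr_power add_pos_nonneg mult.commute)

lemma Hs_iff: "v \<in> Hs s \<longleftrightarrow> v \<in> \<P>' \<and>
    (\<lambda>k. (cmod (of_real (weight 1 s k) * fourier_coeff v k))\<^sup>2) summable_on UNIV"
  by (simp add: Hs_def weight_square norm_mult power_mult_distrib)

lemma Hs_pd: "v \<in> Hs s \<Longrightarrow> v \<in> \<P>'"
  by (simp add: Hs_iff)

lemma Hs_norm_eq:
  assumes "v \<in> Hs s"
  shows "Hs_norm s v = sqrt (2 * pi) * norm (emb 1 s v)"
proof -
  have "(\<Sum>\<^sub>\<infinity>k::int. (1 + \<bar>real_of_int k\<bar>) powr (2 * s) * (cmod (fourier_coeff v k))\<^sup>2) = (norm (emb 1 s v))\<^sup>2"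
    using assms by (simp add: weight_square norm_ell2_sq emb_def coord_Ell2 Hs_iff norm_mult power_mult_distrib)
  then show ?thesis by (simp add: Hs_norm_def real_sqrt_mult)
qed

definition reweight :: "real \<Rightarrow> real \<Rightarrow> real \<Rightarrow> int \<Rightarrow> complex" where
  "reweight R R' s k = of_real (weight R s k / weight R' s k)"

text \<open>From \<open>1 + \<bar>k\<bar> \<le> R + \<bar>k\<bar> \<le> R * (1 +
  \<bar>k\<bar>)\<close>: changing \<open>R\<close> costs at most
  \<open>R powr \<bar>s\<bar>\<close> in either direction.\<close>

lemma norm_reweight_le:
  assumes "R \<ge> 1"
  shows "cmod (reweight R 1 s k) \<le> R powr \<bar>s\<bar>" "cmod (reweight 1 R s k) \<le> R powr \<bar>s\<bar>"
proof -
  have p: "R + \<bar>real_of_int k\<bar> > 0" "1 + \<bar>real_of_int k\<bar> > 0" using assms by (auto simp: add_pos_nonneg)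
  have "R + \<bar>real_of_int k\<bar> \<le> R * (1 + \<bar>real_of_int k\<bar>)"
    using mult_right_mono[OF assms, of "\<bar>real_of_int k\<bar>"] by (simp add: algebra_simps)
  then have 1: "(R + \<bar>real_of_int k\<bar>) / (1 + \<bar>real_of_int k\<bar>) \<le> R"
    "1 / R \<le> (1 + \<bar>real_of_int k\<bar>) / (R + \<bar>real_of_int k\<bar>)"
    using p assms by (simp_all add: field_simps)
  have "1 / R \<le> 1" using assms by simp
  also have "1 \<le> (R + \<bar>real_of_int k\<bar>) / (1 + \<bar>real_of_int k\<bar>)"
    using p assms by (simp add: field_simps)
  finally have 2: "1 / R \<le> (R + \<bar>real_of_int k\<bar>) / (1 + \<bar>real_of_int k\<bar>)" .
  have "(1 + \<bar>real_of_int k\<bar>) / (R + \<bar>real_of_int k\<bar>) \<le> 1" using p assms by (simp add: field_simps)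
  with assms have 3: "(1 + \<bar>real_of_int k\<bar>) / (R + \<bar>real_of_int k\<bar>) \<le> R" by linarith
  show "cmod (reweight R 1 s k) \<le> R powr \<bar>s\<bar>" "cmod (reweight 1 R s k) \<le> R powr \<bar>s\<bar>"
    using powr_between[OF assms 2 1(1), of s] powr_between[OF assms 1(2) 3, of s] p
    by (simp_all add: reweight_def weight_def norm_divide powr_divide)
qed

lemma
  assumes "v \<in> Hs s" "R \<ge> 1"
  shows coord_emb: "coord (emb R s v) k = of_real (weight R s k) * fourier_coeff v k"
    and emb_reweight: "emb R s v = dop (reweight R 1 s) (emb 1 s v)"
proof -
  have co: "coord (emb 1 s v) k = of_real (weight 1 s k) * fourier_coeff v k" for k
    using assms by (simp add: emb_def coord_Ell2 Hs_iff)
  have w: "weight 1 s k \<noteq> 0" for k using weight_pos[of 1 s k] by simp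
  have c: "coord (dop (reweight R 1 s) (emb 1 s v)) k = of_real (weight R s k) * fourier_coeff v k" for k
    by (simp add: coord_dop[of "reweight R 1 s", OF norm_reweight_le(1)[OF assms(2)]] co reweight_def w)
  then have "(\<lambda>k. of_real (weight R s k) * fourier_coeff v k) = coord (dop (reweight R 1 s) (emb 1 s v))"
    by auto
  then show e: "emb R s v = dop (reweight R 1 s) (emb 1 s v)"
    by (simp add: emb_def coord_inverse)
  show "coord (emb R s v) k = of_real (weight R s k) * fourier_coeff v k" by (simp add: e c)
qed

lemma norm_emb_le:
  assumes "v \<in> Hs s" "R \<ge> 1"
  shows "norm (emb R s v) \<le> R powr \<bar>s\<bar> * norm (emb 1 s v)"
    and "norm (emb 1 s v) \<le> R powr \<bar>s\<bar> * norm (emb R s v)"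
proof -
  show "norm (emb R s v) \<le> R powr \<bar>s\<bar> * norm (emb 1 s v)"
    unfolding emb_reweight[OF assms] by (rule norm_dop_le[OF norm_reweight_le(1)[OF assms(2)]])
  have "weight R s k \<noteq> 0" for k using weight_pos[of R s k] assms by simp
  then have "emb 1 s v = dop (reweight 1 R s) (emb R s v)"
    by (intro ell2_eqI)
      (simp add: coord_emb assms coord_dop[of "reweight 1 R s", OF norm_reweight_le(2)[OF assms(2)]] reweight_def)
  then show "norm (emb 1 s v) \<le> R powr \<bar>s\<bar> * norm (emb R s v)"
    using norm_dop_le[of "reweight 1 R s", OF norm_reweight_le(2)[OF assms(2)]] by metis
qed

lemma
  assumes "v \<in> \<P>'" "\<And>k. coord y k = of_real (weight 1 s k) * fourier_coeff v k"
  shows HsI: "v \<in> Hs s" and emb_eqI: "emb 1 s v = y"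
proof -
  have y: "(\<lambda>k. of_real (weight 1 s k) * fourier_coeff v k) = coord y" using assms(2) by auto
  show "emb 1 s v = y" by (simp add: emb_def y coord_inverse)
  show "v \<in> Hs s" by (simp add: Hs_iff assms(1) y coord_sq_summable assms(2)[symmetric])
qed

lemma
  assumes "u \<in> Hs s" "v \<in> Hs s" "R \<ge> 1"
  shows Hs_minus: "u - v \<in> Hs s" and emb_minus: "emb R s (u - v) = emb R s u - emb R s v"
proof -
  show uv: "u - v \<in> Hs s"
    by (rule HsI[where y = "emb 1 s u - emb 1 s v"])
      (use assms in \<open>simp_all add: pd_minus_closed Hs_pd coord_emb fourier_coeff_minus algebra_simps\<close>)
  show "emb R s (u - v) = emb R s u - emb R s v"
    by (rule ell2_eqI) (simp add: coord_emb uv assms fourier_coeff_minus algebra_simps)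
qed

lemma
  assumes "v \<in> Hs s"
  shows Hs_scale: "dist_scale (of_real c) v \<in> Hs s"
    and emb_scale: "emb 1 s (dist_scale (of_real c) v) = c *\<^sub>R emb 1 s v"
  by (rule HsI[where y = "c *\<^sub>R emb 1 s v"] emb_eqI[where y = "c *\<^sub>R emb 1 s v"];
      use assms in \<open>simp add: pd_scale_closed Hs_pd coord_emb fourier_coeff_scale scaleR_conv_of_real\<close>)+

lemma Hs_mono:
  assumes "v \<in> Hs s" "s' \<le> s"
  shows "v \<in> Hs s'"
proof -
  have b: "cmod (of_real (weight 1 (s' - s) k)) \<le> 1" for k
    using powr_mono[of "s' - s" 0 "1 + \<bar>real_of_int k\<bar>"] assms(2)
    by (simp add: weight_def add_nonneg_eq_0_iff)
  have "weight 1 s' k = weight 1 (s' - s) k * weight 1 s k" for k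
    by (simp add: weight_def flip: powr_add)
  then show ?thesis
    by (intro HsI[where y = "dop (\<lambda>k. of_real (weight 1 (s' - s) k)) (emb 1 s v)"])
      (use assms in \<open>simp_all add: Hs_pd coord_emb coord_dop[of "\<lambda>k. of_real (weight 1 (s' - s) k)", OF b]\<close>)
qed

text \<open>The embedding is onto, which turns sequences back into distributions when a solution is
  constructed. Coordinates are bounded, so division by a weight of order \<open>s\<close> leaves
  polynomial growth.\<close>

lemma synth_emb:
  fixes y :: "int ell2" and s :: real
  defines "v \<equiv> synth (\<lambda>k. coord y k / of_real (weight 1 s k))"
  shows "v \<in> Hs s" "emb 1 s v = y"
proof -
  define p where "p = nat \<lceil>\<bar>s\<bar>\<rceil>"
  have bound: "cmod (coord y k / of_real (weight 1 s k)) \<le> norm y * (1 + \<bar>real_of_int k\<bar>) ^ p" for k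
  proof -
    define b where "b = 1 + \<bar>real_of_int k\<bar>"
    have b: "b \<ge> 1" by (simp add: b_def)
    have "b powr (- s) \<le> b powr \<bar>s\<bar>" using b by (intro powr_mono) auto
    also have "\<dots> \<le> b ^ p" unfolding p_def by (rule powr_le_natpower[OF b])
    finally have le: "b powr (- s) \<le> b ^ p" .
    have "cmod (coord y k / of_real (weight 1 s k)) = cmod (coord y k) * b powr (- s)"
      by (simp add: norm_divide weight_def b_def powr_minus_divide)
    also have "\<dots> \<le> norm y * b ^ p"
      using le by (intro mult_mono norm_coord_le) auto
    finally show ?thesis by (simp add: b_def)
  qed
  have w: "weight 1 s k \<noteq> 0" for k using weight_pos[of 1 s k] by simp
  have co: "coord y k = of_real (weight 1 s k) * fourier_coeff v k" for k
    unfolding v_def by (subst fourier_coeff_synth[OF bound]) (simp add: w)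
  have v: "v \<in> \<P>'" unfolding v_def by (rule synth_closed[OF bound])
  show "v \<in> Hs s" "emb 1 s v = y" by (rule HsI[OF v co] emb_eqI[OF v co])+
qed

section \<open>The control operator\<close>

lemma hat_cnj: "hat (\<lambda>x. cnj (f x)) k = cnj (hat f (- k))"
proof -
  have "integral {0..2 * pi} (\<lambda>x. cnj (f x) * trig (- k) x) = integral {0..2 * pi} (\<lambda>x. cnj (f x * trig k x))"
    by (simp add: trig_cnj)
  also have "\<dots> = cnj (integral {0..2 * pi} (\<lambda>x. f x * trig k x))"
    by (rule integral_cnj[symmetric])
  finally show ?thesis by (simp add: hat_eq)
qed

locale control =
  fixes g :: "real \<Rightarrow> real"
  assumes smooth: "(\<lambda>x. complex_of_real (g x)) \<in> \<P>"
    and mean: "integral {0..2 * pi} g = 1"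
begin

definition gc :: "real \<Rightarrow> complex" where "gc x = of_real (g x)"

text \<open>The Fourier matrix of \<open>G\<close>: multiplication by \<open>g\<close> is a
  convolution, and the rank-one part comes from expanding \<open>v gc\<close> as
  \<open>2 * pi\<close> times the sum of \<open>hat gc (- j) * fourier_coeff v j\<close>.\<close>

definition gker :: "int \<Rightarrow> int \<Rightarrow> complex" where
  "gker k j = hat gc (k - j) - 2 * of_real pi * hat gc k * hat gc (- j)"

lemma gc: "gc \<in> \<P>"
  using smooth by (simp add: gc_def[abs_def])

lemma hat_gc_0: "hat gc 0 = 1 / of_real (2 * pi)"
proof -
  have "continuous_on {0..2 * pi} (\<lambda>x. Re (gc x))"
    by (intro continuous_intros test_continuous gc)
  then have "g integrable_on {0..2 * pi}"
    by (intro integrable_continuous_real) (simp add: gc_def)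
  from integral_linear[OF this bounded_linear_of_real]
  have "integral {0..2 * pi} gc = 1" by (simp add: mean o_def gc_def[abs_def])
  then show ?thesis by (simp add: hat_eq)
qed

lemma cnj_hat_gc: "cnj (hat gc k) = hat gc (- k)"
  using hat_cnj[of gc "- k"] by (simp add: gc_def[abs_def])

lemma gker_hermitian: "gker j k = cnj (gker k j)"
  by (simp add: gker_def cnj_hat_gc mult_ac)

text \<open>\<open>G\<close> kills constants and its range has mean zero; both reflect the
  normalisation \<open>2 * pi * hat gc 0 = 1\<close>.\<close>

lemma gker_0: "gker k 0 = 0" "gker 0 j = 0"
  by (simp_all add: gker_def hat_gc_0)

lemma rapid_gker: "rapid gker"
  unfolding rapid_def
proof
  fix N
  obtain C where C: "C \<ge> 0" "\<And>k. cmod (hat gc k) * (1 + \<bar>real_of_int k\<bar>) ^ N \<le> C"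
    using hat_rapid[OF gc] by blast
  have "cmod (gker k j) * (1 + \<bar>real_of_int (k - j)\<bar>) ^ N \<le> C + 2 * pi * (C * C)" for k j
  proof -
    define b where "b = (1 + \<bar>real_of_int (k - j)\<bar>) ^ N"
    have b: "b \<ge> 0" by (simp add: b_def)
    \<comment> \<open>The rank-one part decays in \<open>k\<close> and \<open>j\<close> separately;
      by \<open>peetre_int\<close> through the origin, this implies decay in
      \<open>k - j\<close>.\<close>
    have "b \<le> ((1 + \<bar>real_of_int k\<bar>) * (1 + \<bar>real_of_int j\<bar>)) ^ N"
      unfolding b_def using peetre_int[of k j 0] by (intro power_mono) auto
    then have "cmod (hat gc k) * cmod (hat gc (- j)) * b
        \<le> cmod (hat gc k) * cmod (hat gc (- j)) * ((1 + \<bar>real_of_int k\<bar>) * (1 + \<bar>real_of_int j\<bar>)) ^ N"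
      by (intro mult_left_mono) auto
    also have "\<dots> = (cmod (hat gc k) * (1 + \<bar>real_of_int k\<bar>) ^ N) * (cmod (hat gc (- j)) * (1 + \<bar>real_of_int (- j)\<bar>) ^ N)"
      by (simp add: power_mult_distrib mult_ac)
    also have "\<dots> \<le> C * C" by (intro mult_mono C) (use C(1) in auto)
    finally have 2: "cmod (hat gc k) * cmod (hat gc (- j)) * b \<le> C * C" .
    have "cmod (gker k j) * b \<le> (cmod (hat gc (k - j)) + 2 * pi * (cmod (hat gc k) * cmod (hat gc (- j)))) * b"
      unfolding gker_def
      by (intro mult_right_mono b order_trans[OF norm_triangle_ineq4]) (simp add: norm_mult)
    also have "\<dots> = cmod (hat gc (k - j)) * b + 2 * pi * (cmod (hat gc k) * cmod (hat gc (- j)) * b)"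
      by (simp add: algebra_simps)
    also have "\<dots> \<le> C + 2 * pi * (C * C)"
      using C(2)[of "k - j"] by (intro add_mono mult_left_mono 2) (auto simp: b_def)
    finally show ?thesis by (simp add: b_def)
  qed
  then show "\<exists>C. \<forall>k j. cmod (gker k j) * (1 + \<bar>real_of_int (k - j)\<bar>) ^ N \<le> C" by blast
qed

lemma G_op_eq: "G_op g v = dist_mult gc v - dist_scale (v gc) (dist_of gc)"
  by (simp add: G_op_def Let_def gc_def[abs_def])

lemma G_op_closed: "v \<in> \<P>' \<Longrightarrow> G_op g v \<in> \<P>'"
  unfolding G_op_eq by (intro pd_minus_closed pd_mult_closed pd_scale_closed pd_of_closed gc)

lemma G_op_apply:
  "\<phi> \<in> \<P> \<Longrightarrow> G_op g v \<phi> = v (\<lambda>x. gc x * \<phi> x) - v gc * integral {0..2 * pi} (\<lambda>x. gc x * \<phi> x)"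
  by (simp add: G_op_eq dist_mult_def dist_scale_def dist_of_def)

text \<open>The smooth function behind \<open>G (cnj \<circ> \<phi>)\<close> is the explicit
  \<open>\<eta>\<close>, and it is unique because coefficients determine test functions;
  \<open>g\<close> being real removes the conjugates.\<close>

lemma G_op_selfadjoint:
  assumes u: "u \<in> \<P>'"
  shows "L2_adjoint (G_op g) u = G_op g u"
proof
  fix \<phi>
  show "L2_adjoint (G_op g) u \<phi> = G_op g u \<phi>"
  proof (cases "\<phi> \<in> \<P>")
    case \<phi>: True
    define J where "J = integral {0..2 * pi} (\<lambda>x. gc x * cnj (\<phi> x))"
    define \<eta> where "\<eta> = (\<lambda>x. gc x * cnj (\<phi> x) - J * gc x)"
    have c\<phi>: "(\<lambda>x. cnj (\<phi> x)) \<in> \<P>" by (rule test_cnj[OF \<phi>])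
    have \<eta>: "\<eta> \<in> \<P>" unfolding \<eta>_def by (intro test_diff test_mult test_scale gc c\<phi>)
    have eq: "dist_of \<eta> = G_op g (dist_of (\<lambda>x. cnj (\<phi> x)))"
    proof
      fix \<theta>
      show "dist_of \<eta> \<theta> = G_op g (dist_of (\<lambda>x. cnj (\<phi> x))) \<theta>"
      proof (cases "\<theta> \<in> \<P>")
        case \<theta>: True
        have "dist_of \<eta> \<theta> = integral {0..2 * pi} (\<lambda>x. cnj (\<phi> x) * (gc x * \<theta> x) - J * (gc x * \<theta> x))"
          using \<theta> by (simp add: dist_of_def \<eta>_def algebra_simps)
        also have "\<dots> = integral {0..2 * pi} (\<lambda>x. cnj (\<phi> x) * (gc x * \<theta> x)) - J * integral {0..2 * pi} (\<lambda>x. gc x * \<theta> x)"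
          by (subst integral_diff[OF integrable_continuous_real[OF test_continuous[OF test_mult[OF c\<phi> test_mult[OF gc \<theta>]]]]
                integrable_continuous_real[OF test_continuous[OF test_scale[OF test_mult[OF gc \<theta>]]]]]) simp
        also have "\<dots> = G_op g (dist_of (\<lambda>x. cnj (\<phi> x))) \<theta>"
          by (simp add: G_op_apply[OF \<theta>] dist_of_def test_mult gc \<theta> J_def mult.commute)
        finally show ?thesis .
      qed (simp add: dist_of_def G_op_eq dist_mult_def dist_scale_def)
    qed
    have the: "(THE \<eta>. \<eta> \<in> \<P> \<and> dist_of \<eta> = G_op g (dist_of (\<lambda>x. cnj (\<phi> x)))) = \<eta>"
    proof (rule the_equality)
      show "\<eta> \<in> \<P> \<and> dist_of \<eta> = G_op g (dist_of (\<lambda>x. cnj (\<phi> x)))" by (intro conjI \<eta> eq)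
      fix \<eta>' assume \<eta>': "\<eta>' \<in> \<P> \<and> dist_of \<eta>' = G_op g (dist_of (\<lambda>x. cnj (\<phi> x)))"
      then have "dist_of \<eta>' = dist_of \<eta>" unfolding eq by blast
      with \<eta>' show "\<eta>' = \<eta>" by (intro test_eqI \<eta>) auto
    qed
    have gr: "cnj (gc x) = gc x" for x by (simp add: gc_def)
    have J: "cnj J = integral {0..2 * pi} (\<lambda>x. gc x * \<phi> x)"
      by (simp add: J_def integral_cnj gr)
    have "L2_adjoint (G_op g) u \<phi> = u (\<lambda>x. gc x * \<phi> x - cnj J * gc x)"
      using \<phi> by (simp add: L2_adjoint_def the \<eta>_def gr)
    also have "\<dots> = u (\<lambda>x. gc x * \<phi> x) - cnj J * u gc"
      by (subst pd_diff[OF u]) (simp_all add: test_mult test_scale gc \<phi> pd_scale[OF u])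
    also have "\<dots> = G_op g u \<phi>" by (simp add: G_op_apply[OF \<phi>] J)
    finally show ?thesis .
  qed (simp add: L2_adjoint_def G_op_eq dist_mult_def dist_scale_def dist_of_def)
qed

text \<open>A multiple of the Parseval pairing of \<open>v\<close> with
  \<open>gc x * trig (- k) x\<close>, minus that with \<open>gc\<close>; for a general distribution
  it is expanded in symmetric partial sums.\<close>

lemma fourier_coeff_G_op:
  assumes v: "v \<in> \<P>'"
  shows "(\<lambda>n. \<Sum>j\<in>{- int n..int n}. gker k j * fourier_coeff v j) \<longlonglongrightarrow> fourier_coeff (G_op g v) k"
proof -
  define c where "c = complex_of_real (2 * pi)"
  have c0: "c \<noteq> 0" by (simp add: c_def)
  have fc: "fourier_coeff (G_op g v) k = v (\<lambda>x. gc x * trig (- k) x) / c - v gc * hat gc k"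
    by (subst fourier_coeff_trig) (simp add: G_op_apply[OF test_trig] hat_eq diff_divide_distrib c_def)
  have h: "hat (\<lambda>x. gc x * trig (- k) x) (- j) = hat gc (k - j)" for j
    using hat_mult_trig[of gc "- k" "- j"] by simp
  have "(\<lambda>n. c * (\<Sum>j\<in>{- int n..int n}. hat gc (k - j) * fourier_coeff v j) / c
      - c * (\<Sum>j\<in>{- int n..int n}. hat gc (- j) * fourier_coeff v j) * hat gc k)
     \<longlonglongrightarrow> v (\<lambda>x. gc x * trig (- k) x) / c - v gc * hat gc k"
    using pd_fourier_series[OF v test_mult[OF gc test_trig], of "- k", unfolded h] pd_fourier_series[OF v gc]
    unfolding c_def by (intro tendsto_intros) auto
  moreover have "c * (\<Sum>j\<in>{- int n..int n}. hat gc (k - j) * fourier_coeff v j) / c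
      - c * (\<Sum>j\<in>{- int n..int n}. hat gc (- j) * fourier_coeff v j) * hat gc k
    = (\<Sum>j\<in>{- int n..int n}. gker k j * fourier_coeff v j)" for n
  proof -
    have "c * (\<Sum>j\<in>{- int n..int n}. hat gc (- j) * fourier_coeff v j) * hat gc k
       = (\<Sum>j\<in>{- int n..int n}. c * hat gc k * hat gc (- j) * fourier_coeff v j)"
      by (simp add: sum_distrib_left sum_distrib_right mult_ac)
    moreover have "c * (\<Sum>j\<in>{- int n..int n}. hat gc (k - j) * fourier_coeff v j) / c
       = (\<Sum>j\<in>{- int n..int n}. hat gc (k - j) * fourier_coeff v j)"
      using c0 by simp
    ultimately show ?thesis
      by (simp add: gker_def left_diff_distrib sum_subtractf c_def)
  qed
  ultimately show ?thesis by (simp add: fc)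
qed

definition gker2 :: "int \<Rightarrow> int \<Rightarrow> complex" where
  "gker2 k j = (\<Sum>\<^sub>\<infinity>l. gker k l * gker l j)"

lemma rapid_gker2: "rapid gker2"
  unfolding gker2_def[abs_def] by (rule rapid_compose[OF rapid_gker rapid_gker])

text \<open>The inner weights cancel, so conjugation respects composition and the conjugated
  \<open>gker2\<close> is again a square.\<close>

lemma conj_weight_gker2:
  assumes "R \<ge> 1"
  shows "conj_weight R s gker2 = (\<lambda>k j. \<Sum>\<^sub>\<infinity>l. conj_weight R s gker k l * conj_weight R s gker l j)"
proof (intro ext)
  fix k j
  have w: "complex_of_real (weight R s l) \<noteq> 0" for l
    using weight_pos[of R s l] assms by simp
  have "conj_weight R s gker k l * conj_weight R s gker l j
      = (gker k l * gker l j) * of_real (weight R s k / weight R s j)" for l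
    using w[of l] by (simp add: conj_weight_def)
  then show "conj_weight R s gker2 k j = (\<Sum>\<^sub>\<infinity>l. conj_weight R s gker k l * conj_weight R s gker l j)"
    by (simp only: infsum_cmult_left') (simp add: conj_weight_def gker2_def)
qed

lemma kop_gker2:
  assumes "R \<ge> 1"
  shows "kop (conj_weight R s gker2) x = kop (conj_weight R s gker) (kop (conj_weight R s gker) x)"
proof -
  obtain C where C: "kernel (\<lambda>d. C * inv_sq d) (conj_weight R s gker)"
    using rapid_kernel[OF rapid_conj_weight[OF rapid_gker assms]] by metis
  obtain C' where C': "kernel (\<lambda>d. C' * inv_sq d) (conj_weight R s gker2)"
    using rapid_kernel[OF rapid_conj_weight[OF rapid_gker2 assms]] by metis
  show ?thesis
    using kop_compose[OF C C C'[unfolded conj_weight_gker2[OF assms]], of x]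
    by (simp add: conj_weight_gker2[OF assms])
qed

text \<open>On a weighted sequence the rows of the kernel converge unordered, and their symmetric
  partial sums are those of \<open>fourier_coeff_G_op\<close>; uniqueness of limits identifies the
  two operators.\<close>

lemma
  assumes v: "v \<in> Hs s"
  shows G_op_Hs: "G_op g v \<in> Hs s"
    and emb_G_op: "R \<ge> 1 \<Longrightarrow> emb R s (G_op g v) = kop (conj_weight R s gker) (emb R s v)"
proof -
  have co: "coord (kop (conj_weight R s gker) (emb R s v)) k = of_real (weight R s k) * fourier_coeff (G_op g v) k"
    if R: "R \<ge> 1" for R k
  proof -
    obtain C where C: "kernel (\<lambda>d. C * inv_sq d) (conj_weight R s gker)"
      using rapid_kernel[OF rapid_conj_weight[OF rapid_gker R]] by metis
    have w: "complex_of_real (weight R s j) \<noteq> 0" for j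
      using weight_pos[of R s j] R by simp
    have "conj_weight R s gker k j * coord (emb R s v) j
        = of_real (weight R s k) * (gker k j * fourier_coeff v j)" for j
      using w[of j] by (simp add: conj_weight_def coord_emb[OF v R])
    then have "((\<lambda>j. of_real (weight R s k) * (gker k j * fourier_coeff v j)) has_sum
        coord (kop (conj_weight R s gker) (emb R s v)) k) UNIV"
      using kop_has_sum[OF C, of k "emb R s v"] by simp
    then have "(\<lambda>n. \<Sum>j\<in>{- int n..int n}. of_real (weight R s k) * (gker k j * fourier_coeff v j))
        \<longlonglongrightarrow> coord (kop (conj_weight R s gker) (emb R s v)) k"
      unfolding has_sum_def by (rule filterlim_compose[OF _ filterlim_symmetric_intervals])
    moreover have "(\<lambda>n. \<Sum>j\<in>{- int n..int n}. of_real (weight R s k) * (gker k j * fourier_coeff v j))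
        \<longlonglongrightarrow> of_real (weight R s k) * fourier_coeff (G_op g v) k"
      unfolding sum_distrib_left[symmetric]
      by (intro tendsto_mult_left fourier_coeff_G_op Hs_pd[OF v])
    ultimately show ?thesis by (rule LIMSEQ_unique)
  qed
  show G: "G_op g v \<in> Hs s"
    by (rule HsI[OF G_op_closed[OF Hs_pd[OF v]] co]) simp
  show "emb R s (G_op g v) = kop (conj_weight R s gker) (emb R s v)" if R: "R \<ge> 1"
    by (rule ell2_eqI) (simp add: co[OF R] coord_emb[OF G R])
qed

subsection \<open>Observability of the eigenspaces\<close>

text \<open>\<open>\<kappa>\<close> is the pairing of the trigonometric polynomial \<open>Y\<close>
  with \<open>g\<close>, so \<open>gc x * (Y x - \<kappa>)\<close> is \<open>G Y\<close> as a
  function.\<close>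

lemma gker_trig_poly:
  fixes y :: "int \<Rightarrow> complex"
  assumes "finite F"
  defines "Y \<equiv> \<lambda>x. \<Sum>j\<in>F. y j * trig j x"
  defines "\<kappa> \<equiv> \<Sum>j\<in>F. y j * (2 * of_real pi * hat gc (- j))"
  shows "hat (\<lambda>x. gc x * (Y x - \<kappa>)) k = (\<Sum>j\<in>F. gker k j * y j)"
    and "(\<lambda>x. gc x * (Y x - \<kappa>)) \<in> \<P>"
proof -
  show "(\<lambda>x. gc x * (Y x - \<kappa>)) \<in> \<P>"
    unfolding Y_def by (intro test_mult test_diff test_sum test_scale gc test_const test_trig)
  have "(\<lambda>x. gc x * (Y x - \<kappa>)) = (\<lambda>x. (\<Sum>j\<in>F. y j * (gc x * trig j x)) - \<kappa> * gc x)"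
    by (auto simp: Y_def right_diff_distrib sum_distrib_left mult_ac)
  then have "hat (\<lambda>x. gc x * (Y x - \<kappa>)) k = hat (\<lambda>x. (\<Sum>j\<in>F. y j * (gc x * trig j x)) - \<kappa> * gc x) k"
    by presburger
  also have "\<dots> = hat (\<lambda>x. \<Sum>j\<in>F. y j * (gc x * trig j x)) k - hat (\<lambda>x. \<kappa> * gc x) k"
    by (intro hat_diff test_continuous test_sum test_scale test_mult gc test_trig)
  also have "hat (\<lambda>x. \<Sum>j\<in>F. y j * (gc x * trig j x)) k = (\<Sum>j\<in>F. hat (\<lambda>x. y j * (gc x * trig j x)) k)"
    by (intro hat_sum test_scale test_mult gc test_trig)
  also have "\<dots> = (\<Sum>j\<in>F. y j * hat gc (k - j))"
    by (simp only: hat_scale hat_mult_trig)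
  also have "(\<Sum>j\<in>F. y j * hat gc (k - j)) - hat (\<lambda>x. \<kappa> * gc x) k = (\<Sum>j\<in>F. gker k j * y j)"
    unfolding hat_scale
    by (simp add: \<kappa>_def gker_def sum_distrib_left sum_distrib_right sum_subtractf algebra_simps)
  finally show "hat (\<lambda>x. gc x * (Y x - \<kappa>)) k = (\<Sum>j\<in>F. gker k j * y j)" .
qed

end

text \<open>A trigonometric polynomial of degree at most \<open>N\<close> is a polynomial of degree at most
  \<open>2 * N\<close> in \<open>e\<^sup>i\<^sup>x\<close>, divided by \<open>e\<^sup>i\<^sup>N\<^sup>x\<close>.\<close>

lemma trig_poly_eq_0:
  assumes "a < b" and zero: "\<And>x. x \<in> {a<..<b} \<Longrightarrow> (\<Sum>j\<in>{- int N..int N}. y j * trig j x) = 0"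
    and j: "j \<in> {- int N..int N}"
  shows "y j = 0"
proof (rule ccontr)
  assume "y j \<noteq> 0"
  define c where "c = (\<lambda>i. y (int i - int N))"
  have "trig 1 x \<in> {z. (\<Sum>i\<le>2 * N. c i * z ^ i) = 0}" if "x \<in> {a<..<b}" for x
  proof -
    have t: "trig (int i) x = trig 1 x ^ i" for i
      by (induction i) (simp_all add: trig_add)
    have "(\<Sum>i\<le>2 * N. c i * trig 1 x ^ i) = (\<Sum>j\<in>{- int N..int N}. y j * trig (j + int N) x)"
      by (rule sum.reindex_bij_witness[of _ "\<lambda>j. nat (j + int N)" "\<lambda>i. int i - int N"])
        (auto simp: c_def t[symmetric])
    also have "\<dots> = (\<Sum>j\<in>{- int N..int N}. y j * trig j x) * trig (int N) x"
      by (simp add: trig_add sum_distrib_left mult_ac)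
    finally show ?thesis using zero[OF that] by simp
  qed
  then have "trig 1 ` {a<..<b} \<subseteq> {z. (\<Sum>i\<le>2 * N. c i * z ^ i) = 0}" by blast
  moreover have "finite {z. (\<Sum>i\<le>2 * N. c i * z ^ i) = 0}"
  proof (rule polyfun_finite_roots[THEN iffD2])
    show "\<exists>i\<le>2 * N. c i \<noteq> 0"
      using j \<open>y j \<noteq> 0\<close> by (intro exI[of _ "nat (j + int N)"]) (auto simp: c_def)
  qed
  ultimately have fin: "finite (trig 1 ` {a<..<b})" by (rule finite_subset)
  \<comment> \<open>On an interval of length at most 1, shorter than a period, \<open>trig 1\<close>
    is injective and takes infinitely many values, too many for the roots of a nonzero
    polynomial.\<close>
  define b' where "b' = min b (a + 1)"
  have "inj_on (trig 1) {a<..<b'}"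
  proof (rule inj_onI)
    fix x x' assume x: "x \<in> {a<..<b'}" "x' \<in> {a<..<b'}" and "trig 1 x = trig 1 x'"
    then have "exp (\<i> * of_real x) = exp (\<i> * of_real x')" by (simp add: trig_def)
    then obtain n :: int where n: "x = x' + 2 * of_int n * pi"
      unfolding exp_eq by (auto simp: complex_eq_iff mult_ac)
    have "\<bar>x - x'\<bar> < 1" using x by (auto simp: b'_def)
    then have "\<bar>real_of_int n\<bar> * (2 * pi) < 1" by (simp add: n abs_mult)
    moreover have "1 \<le> 2 * pi" using pi_gt3 by simp
    ultimately have "\<bar>real_of_int n\<bar> < 1"
      using mult_left_mono[of 1 "2 * pi" "\<bar>real_of_int n\<bar>"] by simp
    then have "n = 0" by linarith
    with n show "x = x'" by simp
  qed
  moreover have "finite (trig 1 ` {a<..<b'})"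
    by (rule finite_subset[OF _ fin]) (auto simp: b'_def)
  ultimately have "finite {a<..<b'}" using finite_imageD by blast
  moreover have "infinite {a<..<b'}" using \<open>a < b\<close> by (intro infinite_Ioo) (auto simp: b'_def)
  ultimately show False by blast
qed

text \<open>Built as a Minkowski sum of discs, one coordinate at a time, since closed bounded sets
  in the infinite-dimensional space need not be compact.\<close>

lemma compact_finite_support:
  assumes "finite F"
  shows "compact {x :: int ell2. (\<forall>k\<in>F. cmod (coord x k) \<le> 1) \<and> (\<forall>k. k \<notin> F \<longrightarrow> coord x k = 0)}"
  using assms
proof (induction F)
  case empty
  have "{x :: int ell2. (\<forall>k\<in>{}. cmod (coord x k) \<le> 1) \<and> (\<forall>k. k \<notin> {} \<longrightarrow> coord x k = 0)} = {0}"
    by (auto intro: ell2_eqI)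
  then show ?case by simp
next
  case (insert i F)
  define S where "S = {x :: int ell2. (\<forall>k\<in>F. cmod (coord x k) \<le> 1) \<and> (\<forall>k. k \<notin> F \<longrightarrow> coord x k = 0)}"
  have "compact (single i ` cball 0 1)"
    by (intro compact_continuous_image bounded_linear.continuous_on[OF bounded_linear_single] continuous_on_id) auto
  with insert have "compact {x + y | x y. x \<in> S \<and> y \<in> single i ` cball 0 1}"
    by (intro compact_sums) (simp_all add: S_def)
  moreover have "{x + y | x y. x \<in> S \<and> y \<in> single i ` cball 0 1}
      = {x :: int ell2. (\<forall>k\<in>insert i F. cmod (coord x k) \<le> 1) \<and> (\<forall>k. k \<notin> insert i F \<longrightarrow> coord x k = 0)}" (is "?A = ?B")
  proof
    show "?A \<subseteq> ?B" using insert(2) by (auto simp: S_def)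
    show "?B \<subseteq> ?A"
    proof
      fix x assume x: "x \<in> ?B"
      have "x = (x - single i (coord x i)) + single i (coord x i)" by simp
      moreover have "x - single i (coord x i) \<in> S" using x insert(2) by (auto simp: S_def)
      moreover have "single i (coord x i) \<in> single i ` cball 0 1" using x by auto
      ultimately show "x \<in> ?A" by blast
    qed
  qed
  ultimately show ?case by simp
qed

text \<open>The norm of an injective map attains a positive minimum on the compact unit sphere of
  the subspace; homogeneity does the rest.\<close>

lemma finite_support_bounded_below:
  fixes f :: "int ell2 \<Rightarrow> 'b::real_normed_vector"
  assumes "finite F" "bounded_linear f"
    and inj: "\<And>x. (\<And>k. k \<notin> F \<Longrightarrow> coord x k = 0) \<Longrightarrow> f x = 0 \<Longrightarrow> x = 0"
  obtains c where "c > 0" "\<And>x. (\<And>k. k \<notin> F \<Longrightarrow> coord x k = 0) \<Longrightarrow> norm (f x) \<ge> c * norm x"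
proof -
  interpret f: bounded_linear f by fact
  define S where "S = {x :: int ell2. (\<forall>k\<in>F. cmod (coord x k) \<le> 1) \<and> (\<forall>k. k \<notin> F \<longrightarrow> coord x k = 0)} \<inter> sphere 0 1"
  have S: "compact S" unfolding S_def
    by (intro compact_Int_closed compact_finite_support assms)
      (simp add: sphere_def closed_Collect_eq continuous_on_norm_id dist_norm)
  have scale: "\<exists>c>0. \<forall>x. (\<forall>k. k \<notin> F \<longrightarrow> coord x k = 0) \<longrightarrow> norm (f x) \<ge> c * norm x"
    if "c > 0" and c: "\<And>x. x \<in> S \<Longrightarrow> norm (f x) \<ge> c" for c
  proof (intro exI[of _ c] conjI allI impI)
    fix x assume x: "\<forall>k. k \<notin> F \<longrightarrow> coord x k = 0"
    show "c * norm x \<le> norm (f x)"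
    proof (cases "x = 0")
      case False
      define u where "u = (1 / norm x) *\<^sub>R x"
      have "norm u = 1" using False by (simp add: u_def)
      then have "u \<in> S" using x norm_coord_le[of u] by (auto simp: S_def u_def)
      from c[OF this] have "c \<le> norm (f x) / norm x" by (simp add: u_def f.scaleR)
      with False show ?thesis by (simp add: field_simps)
    qed simp
  qed fact
  have "\<exists>c>0. \<forall>x. (\<forall>k. k \<notin> F \<longrightarrow> coord x k = 0) \<longrightarrow> norm (f x) \<ge> c * norm x"
  \<comment> \<open>An empty \<open>S\<close> means that only \<open>x = 0\<close> has the required
    support, and then any constant works.\<close>
  proof (cases "S = {}")
    case True
    then show ?thesis using scale[of 1] by simp
  next
    case False
    have "continuous_on S (\<lambda>x. norm (f x))" by (intro continuous_intros f.continuous_on continuous_on_id)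
    then obtain z where z: "z \<in> S" "\<And>x. x \<in> S \<Longrightarrow> norm (f z) \<le> norm (f x)"
      using continuous_attains_inf[OF S False] by blast
    have "z \<noteq> 0" using z(1) by (auto simp: S_def)
    then have "norm (f z) > 0" using inj[of z] z(1) by (auto simp: S_def)
    then show ?thesis using scale z(2) by blast
  qed
  then show thesis using that by blast
qed

lemma coord_kop_finite_support:
  assumes "kernel h m" "finite F" "\<And>k. k \<notin> F \<Longrightarrow> coord x k = 0"
  shows "coord (kop m x) k = (\<Sum>j\<in>F. m k j * coord x j)"
proof -
  have "coord (kop m x) k = (\<Sum>\<^sub>\<infinity>j\<in>F. m k j * coord x j)"
    unfolding coord_kop[OF assms(1)] by (rule infsum_cong_neutral) (use assms in auto)
  with assms(2) show ?thesis by simp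
qed

context control
begin

text \<open>If \<open>G Y = 0\<close>, then \<open>Y\<close> equals \<open>\<kappa>\<close> on the
  interval, where \<open>g\<close> is nonzero. Subtracting \<open>\<kappa>\<close> from the zeroth
  coefficient gives a polynomial for \<open>trig_poly_eq_0\<close>; what remains is the zero mode,
  excluded by hypothesis.\<close>

lemma gker_injective:
  assumes "a < b" and pos: "\<And>x. x \<in> {a<..<b} \<Longrightarrow> g x \<noteq> 0"
    and supp: "\<And>k. k \<notin> {- int N..int N} \<Longrightarrow> coord x k = 0" and "coord x 0 = 0"
    and zero: "kop gker x = 0"
  shows "x = 0"
proof -
  obtain C where C: "kernel (\<lambda>d. C * inv_sq d) gker"
    using rapid_kernel[OF rapid_gker] by metis
  define F where "F = {- int N..int N}"
  define Y where "Y = (\<lambda>x'. \<Sum>j\<in>F. coord x j * trig j x')"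
  define \<kappa> where "\<kappa> = (\<Sum>j\<in>F. coord x j * (2 * of_real pi * hat gc (- j)))"
  have F: "finite F" by (simp add: F_def)
  have tp: "hat (\<lambda>x. gc x * (Y x - \<kappa>)) k = (\<Sum>j\<in>F. gker k j * coord x j)"
    "(\<lambda>x. gc x * (Y x - \<kappa>)) \<in> \<P>" for k
    unfolding Y_def \<kappa>_def by (rule gker_trig_poly[OF F])+
  have "hat (\<lambda>x. gc x * (Y x - \<kappa>)) k = hat (\<lambda>_. 0) k" for k
    using coord_kop_finite_support[OF C F, of x k] supp zero
    unfolding tp(1) by (simp add: F_def hat_const)
  then have "(\<lambda>x. gc x * (Y x - \<kappa>)) = (\<lambda>_. 0)"
    by (rule test_eqI[OF tp(2) test_const])
  then have Y: "Y t = \<kappa>" if "t \<in> {a<..<b}" for t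
    using pos[OF that] by (auto simp: gc_def dest: fun_cong[of _ _ t])
  have z: "coord x j - (if j = 0 then \<kappa> else 0) = 0" if "j \<in> F" for j
  proof (rule trig_poly_eq_0[OF \<open>a < b\<close>, where N = N and y = "\<lambda>j. coord x j - (if j = 0 then \<kappa> else 0)" and j = j])
    fix t assume t: "t \<in> {a<..<b}"
    have "(\<Sum>j\<in>F. (coord x j - (if j = 0 then \<kappa> else 0)) * trig j t)
        = Y t - (\<Sum>j\<in>F. if j = 0 then \<kappa> else 0)"
      unfolding Y_def sum_subtractf[symmetric] by (intro sum.cong) (auto simp: left_diff_distrib)
    also have "(\<Sum>j\<in>F. if j = 0 then \<kappa> else 0) = \<kappa>"
      by (subst sum.delta[OF F]) (simp add: F_def)
    finally show "(\<Sum>j = - int N..int N. (coord x j - (if j = 0 then \<kappa> else 0)) * trig j t) = 0"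
      using Y[OF t] by (simp add: F_def)
  qed (use that in \<open>simp add: F_def\<close>)
  show "x = 0"
  proof (rule ell2_eqI)
    fix k
    show "coord x k = coord 0 k"
      using z[of k] supp[of k] \<open>coord x 0 = 0\<close> by (cases "k \<in> F"; cases "k = 0") (auto simp: F_def)
  qed
qed

text \<open>On the modes \<open>k\<close> and \<open>- k\<close> the matrix is the average
  \<open>1 / (2 * pi)\<close> of \<open>g\<close> times the identity, up to entries of size
  \<open>O (1 / \<bar>k\<bar>)\<close>; diagonal dominance gives the bound.\<close>

lemma gker_large_modes:
  obtains K :: nat and c where "c > 0"
    "\<And>k x. \<bar>k\<bar> \<ge> int K \<Longrightarrow> k \<noteq> 0 \<Longrightarrow> (\<And>j. j \<notin> {k, - k} \<Longrightarrow> coord x j = 0) \<Longrightarrow> c * norm x \<le> norm (kop gker x)"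
proof -
  obtain Ck where Ck: "kernel (\<lambda>d. Ck * inv_sq d) gker"
    using rapid_kernel[OF rapid_gker] by metis
  obtain C where C: "C \<ge> 0" "\<And>k. cmod (hat gc k) * (1 + \<bar>real_of_int k\<bar>) ^ 1 \<le> C"
    using hat_rapid[OF gc] by blast
  define \<delta> where "\<delta> = 1 / (2 * pi)"
  have \<delta>: "\<delta> > 0" by (simp add: \<delta>_def)
  \<comment> \<open>\<open>D / b\<close> bounds the error terms: \<open>hat gc (2 * k)\<close> and
    products of two coefficients, of which one supplies the decay. \<open>K\<close> brings this
    below \<open>\<delta> / 4\<close>.\<close>
  define D where "D = C + 2 * pi * (C * C)"
  define K where "K = nat \<lceil>4 * D / \<delta>\<rceil>"
  have small: "cmod (gker k k - of_real \<delta>) \<le> \<delta> / 4" "cmod (gker k (- k)) \<le> \<delta> / 4" if k: "\<bar>k\<bar> \<ge> int K" for k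
  proof -
    define b where "b = 1 + \<bar>real_of_int k\<bar>"
    have b: "b \<ge> 1" by (simp add: b_def)
    have "4 * D / \<delta> \<le> real K" by (simp add: K_def of_nat_nat real_nat_ceiling_ge)
    also have "\<dots> \<le> b" using k by (simp add: b_def)
    finally have Db: "D / b \<le> \<delta> / 4" using b \<delta> by (simp add: field_simps)
    have h: "cmod (hat gc k) \<le> C / b" "cmod (hat gc (- k)) \<le> C / b"
      using C(2)[of k] C(2)[of "- k"] b by (simp_all add: field_simps b_def[symmetric])
    have hh: "2 * pi * (cmod (hat gc k) * cmod (hat gc j)) \<le> 2 * pi * (C * C) / b" if "j = k \<or> j = - k" for j
    proof -
      have "cmod (hat gc k) * cmod (hat gc j) \<le> (C / b) * (C / 1)"
      proof (rule mult_mono)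
        have "cmod (hat gc j) * 1 \<le> cmod (hat gc j) * (1 + \<bar>real_of_int j\<bar>) ^ 1"
          by (intro mult_left_mono) auto
        also have "\<dots> \<le> C" by (rule C)
        finally show "cmod (hat gc j) \<le> C / 1" by simp
      qed (use h C(1) b in auto)
      then have "2 * pi * (cmod (hat gc k) * cmod (hat gc j)) \<le> 2 * pi * ((C / b) * (C / 1))"
        by (intro mult_left_mono) auto
      then show ?thesis by simp
    qed
    have "cmod (gker k k - of_real \<delta>) = 2 * pi * (cmod (hat gc k) * cmod (hat gc (- k)))"
      by (simp add: gker_def hat_gc_0 \<delta>_def norm_mult)
    also have "\<dots> \<le> 2 * pi * (C * C) / b" by (rule hh) simp
    also have "\<dots> \<le> D / b" using C(1) b by (intro divide_right_mono) (auto simp: D_def)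
    finally show "cmod (gker k k - of_real \<delta>) \<le> \<delta> / 4" using Db by (rule order_trans)
    have "cmod (hat gc (2 * k)) * b \<le> cmod (hat gc (2 * k)) * (1 + \<bar>real_of_int (2 * k)\<bar>) ^ 1"
      by (intro mult_left_mono) (auto simp: b_def)
    also have "\<dots> \<le> C" by (rule C)
    finally have h2: "cmod (hat gc (2 * k)) \<le> C / b" using b by (simp add: field_simps)
    have "cmod (gker k (- k)) \<le> cmod (hat gc (2 * k)) + 2 * pi * (cmod (hat gc k) * cmod (hat gc k))"
      unfolding gker_def by (rule order_trans[OF norm_triangle_ineq4]) (simp add: norm_mult)
    also have "\<dots> \<le> C / b + 2 * pi * (C * C) / b" by (intro add_mono h2 hh) simp
    also have "\<dots> = D / b" by (simp add: D_def add_divide_distrib)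
    finally show "cmod (gker k (- k)) \<le> \<delta> / 4" using Db by (rule order_trans)
  qed
  show thesis
  proof (rule that[of "\<delta> / 4" K])
    show "\<delta> / 4 > 0" using \<delta> by simp
    fix k and x :: "int ell2"
    assume k: "\<bar>k\<bar> \<ge> int K" "k \<noteq> 0" and supp: "\<And>j. j \<notin> {k, - k} \<Longrightarrow> coord x j = 0"
    define A where "A = cmod (coord x k)"
    define B where "B = cmod (coord x (- k))"
    have main: "cmod (coord (kop gker x) i) \<ge> 3 / 4 * \<delta> * cmod (coord x i) - \<delta> / 4 * cmod (coord x (- i))"
      if "i \<in> {k, - k}" for i
    proof -
      have i: "\<bar>i\<bar> \<ge> int K" "i \<noteq> - i" using k that by auto
      have "coord (kop gker x) i = (\<Sum>j\<in>{i, - i}. gker i j * coord x j)"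
        by (rule coord_kop_finite_support[OF Ck]) (use that supp in auto)
      also have "\<dots> = of_real \<delta> * coord x i + (gker i i - of_real \<delta>) * coord x i + gker i (- i) * coord x (- i)"
        using i by (simp add: algebra_simps)
      finally have e: "of_real \<delta> * coord x i
          = coord (kop gker x) i - (gker i i - of_real \<delta>) * coord x i - gker i (- i) * coord x (- i)" by simp
      have "\<delta> * cmod (coord x i) = cmod (of_real \<delta> * coord x i)" using \<delta> by (simp add: norm_mult)
      also have "\<dots> \<le> cmod (coord (kop gker x) i) + cmod (gker i i - of_real \<delta>) * cmod (coord x i)
          + cmod (gker i (- i)) * cmod (coord x (- i))"
        unfolding e by (intro order_trans[OF norm_triangle_ineq4] add_mono) (auto simp: norm_mult)
      also have "\<dots> \<le> cmod (coord (kop gker x) i) + \<delta> / 4 * cmod (coord x i) + \<delta> / 4 * cmod (coord x (- i))"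
        by (intro add_mono mult_right_mono small[OF i(1)]) auto
      finally show ?thesis by (simp add: algebra_simps)
    qed
    have "3 / 4 * \<delta> * A - \<delta> / 4 * B \<le> norm (kop gker x)" "3 / 4 * \<delta> * B - \<delta> / 4 * A \<le> norm (kop gker x)"
      using main[of k] main[of "- k"] norm_coord_le[of "kop gker x"] order_trans by (fastforce simp: A_def B_def)+
    \<comment> \<open>The sum of the two inequalities, with the diagonal excess
      \<open>3 / 4 - 1 / 4\<close>.\<close>
    then have "\<delta> / 2 * A + \<delta> / 2 * B \<le> 2 * norm (kop gker x)" by linarith
    moreover have "norm x \<le> A + B"
    proof -
      have "x = single k (coord x k) + single (- k) (coord x (- k))"
        using supp k by (intro ell2_eqI) auto
      then have "norm x = norm (single k (coord x k) + single (- k) (coord x (- k)))" by simp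
      also have "\<dots> \<le> A + B" unfolding A_def B_def by (rule order_trans[OF norm_triangle_ineq]) simp
      finally show ?thesis .
    qed
    ultimately show "\<delta> / 4 * norm x \<le> norm (kop gker x)"
      using mult_left_mono[of "norm x" "A + B" "\<delta> / 4"] \<delta> by (simp add: algebra_simps)
  qed
qed

end

section \<open>Consequences of the spectral conditions\<close>

lemma gap_le:
  assumes "index_set a J" "gap a J > 0"
  obtains \<gamma> where "\<gamma> > 0" "\<And>k j. eig a k = eig a j \<or> \<bar>eig a k - eig a j\<bar> \<ge> \<gamma>"
proof -
  \<comment> \<open>The gap may be infinite, so a real \<open>\<gamma>\<close> is taken strictly
    below it; arbitrary indices are then replaced by the representatives of their classes in
    \<open>J\<close>.\<close>
  obtain e where e: "0 < e" "e < gap a J" using assms(2) dense by blast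
  then obtain \<gamma> where \<gamma>: "e = ereal \<gamma>" "\<gamma> > 0" by (cases e) auto
  have "eig a k = eig a j \<or> \<bar>eig a k - eig a j\<bar> \<ge> \<gamma>" for k j
  proof -
    have rep: "\<exists>k'. k' \<in> J \<and> eig a k' = eig a k" for k
    proof -
      have "\<exists>!j. j \<in> J \<and> j \<in> eig_class a k" using assms(1) by (simp add: index_set_def)
      then obtain j where "j \<in> J" "j \<in> eig_class a k" by blast
      then show ?thesis by (auto simp: eig_class_def)
    qed
    obtain k' where k': "k' \<in> J" "eig a k' = eig a k" using rep[of k] by blast
    obtain j' where j': "j' \<in> J" "eig a j' = eig a j" using rep[of j] by blast
    show ?thesis
    proof (cases "k' = j'")
      case False
      have "gap a J \<le> ereal \<bar>eig a k' - eig a j'\<bar>"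
        unfolding gap_def by (rule INF_lower2[of "(k', j')"]) (use k' j' False in auto)
      from less_le_trans[OF e(2) this] show ?thesis using k' j' by (simp add: \<gamma>(1))
    qed (use k' j' in simp)
  qed
  with \<gamma>(2) that show thesis by blast
qed

text \<open>The common core of both conditions. Under (I) a high-frequency class is a singleton;
  under (II) oddness of \<open>a\<close> puts \<open>- k\<close> into the class of \<open>k\<close>,
  and multiplicity two leaves room for nothing else.\<close>

lemma spectral_structure:
  assumes "condition_I a \<or> condition_II a"
  obtains \<gamma> K where "\<gamma> > 0" "\<And>k j. eig a k = eig a j \<or> \<bar>eig a k - eig a j\<bar> \<ge> \<gamma>"
    "\<And>k. finite (eig_class a k)" "\<And>k. \<bar>k\<bar> \<ge> int K \<Longrightarrow> eig_class a k \<subseteq> {k, - k}"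
proof -
  have self: "k \<in> eig_class a k" for k by (simp add: eig_class_def)
  have fin: "finite (eig_class a k)" if "mult a k \<le> enat n" for k n
    using that by (auto simp: mult_def split: if_splits)
  from assms show thesis
  proof
    assume I: "condition_I a"
    then obtain n0 K J where n0: "\<And>k. mult a k \<le> enat n0" and K: "\<And>k. \<bar>k\<bar> \<ge> int K \<Longrightarrow> mult a k = 1"
      and J: "index_set a J" "gap a J > 0"
      unfolding condition_I_def by blast
    have "eig_class a k \<subseteq> {k, - k}" if "\<bar>k\<bar> \<ge> int K" for k
    proof -
      have "card (eig_class a k) = 1"
        using K[OF that] by (auto simp: mult_def one_enat_def split: if_splits)
      then obtain x where "eig_class a k = {x}" by (auto simp: card_1_singleton_iff)
      with self[of k] show ?thesis by auto
    qed
    with gap_le[OF J] fin[OF n0] that show thesis by metis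
  next
    assume II: "condition_II a"
    then obtain n0 K J where n0: "\<And>k. \<bar>k\<bar> < int K \<Longrightarrow> mult a k \<le> enat n0"
      and K: "\<And>k. \<bar>k\<bar> \<ge> int K \<Longrightarrow> mult a k = 2"
      and odd: "\<And>k. \<bar>k\<bar> \<ge> int K \<Longrightarrow> a (- k) = - a k"
      and J: "index_set a J" "gap a J > 0"
      unfolding condition_II_def by blast
    have two: "finite (eig_class a k) \<and> card (eig_class a k) = 2" if "\<bar>k\<bar> \<ge> int K" for k
      using K[OF that] by (auto simp: mult_def numeral_eq_enat split: if_splits)
    have f: "finite (eig_class a k)" for k
      using two[of k] fin[OF n0[of k]] by (cases "\<bar>k\<bar> \<ge> int K") auto
    \<comment> \<open>The maximum with 1 excludes \<open>k = 0\<close>, for which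
      \<open>{k, - k}\<close> has only one element.\<close>
    have "eig_class a k \<subseteq> {k, - k}" if k: "\<bar>k\<bar> \<ge> int (max 1 K)" for k
    proof -
      have "{k, - k} \<subseteq> eig_class a k" using odd[of k] k by (auto simp: eig_class_def eig_def)
      moreover have "card {k, - k} = 2" using k by (auto simp: card_2_iff)
      ultimately have "{k, - k} = eig_class a k"
        using two[of k] k by (intro card_subset_eq) auto
      then show ?thesis by simp
    qed
    with gap_le[OF J] f that show thesis by metis
  qed
qed

context control
begin

text \<open>One constant must serve infinitely many eigenspaces: all classes that meet the low
  frequencies are placed in a single finite-dimensional space, and the others fall under
  \<open>gker_large_modes\<close>.\<close>

lemma eigenspace_observability:
  assumes "a' < b'" and pos: "\<And>x. x \<in> {a'<..<b'} \<Longrightarrow> g x \<noteq> 0"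
    and fin: "\<And>k. finite (eig_class a k)" and K: "\<And>k. \<bar>k\<bar> \<ge> int K \<Longrightarrow> eig_class a k \<subseteq> {k, - k}"
  obtains c where "c > 0"
    "\<And>k x. (\<And>j. j \<notin> eig_class a k \<Longrightarrow> coord x j = 0) \<Longrightarrow> coord x 0 = 0 \<Longrightarrow> c * norm x \<le> norm (kop gker x)"
proof -
  obtain C where C: "kernel (\<lambda>d. C * inv_sq d) gker"
    using rapid_kernel[OF rapid_gker] by metis
  obtain K1 :: nat and c1 where c1: "c1 > 0"
    "\<And>k x. \<bar>k\<bar> \<ge> int K1 \<Longrightarrow> k \<noteq> 0 \<Longrightarrow> (\<And>j. j \<notin> {k, - k} \<Longrightarrow> coord x j = 0) \<Longrightarrow> c1 * norm x \<le> norm (kop gker x)"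
    using gker_large_modes by metis
  define L where "L = max K K1"
  \<comment> \<open>Whole classes are collected, as the class of a low frequency may also contain
    higher ones; their union is finite and lies in some \<open>{- N..N}\<close>.\<close>
  define S where "S = (\<Union>k\<in>{- int L..int L}. eig_class a k)"
  have "finite S" using fin by (simp add: S_def)
  then obtain n where n: "\<And>k. k \<in> S \<Longrightarrow> \<bar>k\<bar> \<le> n" by (metis finite_imageI Max_ge imageI)
  define N where "N = nat n"
  obtain c2 where c2: "c2 > 0"
    "\<And>x. (\<And>k. k \<notin> {- int N..int N} - {0} \<Longrightarrow> coord x k = 0) \<Longrightarrow> norm (kop gker x) \<ge> c2 * norm x"
  proof (rule finite_support_bounded_below[of "{- int N..int N} - {0}" "kop gker"])
    show "bounded_linear (kop gker)" by (rule bounded_linear_kop[OF C])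
    show "x = 0" if "\<And>k. k \<notin> {- int N..int N} - {0} \<Longrightarrow> coord x k = 0" "kop gker x = 0" for x
      by (rule gker_injective[OF assms(1) pos, of N]) (use that in auto)
  qed auto
  show thesis
  proof (rule that[of "min c1 c2"])
    show "min c1 c2 > 0" using c1 c2 by simp
    fix k x assume supp: "\<And>j. j \<notin> eig_class a k \<Longrightarrow> coord x j = 0" and x0: "coord x 0 = 0"
    have "c1 * norm x \<le> norm (kop gker x) \<or> c2 * norm x \<le> norm (kop gker x)"
    proof (cases "\<exists>j\<in>eig_class a k. \<bar>j\<bar> \<le> int L")
      case True
      then obtain j where j: "j \<in> eig_class a k" "\<bar>j\<bar> \<le> int L" by blast
      then have "eig_class a k = eig_class a j" by (auto simp: eig_class_def)
      moreover have "j \<in> {- int L..int L}" using j by auto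
      ultimately have "eig_class a k \<subseteq> S" unfolding S_def by blast
      then have "c2 * norm x \<le> norm (kop gker x)"
      proof (intro c2(2))
        fix i assume i: "i \<notin> {- int N..int N} - {0}"
        show "coord x i = 0"
        proof (cases "i = 0")
          case False
          with i have "\<bar>i\<bar> > int N" by auto
          then have "\<not> \<bar>i\<bar> \<le> n" unfolding N_def by linarith
          then have "i \<notin> S" using n by blast
          with \<open>eig_class a k \<subseteq> S\<close> show ?thesis using supp by blast
        qed (use x0 in simp)
      qed
      then show ?thesis ..
    next
      case False
      have "k \<in> eig_class a k" by (simp add: eig_class_def)
      with False have k: "\<bar>k\<bar> > int L" by auto
      then have "eig_class a k \<subseteq> {k, - k}" by (intro K) (auto simp: L_def)
      then have "c1 * norm x \<le> norm (kop gker x)"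
        using k supp by (intro c1(2)[of k]) (auto simp: L_def)
      then show ?thesis ..
    qed
    moreover have "min c1 c2 * norm x \<le> c1 * norm x" "min c1 c2 * norm x \<le> c2 * norm x"
      by (intro mult_right_mono; simp)+
    ultimately show "min c1 c2 * norm x \<le> norm (kop gker x)" by linarith
  qed
qed

text \<open>Makes the unweighted operators the case \<open>R = 1\<close>, \<open>s = 0\<close> of
  the weighted statements.\<close>

lemma conj_weight_trivial: "conj_weight 1 0 m = m"
  by (intro ext) (simp add: conj_weight_def weight_def add_nonneg_eq_0_iff)

text \<open>The blocks decouple: for a truncation the form is the sum of
  \<open>(norm (kop gker (P \<mu>)))\<^sup>2\<close> over the eigenspace components, whose lower
  bounds add up by orthogonality. Continuity removes the truncation.\<close>

lemma block_diagonal_coercive: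
  fixes a :: "int \<Rightarrow> real"
  assumes c: "c > 0"
    "\<And>k x. (\<And>j. j \<notin> eig_class a k \<Longrightarrow> coord x j = 0) \<Longrightarrow> coord x 0 = 0 \<Longrightarrow> c * norm x \<le> norm (kop gker x)"
    and x0: "coord x 0 = 0"
  shows "inner (kop (\<lambda>k j. if eig a k = eig a j then gker2 k j else 0) x) x \<ge> c\<^sup>2 * (norm x)\<^sup>2"
proof -
  obtain C where G: "kernel (\<lambda>d. C * inv_sq d) gker"
    using rapid_kernel[OF rapid_gker] by metis
  obtain C' where B: "kernel (\<lambda>d. C' * inv_sq d) gker2"
    using rapid_kernel[OF rapid_gker2] by metis
  define d where "d = (\<lambda>k j. if eig a k = eig a j then gker2 k j else 0)"
  have D: "kernel (\<lambda>d. C' * inv_sq d) d"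
    using B kernel_bound_nonneg[OF B] by (auto simp: kernel_def d_def)
  have b_inner: "inner (kop gker2 y) y = (norm (kop gker y))\<^sup>2" for y
    using kop_gker2[of 1 0 y]
    by (simp add: conj_weight_trivial kop_selfadjoint[OF G gker_hermitian] power2_norm_eq_inner)
  have fin: "inner (kop d (trunc F x)) (trunc F x) \<ge> c\<^sup>2 * (norm (trunc F x))\<^sup>2" if F: "finite F" for F
  proof -
    define lam where "lam = eig a"
    define y where "y = coord x"
    define Fm where "Fm \<mu> = {k \<in> F. lam k = \<mu>}" for \<mu>
    define P where "P \<mu> = (\<Sum>k\<in>Fm \<mu>. single k (y k))" for \<mu>
    have Fm: "finite (Fm \<mu>)" for \<mu> using F by (simp add: Fm_def)
    have coP: "coord (P \<mu>) k = (if k \<in> Fm \<mu> then y k else 0)" for \<mu> k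
      using Fm by (simp add: P_def)
    have nP: "(norm (P \<mu>))\<^sup>2 = (\<Sum>k\<in>Fm \<mu>. (cmod (y k))\<^sup>2)" for \<mu>
      by (subst norm_ell2_finite_support[OF Fm[of \<mu>]]) (auto simp: coP)
    have tr: "trunc F x = (\<Sum>k\<in>F. single k (y k))" by (simp add: trunc_def y_def)
    have "inner (kop d (trunc F x)) (trunc F x) = (\<Sum>k\<in>F. \<Sum>j\<in>F. inner (d k j * y j) (y k))"
      unfolding tr by (rule inner_kop_sum_single[OF D F])
    also have "\<dots> = (\<Sum>\<mu>\<in>lam ` F. \<Sum>k\<in>Fm \<mu>. \<Sum>j\<in>F. inner (d k j * y j) (y k))"
      unfolding Fm_def by (rule sum.image_gen[OF F])
    also have "\<dots> = (\<Sum>\<mu>\<in>lam ` F. \<Sum>k\<in>Fm \<mu>. \<Sum>j\<in>Fm \<mu>. inner (gker2 k j * y j) (y k))"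
    proof (rule sum.cong[OF refl], rule sum.cong[OF refl])
      fix \<mu> k assume k: "k \<in> Fm \<mu>"
      have "(\<Sum>j\<in>F. inner (d k j * y j) (y k)) = (\<Sum>j\<in>Fm \<mu>. inner (d k j * y j) (y k))"
        by (rule sum.mono_neutral_right[OF F]) (use k in \<open>auto simp: Fm_def d_def lam_def\<close>)
      also have "\<dots> = (\<Sum>j\<in>Fm \<mu>. inner (gker2 k j * y j) (y k))"
        by (rule sum.cong) (use k in \<open>auto simp: Fm_def d_def lam_def\<close>)
      finally show "(\<Sum>j\<in>F. inner (d k j * y j) (y k)) = (\<Sum>j\<in>Fm \<mu>. inner (gker2 k j * y j) (y k))" .
    qed
    also have "\<dots> = (\<Sum>\<mu>\<in>lam ` F. (norm (kop gker (P \<mu>)))\<^sup>2)"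
      unfolding P_def b_inner[symmetric] inner_kop_sum_single[OF B Fm] ..
    finally have 1: "inner (kop d (trunc F x)) (trunc F x) = (\<Sum>\<mu>\<in>lam ` F. (norm (kop gker (P \<mu>)))\<^sup>2)" .
    have 2: "(\<Sum>\<mu>\<in>lam ` F. c\<^sup>2 * (norm (P \<mu>))\<^sup>2) \<le> (\<Sum>\<mu>\<in>lam ` F. (norm (kop gker (P \<mu>)))\<^sup>2)"
    proof (rule sum_mono)
      fix \<mu> assume "\<mu> \<in> lam ` F"
      then obtain k where k: "\<mu> = lam k" by blast
      have "c * norm (P \<mu>) \<le> norm (kop gker (P \<mu>))"
        by (rule c(2)[of k]) (use x0 in \<open>auto simp: coP k Fm_def eig_class_def lam_def y_def\<close>)
      then have "(c * norm (P \<mu>))\<^sup>2 \<le> (norm (kop gker (P \<mu>)))\<^sup>2"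
        using c(1) by (intro power_mono) auto
      then show "c\<^sup>2 * (norm (P \<mu>))\<^sup>2 \<le> (norm (kop gker (P \<mu>)))\<^sup>2" by (simp add: power_mult_distrib)
    qed
    have "(\<Sum>\<mu>\<in>lam ` F. c\<^sup>2 * (norm (P \<mu>))\<^sup>2) = c\<^sup>2 * (\<Sum>\<mu>\<in>lam ` F. \<Sum>k\<in>Fm \<mu>. (cmod (y k))\<^sup>2)"
      by (simp add: nP sum_distrib_left)
    also have "(\<Sum>\<mu>\<in>lam ` F. \<Sum>k\<in>Fm \<mu>. (cmod (y k))\<^sup>2) = (\<Sum>k\<in>F. (cmod (y k))\<^sup>2)"
      unfolding Fm_def by (rule sum.image_gen[OF F, symmetric])
    also have "\<dots> = (norm (trunc F x))\<^sup>2"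
      by (subst norm_ell2_finite_support[OF F]) (auto simp: F y_def)
    finally show ?thesis using 1 2 by simp
  qed
  have "(\<lambda>n. c\<^sup>2 * (norm (trunc {- int n..int n} x))\<^sup>2) \<longlonglongrightarrow> c\<^sup>2 * (norm x)\<^sup>2"
    by (intro tendsto_intros tendsto_trunc)
  moreover have "(\<lambda>n. inner (kop d (trunc {- int n..int n} x)) (trunc {- int n..int n} x)) \<longlonglongrightarrow> inner (kop d x) x"
    by (intro tendsto_inner bounded_linear.tendsto[OF bounded_linear_kop[OF D]] tendsto_trunc)
  ultimately have "c\<^sup>2 * (norm x)\<^sup>2 \<le> inner (kop d x) x"
    by (rule LIMSEQ_le) (use fin in auto)
  then show ?thesis by (simp add: d_def)
qed

end

section \<open>The closed-loop system in Fourier modes\<close>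

lemma mode_solution_diff:
  assumes "mode_solution lam T x" "mode_solution lam T y" "bounded_linear T"
  shows "mode_solution lam T (\<lambda>t. x t - y t)"
  unfolding mode_solution_def
proof (intro conjI allI impI)
  show "continuous_on {0..} (\<lambda>t. x t - y t)"
    using assms by (auto simp: mode_solution_def intro: continuous_on_diff)
  fix t :: real and k assume "t > 0"
  then have "((\<lambda>t. coord (x t) k - coord (y t) k) has_vector_derivative
      (\<i> * of_real (lam k) * coord (x t) k - coord (T (x t)) k)
       - (\<i> * of_real (lam k) * coord (y t) k - coord (T (y t)) k)) (at t)"
    using assms by (intro has_vector_derivative_diff) (auto simp: mode_solution_def)
  then show "((\<lambda>t. coord (x t - y t) k) has_vector_derivative
      \<i> * of_real (lam k) * coord (x t - y t) k - coord (T (x t - y t)) k) (at t)"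
    by (simp add: linear_diff[OF bounded_linear.linear[OF assms(3)]] algebra_simps)
qed

lemma mode_solution_const:
  assumes "lam 0 = 0" "T (single 0 c) = 0"
  shows "mode_solution lam T (\<lambda>_. single 0 c)"
  using assms by (auto simp: mode_solution_def)

text \<open>The zero mode has frequency 0 and receives no feedback. Solutions thus stay in the
  mean-zero space on which the Lyapunov estimate holds.\<close>

lemma mode_solution_conserved:
  assumes "mode_solution lam T x" "lam 0 = 0" "\<And>y. coord (T y) 0 = 0" "t \<ge> 0"
  shows "coord (x t) 0 = coord (x 0) 0"
proof -
  have "((\<lambda>_. 0) has_integral coord (x t) 0 - coord (x 0) 0) {0..t}"
  proof (rule fundamental_theorem_of_calculus_interior[OF assms(4)])
    show "continuous_on {0..t} (\<lambda>t. coord (x t) 0)"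
      using assms(1) by (auto simp: mode_solution_def intro: continuous_on_coord continuous_on_subset)
    show "((\<lambda>t. coord (x t) 0) has_vector_derivative 0) (at \<tau>)" if "\<tau> \<in> {0<..<t}" for \<tau>
    proof -
      have "((\<lambda>t. coord (x t) 0) has_vector_derivative
          (\<i> * of_real (lam 0) * coord (x \<tau>) 0 - coord (T (x \<tau>)) 0)) (at \<tau>)"
        using assms(1) that by (simp add: mode_solution_def)
      then show ?thesis by (simp add: assms)
    qed
  qed
  from has_integral_unique[OF this has_integral_0] show ?thesis by simp
qed

lemma eig_growth:
  fixes a :: "int \<Rightarrow> real" and k0 :: nat
  assumes "r \<ge> 1" "C > 0" and growth: "\<And>k. \<bar>k\<bar> \<ge> int k0 \<Longrightarrow> \<bar>a k\<bar> \<le> C * \<bar>real_of_int k\<bar> powr (r - 1)"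
  obtains C' where "C' \<ge> 1" "\<And>k. \<bar>eig a k\<bar> * weight 1 (- r) k \<le> C'"
proof -
  \<comment> \<open>The growth hypothesis is silent below \<open>k0\<close>; these finitely many
    eigenvalues are bounded by the sum of their moduli.\<close>
  define M where "M = (\<Sum>k\<in>{- int k0..int k0}. \<bar>eig a k\<bar>)"
  have M: "M \<ge> 0" unfolding M_def by (intro sum_nonneg) auto
  show thesis
  proof (rule that[of "max 1 (C + M)"])
    fix k
    define b where "b = 1 + \<bar>real_of_int k\<bar>"
    have b: "b \<ge> 1" by (simp add: b_def)
    have w: "weight 1 (- r) k = b powr (- r)" by (simp add: weight_def b_def)
    have w1: "weight 1 (- r) k \<le> 1"
      unfolding w using powr_mono[of "- r" 0 b] b assms(1) by simp
    have w0: "weight 1 (- r) k \<ge> 0" by (simp add: weight_def)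
    have "\<bar>eig a k\<bar> * weight 1 (- r) k \<le> C + M"
    proof (cases "\<bar>k\<bar> \<ge> int k0")
      case True
      have "\<bar>eig a k\<bar> = \<bar>real_of_int k\<bar> * \<bar>a k\<bar>" by (simp add: eig_def abs_mult)
      also have "\<dots> \<le> b * (C * b powr (r - 1))"
      proof (intro mult_mono)
        show "\<bar>a k\<bar> \<le> C * b powr (r - 1)"
          by (rule order_trans[OF growth[OF True]])
            (use assms in \<open>auto simp: b_def intro!: mult_left_mono powr_mono2\<close>)
      qed (auto simp: b_def)
      also have "\<dots> = C * b powr r" using b by (simp add: powr_diff)
      finally have "\<bar>eig a k\<bar> * weight 1 (- r) k \<le> C * b powr r * b powr (- r)"
        unfolding w by (intro mult_right_mono) auto
      also have "\<dots> = C" using b by (simp add: powr_minus)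
      finally show ?thesis using M by simp
    next
      case False
      then have "\<bar>eig a k\<bar> \<le> M" unfolding M_def by (intro member_le_sum) auto
      then have "\<bar>eig a k\<bar> * weight 1 (- r) k \<le> M * 1" using w0 w1 M by (intro mult_mono) auto
      then show ?thesis using assms(2) by simp
    qed
    then show "\<bar>eig a k\<bar> * weight 1 (- r) k \<le> max 1 (C + M)" by simp
  qed simp
qed

context control
begin

text \<open>The operator \<open>G G\<^sup>*\<close> seen through the embedding
  \<open>emb R s\<close>.\<close>

abbreviation feedback :: "real \<Rightarrow> real \<Rightarrow> int ell2 \<Rightarrow> int ell2" where
  "feedback R s \<equiv> kop (conj_weight R s gker2)"

lemma feedback_kernel:
  assumes "R \<ge> 1"
  obtains C where "kernel (\<lambda>d. C * inv_sq d) (conj_weight R s gker2)"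
  using rapid_kernel[OF rapid_conj_weight[OF rapid_gker2 assms]] by metis

lemma bounded_linear_feedback:
  assumes "R \<ge> 1"
  shows "bounded_linear (feedback R s)"
  by (rule feedback_kernel[OF assms]) (rule bounded_linear_kop)

lemma gker2_0: "gker2 k 0 = 0" "gker2 0 j = 0"
  by (simp_all add: gker2_def gker_0)

lemma
  assumes "R \<ge> 1"
  shows feedback_const: "feedback R s (single 0 c) = 0"
    and feedback_mean: "coord (feedback R s y) 0 = 0"
proof -
  obtain C where C: "kernel (\<lambda>d. C * inv_sq d) (conj_weight R s gker2)"
    by (rule feedback_kernel[OF assms])
  show "feedback R s (single 0 c) = 0"
    by (rule ell2_eqI) (simp add: coord_kop_single[OF C] conj_weight_def gker2_0)
  show "coord (feedback R s y) 0 = 0"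
    unfolding coord_kop[OF C] by (simp add: conj_weight_def gker2_0)
qed

lemma feedback_decay:
  assumes "a' < b'" "\<And>x. x \<in> {a'<..<b'} \<Longrightarrow> g x \<noteq> 0" and spectral: "condition_I a \<or> condition_II a"
  obtains \<alpha> where "\<alpha> > 0"
    "\<And>s. \<exists>R\<ge>1. \<forall>x t. mode_solution (eig a) (feedback R s) x \<longrightarrow> coord (x 0) 0 = 0 \<longrightarrow> t \<ge> 0 \<longrightarrow>
       norm (x t) \<le> 2 * exp (- \<alpha> * t) * norm (x 0)"
proof -
  obtain \<gamma> K where \<gamma>: "\<gamma> > 0" "\<And>k j. eig a k = eig a j \<or> \<bar>eig a k - eig a j\<bar> \<ge> \<gamma>"
    and fin: "\<And>k. finite (eig_class a k)" and K: "\<And>k. \<bar>k\<bar> \<ge> int K \<Longrightarrow> eig_class a k \<subseteq> {k, - k}"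
    using spectral_structure[OF spectral] by metis
  obtain c where c: "c > 0"
    "\<And>k x. (\<And>j. j \<notin> eig_class a k \<Longrightarrow> coord x j = 0) \<Longrightarrow> coord x 0 = 0 \<Longrightarrow> c * norm x \<le> norm (kop gker x)"
    using eigenspace_observability[OF assms(1,2) fin K] by metis
  obtain C where G: "kernel (\<lambda>d. C * inv_sq d) gker"
    using rapid_kernel[OF rapid_gker] by metis
  obtain C' where B: "kernel (\<lambda>d. C' * inv_sq d) gker2"
    using rapid_kernel[OF rapid_gker2] by metis
  have BG: "kop gker2 x = kop gker (kop gker x)" for x
    using kop_gker2[of 1 0 x] by (simp add: conj_weight_trivial)
  obtain \<alpha> \<epsilon> where \<alpha>: "\<alpha> > 0" and \<epsilon>: "\<epsilon> > 0"
    and decay: "\<And>T x t. bounded_linear T \<Longrightarrow> (\<And>y. norm (T y - kop gker2 y) \<le> \<epsilon> * norm y) \<Longrightarrow>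
       mode_solution (eig a) T x \<Longrightarrow> (\<And>t. t \<ge> 0 \<Longrightarrow> coord (x t) 0 = 0) \<Longrightarrow> t \<ge> 0 \<Longrightarrow>
       norm (x t) \<le> 2 * exp (- \<alpha> * t) * norm (x 0)"
    by (rule lyapunov_decay[OF G B gker_hermitian BG \<gamma> zero_less_power[OF c(1), of 2]
          block_diagonal_coercive[OF c]]) blast+
  show thesis
  proof (rule that[OF \<alpha>])
    fix s :: real
    obtain D where D: "D \<ge> 0"
      "\<And>R. R \<ge> 1 \<Longrightarrow> kernel (\<lambda>d. D / R * inv_sq d) (\<lambda>k j. conj_weight R s gker2 k j - gker2 k j)"
      using conj_weight_close[OF rapid_gker2, of s] by metis
    define Z where "Z = infsum inv_sq UNIV"
    have Z: "Z \<ge> 0" unfolding Z_def by (rule infsum_nonneg) simp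
    \<comment> \<open>Weighted and unweighted feedback differ in operator norm by at most
      \<open>D * Z / R\<close>; this \<open>R\<close> brings the difference below the tolerance
      \<open>\<epsilon>\<close> of \<open>lyapunov_decay\<close>.\<close>
    define R where "R = max 1 (D * Z / \<epsilon>)"
    have R: "R \<ge> 1" by (simp add: R_def)
    have "D * Z / \<epsilon> \<le> R" by (simp add: R_def)
    then have DR: "D / R * Z \<le> \<epsilon>" using \<epsilon> R by (simp add: field_simps)
    note bl = bounded_linear_feedback[OF R, of s]
    obtain C'' where C'': "kernel (\<lambda>d. C'' * inv_sq d) (conj_weight R s gker2)"
      by (rule feedback_kernel[OF R])
    have "feedback R s y - kop gker2 y = kop (\<lambda>k j. conj_weight R s gker2 k j - gker2 k j) y" for y
      by (rule bounded_linear_eqI[OF bounded_linear_sub[OF bl bounded_linear_kop[OF B]] bounded_linear_kop[OF D(2)[OF R]]], rule ell2_eqI)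
        (simp add: coord_kop_single[OF C''] coord_kop_single[OF B] coord_kop_single[OF D(2)[OF R]] left_diff_distrib)
    then have close: "norm (feedback R s y - kop gker2 y) \<le> \<epsilon> * norm y" for y
      using order_trans[OF norm_kop_le[OF D(2)[OF R], of y, unfolded infsum_cmult_right' Z_def[symmetric]]
          mult_right_mono[OF DR norm_ge_zero[of y]]] by simp
    have "norm (x t) \<le> 2 * exp (- \<alpha> * t) * norm (x 0)"
      if sol: "mode_solution (eig a) (feedback R s) x" and "coord (x 0) 0 = 0" "t \<ge> 0" for x t
    proof (rule decay[OF bl close sol _ \<open>t \<ge> 0\<close>])
      show "coord (x t) 0 = 0" if "t \<ge> 0" for t
        using mode_solution_conserved[OF sol _ feedback_mean[OF R] that] \<open>coord (x 0) 0 = 0\<close>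
        by (simp add: eig_def)
    qed
    with R show "\<exists>R\<ge>1. \<forall>x t. mode_solution (eig a) (feedback R s) x \<longrightarrow> coord (x 0) 0 = 0 \<longrightarrow> t \<ge> 0 \<longrightarrow>
       norm (x t) \<le> 2 * exp (- \<alpha> * t) * norm (x 0)" by blast
  qed
qed

end

section \<open>Dictionary between the closed loop and its Fourier modes\<close>

locale closed_loop = control g for g +
  fixes A :: "pdist \<Rightarrow> pdist" and a :: "int \<Rightarrow> real" and r C :: real
  assumes multiplier: "linear_fourier_multiplier a A"
    and r_nonneg: "r \<ge> 0"
    and C_ge_1: "C \<ge> 1"
    and growth: "\<And>k. \<bar>eig a k\<bar> * weight 1 (- r) k \<le> C"
begin

lemma closed_loop_rhs_eq:
  "v \<in> \<P>' \<Longrightarrow> closed_loop_rhs A g v = dist_deriv (A v) - G_op g (G_op g v)"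
  by (simp add: closed_loop_rhs_def G_op_selfadjoint)

lemma closed_loop_rhs_pd: "v \<in> \<P>' \<Longrightarrow> closed_loop_rhs A g v \<in> \<P>'"
  using multiplier
  by (simp add: closed_loop_rhs_eq linear_fourier_multiplier_def pd_minus_closed pd_deriv_closed G_op_closed)

lemma fourier_coeff_closed_loop:
  assumes v: "v \<in> Hs s" and R: "R \<ge> 1"
  shows "of_real (weight R s k) * fourier_coeff (closed_loop_rhs A g v) k
    = \<i> * of_real (eig a k) * coord (emb R s v) k - coord (feedback R s (emb R s v)) k"
proof -
  have pd: "v \<in> \<P>'" by (rule Hs_pd[OF v])
  have A: "A v \<in> \<P>'" "fourier_coeff (A v) k = of_real (a k) * fourier_coeff v k"
    using multiplier pd by (auto simp: linear_fourier_multiplier_def)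
  have GG: "of_real (weight R s k) * fourier_coeff (G_op g (G_op g v)) k = coord (feedback R s (emb R s v)) k"
    by (simp add: kop_gker2[OF R] coord_emb[OF G_op_Hs[OF G_op_Hs[OF v]] R]
        emb_G_op[OF v R, symmetric] emb_G_op[OF G_op_Hs[OF v] R, symmetric])
  show ?thesis
    unfolding closed_loop_rhs_eq[OF pd] fourier_coeff_minus right_diff_distrib GG
    by (simp add: fourier_coeff_deriv[OF A(1)] A(2) coord_emb[OF v R] eig_def mult_ac)
qed

text \<open>Multiplication by \<open>loss\<close> passes from the coordinates for \<open>s\<close>
  to those for \<open>s - r\<close> and, by \<open>growth\<close>, turns the unbounded frequencies
  into a bounded symbol.\<close>

abbreviation loss :: "int \<Rightarrow> complex" where
  "loss k \<equiv> of_real (weight 1 (- r) k)"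

lemma loss_le: "cmod (loss k) \<le> C" "cmod (loss k * (\<i> * of_real (eig a k))) \<le> C"
proof -
  have "weight 1 (- r) k \<le> 1"
    using powr_mono[of "- r" 0 "1 + \<bar>real_of_int k\<bar>"] r_nonneg
    by (simp add: weight_def add_nonneg_eq_0_iff)
  moreover have "weight 1 (- r) k > 0" by (rule weight_pos) simp
  ultimately show "cmod (loss k) \<le> C" using C_ge_1 by simp
  show "cmod (loss k * (\<i> * of_real (eig a k))) \<le> C"
    using growth[of k] \<open>weight 1 (- r) k > 0\<close> by (simp add: norm_mult mult.commute)
qed

lemma weight_loss: "of_real (weight 1 (s - r) k) = loss k * of_real (weight 1 s k)"
  by (simp add: weight_def flip: of_real_mult powr_add)

lemma emb_lower: "v \<in> Hs s \<Longrightarrow> emb 1 (s - r) v = dop loss (emb 1 s v)"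
  by (rule emb_eqI)
    (simp_all add: Hs_pd coord_dop[of loss, OF loss_le(1)] coord_emb weight_loss mult.assoc)

lemma
  assumes v: "v \<in> Hs s"
  shows closed_loop_rhs_Hs: "closed_loop_rhs A g v \<in> Hs (s - r)"
    and emb_closed_loop_rhs: "emb 1 (s - r) (closed_loop_rhs A g v)
      = dop (\<lambda>k. loss k * (\<i> * of_real (eig a k))) (emb 1 s v) - dop loss (feedback 1 s (emb 1 s v))"
proof -
  have "coord (dop (\<lambda>k. loss k * (\<i> * of_real (eig a k))) (emb 1 s v) - dop loss (feedback 1 s (emb 1 s v))) k
      = of_real (weight 1 (s - r) k) * fourier_coeff (closed_loop_rhs A g v) k" for k
    unfolding weight_loss mult.assoc fourier_coeff_closed_loop[OF v order.refl] coord_simps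
      coord_dop[of loss, OF loss_le(1)] coord_dop[of "\<lambda>k. loss k * (\<i> * of_real (eig a k))", OF loss_le(2)]
    by (simp add: algebra_simps)
  from HsI[OF closed_loop_rhs_pd[OF Hs_pd[OF v]] this] emb_eqI[OF closed_loop_rhs_pd[OF Hs_pd[OF v]] this]
  show "closed_loop_rhs A g v \<in> Hs (s - r)" "emb 1 (s - r) (closed_loop_rhs A g v)
      = dop (\<lambda>k. loss k * (\<i> * of_real (eig a k))) (emb 1 s v) - dop loss (feedback 1 s (emb 1 s v))" .
qed

lemma
  assumes "u \<in> Hs s" "v \<in> Hs s"
  defines "q \<equiv> \<lambda>h. dist_scale (of_real (1 / h)) (u - v) - closed_loop_rhs A g v"
  shows quotient_Hs: "q h \<in> Hs (s - r)"
    and emb_quotient: "emb 1 (s - r) (q h) = (1 / h) *\<^sub>R (emb 1 (s - r) u - emb 1 (s - r) v)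
        - emb 1 (s - r) (closed_loop_rhs A g v)"
proof -
  have le: "s - r \<le> s" using r_nonneg by simp
  note lo = Hs_mono[OF assms(1) le] Hs_mono[OF assms(2) le]
  note d = Hs_minus[OF lo order.refl]
  note sc = Hs_scale[OF d, of "1 / h"]
  show "q h \<in> Hs (s - r)"
    unfolding q_def by (rule Hs_minus[OF sc closed_loop_rhs_Hs[OF assms(2)] order.refl])
  show "emb 1 (s - r) (q h) = (1 / h) *\<^sub>R (emb 1 (s - r) u - emb 1 (s - r) v)
        - emb 1 (s - r) (closed_loop_rhs A g v)"
    unfolding q_def emb_minus[OF sc closed_loop_rhs_Hs[OF assms(2)] order.refl] emb_scale[OF d]
      emb_minus[OF lo order.refl] ..
qed

text \<open>Outside \<open>Hs s\<close> the value of \<open>Hs_norm\<close> is a meaningless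
  default, so membership is required eventually along the filter.\<close>

lemma Hs_norm_tendsto_0_iff:
  assumes "\<forall>\<^sub>F x in F. f x \<in> Hs s"
  shows "((\<lambda>x. Hs_norm s (f x)) \<longlongrightarrow> 0) F \<longleftrightarrow> ((\<lambda>x. emb 1 s (f x)) \<longlongrightarrow> 0) F"
proof -
  have "((\<lambda>x. Hs_norm s (f x)) \<longlongrightarrow> 0) F \<longleftrightarrow> ((\<lambda>x. sqrt (2 * pi) * norm (emb 1 s (f x))) \<longlongrightarrow> 0) F"
    by (rule filterlim_cong) (use assms in \<open>auto elim!: eventually_mono simp: Hs_norm_eq\<close>)
  also have "\<dots> \<longleftrightarrow> ((\<lambda>x. norm (emb 1 s (f x))) \<longlongrightarrow> 0) F"
    using tendsto_mult_left_iff[of "sqrt (2 * pi)" "\<lambda>x. norm (emb 1 s (f x))" 0 F] by simp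
  finally show ?thesis by (simp add: tendsto_norm_zero_iff)
qed

text \<open>Difference quotients of distributions become vector derivatives of curves of sequences.
  The direction to sequences serves decay and uniqueness, the other one existence.\<close>

lemma closed_loop_solution_iff:
  assumes u: "\<And>t. t \<ge> 0 \<Longrightarrow> u t \<in> Hs s"
  shows "closed_loop_solution A g r s u0 u \<longleftrightarrow> u 0 = u0 \<and>
    continuous_on {0..} (\<lambda>t. emb 1 s (u t)) \<and>
    (\<forall>t>0. ((\<lambda>t. emb 1 (s - r) (u t)) has_vector_derivative emb 1 (s - r) (closed_loop_rhs A g (u t))) (at t))"
proof -
  have "((\<lambda>\<tau>. Hs_norm s (u \<tau> - u t)) \<longlongrightarrow> 0) (at t within {0..})
      \<longleftrightarrow> ((\<lambda>\<tau>. emb 1 s (u \<tau>)) \<longlongrightarrow> emb 1 s (u t)) (at t within {0..})" if "t \<ge> 0" for t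
  proof -
    have "\<forall>\<^sub>F \<tau> in at t within {0..}. u \<tau> - u t \<in> Hs s"
      by (auto simp: eventually_at_filter intro!: always_eventually Hs_minus[where R = 1] u that)
    then have "((\<lambda>\<tau>. Hs_norm s (u \<tau> - u t)) \<longlongrightarrow> 0) (at t within {0..})
        \<longleftrightarrow> ((\<lambda>\<tau>. emb 1 s (u \<tau> - u t)) \<longlongrightarrow> 0) (at t within {0..})"
      by (rule Hs_norm_tendsto_0_iff)
    also have "\<dots> \<longleftrightarrow> ((\<lambda>\<tau>. emb 1 s (u \<tau>) - emb 1 s (u t)) \<longlongrightarrow> 0) (at t within {0..})"
      by (rule filterlim_cong) (auto simp: eventually_at_filter emb_minus u that intro!: always_eventually)
    finally show ?thesis by (simp add: LIM_zero_iff)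
  qed
  moreover have "((\<lambda>h. Hs_norm (s - r)
            (dist_scale (of_real (1 / h)) (u (t + h) - u t) - closed_loop_rhs A g (u t))) \<longlongrightarrow> 0) (at 0)
      \<longleftrightarrow> ((\<lambda>t. emb 1 (s - r) (u t)) has_vector_derivative emb 1 (s - r) (closed_loop_rhs A g (u t))) (at t)"
    if "t > 0" for t
  proof -
    \<comment> \<open>For small \<open>h\<close> the time \<open>t + h\<close> is nonnegative, where
      membership in \<open>Hs s\<close> is known.\<close>
    have "\<forall>\<^sub>F h in at 0. h \<in> {- t<..}"
      using that by (intro eventually_at_in_open') auto
    then have ev: "\<forall>\<^sub>F h in at 0. u (t + h) \<in> Hs s"
      by eventually_elim (auto intro: u)
    have ut: "u t \<in> Hs s" using u that by simp
    have "((\<lambda>h. Hs_norm (s - r)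
            (dist_scale (of_real (1 / h)) (u (t + h) - u t) - closed_loop_rhs A g (u t))) \<longlongrightarrow> 0) (at 0)
      \<longleftrightarrow> ((\<lambda>h. emb 1 (s - r)
            (dist_scale (of_real (1 / h)) (u (t + h) - u t) - closed_loop_rhs A g (u t))) \<longlongrightarrow> 0) (at 0)"
    proof (rule Hs_norm_tendsto_0_iff)
      show "\<forall>\<^sub>F h in at 0. dist_scale (of_real (1 / h)) (u (t + h) - u t) - closed_loop_rhs A g (u t) \<in> Hs (s - r)"
        using ev by eventually_elim (rule quotient_Hs[OF _ ut])
    qed
    also have "\<dots> \<longleftrightarrow> ((\<lambda>h. (1 / h) *\<^sub>R (emb 1 (s - r) (u (t + h)) - emb 1 (s - r) (u t))
        - emb 1 (s - r) (closed_loop_rhs A g (u t))) \<longlongrightarrow> 0) (at 0)"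
    proof (rule filterlim_cong[OF refl refl])
      show "\<forall>\<^sub>F h in at 0. emb 1 (s - r) (dist_scale (of_real (1 / h)) (u (t + h) - u t) - closed_loop_rhs A g (u t))
          = (1 / h) *\<^sub>R (emb 1 (s - r) (u (t + h)) - emb 1 (s - r) (u t)) - emb 1 (s - r) (closed_loop_rhs A g (u t))"
        using ev by eventually_elim (rule emb_quotient[OF _ ut])
    qed
    finally show ?thesis by (simp only: has_vector_derivative_iff_quotient)
  qed
  ultimately show ?thesis
    using u by (auto simp: closed_loop_solution_def continuous_on_def closed_loop_rhs_Hs)
qed

text \<open>The derivative is known only in \<open>Hs (s - r)\<close>, but it is read off one mode
  at a time, where the loss of derivatives is a scalar factor. The same holds for the passage to
  another \<open>R\<close>.\<close>

lemma closed_loop_imp_mode_solution: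
  assumes sol: "closed_loop_solution A g r s u0 u" and R: "R \<ge> 1"
  shows "mode_solution (eig a) (feedback R s) (\<lambda>t. emb R s (u t))"
  unfolding mode_solution_def
proof (intro conjI allI impI)
  have u: "u t \<in> Hs s" if "t \<ge> 0" for t using sol that by (simp add: closed_loop_solution_def)
  have S: "continuous_on {0..} (\<lambda>t. emb 1 s (u t))"
    "t > 0 \<Longrightarrow> ((\<lambda>t. emb 1 (s - r) (u t)) has_vector_derivative emb 1 (s - r) (closed_loop_rhs A g (u t))) (at t)" for t
  proof -
    have "continuous_on {0..} (\<lambda>t. emb 1 s (u t)) \<and>
      (\<forall>t>0. ((\<lambda>t. emb 1 (s - r) (u t)) has_vector_derivative emb 1 (s - r) (closed_loop_rhs A g (u t))) (at t))"
      by (rule closed_loop_solution_iff[of u s u0, OF u, THEN iffD1, OF _ sol, THEN conjunct2])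
    then show "continuous_on {0..} (\<lambda>t. emb 1 s (u t))"
      "t > 0 \<Longrightarrow> ((\<lambda>t. emb 1 (s - r) (u t)) has_vector_derivative emb 1 (s - r) (closed_loop_rhs A g (u t))) (at t)" for t
      by simp_all
  qed
  have "continuous_on {0..} (\<lambda>t. dop (reweight R 1 s) (emb 1 s (u t)))"
    by (rule bounded_linear.continuous_on[OF bounded_linear_dop[of "reweight R 1 s", OF norm_reweight_le(1)[OF R]]])
      (rule S(1))
  moreover have "continuous_on {0..} (\<lambda>t. emb R s (u t))
      \<longleftrightarrow> continuous_on {0..} (\<lambda>t. dop (reweight R 1 s) (emb 1 s (u t)))"
    by (rule continuous_on_cong[OF refl]) (intro emb_reweight u R, simp)
  ultimately show "continuous_on {0..} (\<lambda>t. emb R s (u t))" by simp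
  fix t :: real and k assume t: "t > 0"
  have low: "u t \<in> Hs (s - r)" if "t \<ge> 0" for t
    using Hs_mono[OF u[OF that]] r_nonneg by simp
  have w: "complex_of_real (weight 1 (s - r) k) \<noteq> 0" using weight_pos[of 1 "s - r" k] by simp
  \<comment> \<open>At the fixed mode \<open>k\<close>, exchanges the weight of order
    \<open>s - r\<close> for that of \<open>emb R s\<close>.\<close>
  define c where "c = complex_of_real (weight R s k / weight 1 (s - r) k)"
  have c: "c * of_real (weight 1 (s - r) k) = of_real (weight R s k)" using w by (simp add: c_def)
  have "((\<lambda>t. c * coord (emb 1 (s - r) (u t)) k) has_vector_derivative
      c * coord (emb 1 (s - r) (closed_loop_rhs A g (u t))) k) (at t)"
    by (intro bounded_linear.has_vector_derivative[OF bounded_linear_mult_right]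
        bounded_linear.has_vector_derivative[OF bounded_linear_coord] S(2) t)
  also have "c * coord (emb 1 (s - r) (closed_loop_rhs A g (u t))) k
      = of_real (weight R s k) * fourier_coeff (closed_loop_rhs A g (u t)) k"
    using t by (simp add: coord_emb[OF closed_loop_rhs_Hs[OF u]] c flip: mult.assoc)
  also have "\<dots> = \<i> * of_real (eig a k) * coord (emb R s (u t)) k - coord (feedback R s (emb R s (u t))) k"
    using t by (intro fourier_coeff_closed_loop u R) simp
  finally show "((\<lambda>t. coord (emb R s (u t)) k) has_vector_derivative
      \<i> * of_real (eig a k) * coord (emb R s (u t)) k - coord (feedback R s (emb R s (u t))) k) (at t)"
    by (rule has_vector_derivative_transform_within_open[where S = "{0<..}"])
      (use t in \<open>auto simp: coord_emb u low R c simp flip: mult.assoc\<close>)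
qed

text \<open>Existence needs only boundedness of the feedback, so \<open>R = 1\<close>
  suffices.\<close>

lemma closed_loop_solution_exists:
  assumes u0: "u0 \<in> Hs s"
  shows "\<exists>u. closed_loop_solution A g r s u0 u"
proof -
  obtain x where x: "mode_solution (eig a) (feedback 1 s) x" "x 0 = emb 1 s u0"
    using mode_solution_exists[OF bounded_linear_feedback[OF order.refl]] by metis
  define u where "u = (\<lambda>t. synth (\<lambda>k. coord (x t) k / of_real (weight 1 s k)))"
  have u: "u t \<in> Hs s" and ux: "emb 1 s (u t) = x t" for t
    unfolding u_def by (rule synth_emb)+
  have w: "complex_of_real (weight 1 s k) \<noteq> 0" for k using weight_pos[of 1 s k] by simp
  have "u 0 = u0"
  proof (rule pd_eqI[OF Hs_pd[OF u] Hs_pd[OF u0]])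
    show "fourier_coeff (u 0) k = fourier_coeff u0 k" for k
      using coord_emb[OF u order.refl, of 0 k] coord_emb[OF u0 order.refl, of k] w[of k]
      by (simp add: ux x(2))
  qed
  moreover have "((\<lambda>t. emb 1 (s - r) (u t)) has_vector_derivative emb 1 (s - r) (closed_loop_rhs A g (u t))) (at t)"
    if "t > 0" for t
    unfolding emb_closed_loop_rhs[OF u] emb_lower[OF u] ux
    by (rule mode_solution_weak_derivative[OF x(1) bounded_linear_feedback[OF order.refl] loss_le that])
  moreover have "continuous_on {0..} (\<lambda>t. emb 1 s (u t))"
    using x(1) by (simp add: ux mode_solution_def)
  ultimately show ?thesis using closed_loop_solution_iff[of u s u0, OF u] by blast
qed

end

section \<open>Constant functions and the final estimate\<close>

lemma
  assumes "R \<ge> 1"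
  shows const_Hs: "dist_of (\<lambda>_. c) \<in> Hs s"
    and emb_const: "emb R s (dist_of (\<lambda>_. c)) = single 0 (of_real (weight R s 0) * c)"
proof -
  show H: "dist_of (\<lambda>_. c) \<in> Hs s"
    by (rule HsI[where y = "single 0 (of_real (weight 1 s 0) * c)", OF pd_of_closed[OF test_const]])
      (simp add: hat_const)
  show "emb R s (dist_of (\<lambda>_. c)) = single 0 (of_real (weight R s 0) * c)"
    by (rule ell2_eqI) (simp add: coord_emb[OF H assms] hat_const)
qed

theorem theorem1p7:
  fixes A :: "pdist \<Rightarrow> pdist" and a :: "int \<Rightarrow> real" and r :: real and g :: "real \<Rightarrow> real"
  assumes A_multiplier: "linear_fourier_multiplier a A"
    and r_ge_1: "r \<ge> 1"
    and a_growth: "\<exists>(k0::nat) C. C > 0 \<and>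
          (\<forall>k. \<bar>k\<bar> \<ge> int k0 \<longrightarrow> \<bar>a k\<bar> \<le> C * \<bar>real_of_int k\<bar> powr (r - 1))"
    and g_smooth: "(\<lambda>x. complex_of_real (g x)) \<in> \<P>"
    and g_nonneg: "\<forall>x. g x \<ge> 0"
    and g_integral: "integral {0..2 * pi} g = 1"
    and g_support: "\<exists>c d. c < d \<and>
          {x. g x > 0} = (\<Union>n::int. {c + 2 * pi * of_int n <..< d + 2 * pi * of_int n})"
    and eigenfunctions: "\<forall>k. dist_deriv (A (dist_of (psi k)))
          = dist_scale (\<i> * of_real (eig a k)) (dist_of (psi k))"
    and spectral: "condition_I a \<or> condition_II a"
  shows "\<exists>\<alpha>>0. \<forall>s::real. \<exists>M>0. \<forall>u0 \<in> Hs s.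
      (\<exists>u. closed_loop_solution A g r s u0 u) \<and>
      (\<forall>u v. closed_loop_solution A g r s u0 u \<longrightarrow> closed_loop_solution A g r s u0 v
          \<longrightarrow> (\<forall>t\<ge>0. u t = v t)) \<and>
      (\<forall>u. closed_loop_solution A g r s u0 u \<longrightarrow>
         (\<forall>t\<ge>0. Hs_norm s (u t - dist_of (\<lambda>_. fourier_coeff u0 0))
               \<le> M * exp (- \<alpha> * t) * Hs_norm s (u0 - dist_of (\<lambda>_. fourier_coeff u0 0))))"
proof -
  obtain k0 :: nat and C0 where C0: "C0 > 0" "\<And>k. \<bar>k\<bar> \<ge> int k0 \<Longrightarrow> \<bar>a k\<bar> \<le> C0 * \<bar>real_of_int k\<bar> powr (r - 1)"
    using a_growth by blast
  obtain C where C: "C \<ge> 1" "\<And>k. \<bar>eig a k\<bar> * weight 1 (- r) k \<le> C"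
    using eig_growth[OF r_ge_1 C0] by blast
  interpret closed_loop g A a r C
    by unfold_locales (use assms C in auto)
  obtain c d where "c < d" and
    supp: "{x. g x > 0} = (\<Union>n::int. {c + 2 * pi * of_int n <..< d + 2 * pi * of_int n})"
    using g_support by blast
  have pos: "g x \<noteq> 0" if "x \<in> {c<..<d}" for x
  proof -
    have "x \<in> (\<Union>n::int. {c + 2 * pi * of_int n <..< d + 2 * pi * of_int n})"
      using that by (intro UN_I[of 0]) auto
    then have "g x > 0" unfolding supp[symmetric] by simp
    then show ?thesis by simp
  qed
  obtain \<alpha> where \<alpha>: "\<alpha> > 0" and decay: "\<And>s. \<exists>R\<ge>1. \<forall>x t. mode_solution (eig a) (feedback R s) x \<longrightarrow>
       coord (x 0) 0 = 0 \<longrightarrow> t \<ge> 0 \<longrightarrow> norm (x t) \<le> 2 * exp (- \<alpha> * t) * norm (x 0)"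
  proof (rule feedback_decay[OF \<open>c < d\<close> _ spectral])
    show "g x \<noteq> 0" if "x \<in> {c<..<d}" for x using that by (rule pos)
  qed (rule that)
  show ?thesis
  proof (rule exI[of _ \<alpha>], intro conjI \<alpha> allI)
    fix s :: real
    obtain R where R: "R \<ge> 1" and decay: "\<And>x t. mode_solution (eig a) (feedback R s) x \<Longrightarrow>
       coord (x 0) 0 = 0 \<Longrightarrow> t \<ge> 0 \<Longrightarrow> norm (x t) \<le> 2 * exp (- \<alpha> * t) * norm (x 0)"
      using decay[of s] by blast
    \<comment> \<open>Each of the two passages between \<open>emb 1 s\<close> and
      \<open>emb R s\<close> costs this factor, whence the constant
      \<open>2 * p * p\<close>.\<close>
    define p where "p = R powr \<bar>s\<bar>"
    have p: "p > 0" using R by (simp add: p_def)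
    note diff = mode_solution_diff[OF _ _ bounded_linear_feedback[OF R]]
    note mode = closed_loop_imp_mode_solution[OF _ R]
    have HsD: "u t \<in> Hs s" "u 0 = u0" if "closed_loop_solution A g r s u0 u" "t \<ge> 0" for u0 u t
      using that by (simp_all add: closed_loop_solution_def)
    have unique: "u t = v t"
      if u: "closed_loop_solution A g r s u0 u" and v: "closed_loop_solution A g r s u0 v" and t: "t \<ge> 0" for u0 u v t
    proof -
      have "norm (emb R s (u t) - emb R s (v t)) \<le> 2 * exp (- \<alpha> * t) * norm (emb R s (u 0) - emb R s (v 0))"
        using HsD(2)[OF u t] HsD(2)[OF v t] by (intro decay[OF diff[OF mode[OF u] mode[OF v]] _ t]) simp
      then have "emb R s (u t) = emb R s (v t)" using HsD(2)[OF u t] HsD(2)[OF v t] by simp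
      moreover have "complex_of_real (weight R s k) \<noteq> 0" for k using weight_pos[of R s k] R by simp
      ultimately have "fourier_coeff (u t) k = fourier_coeff (v t) k" for k
        using coord_emb[OF HsD(1)[OF u t] R, of k] coord_emb[OF HsD(1)[OF v t] R, of k] by simp
      then show ?thesis by (intro pd_eqI Hs_pd[OF HsD(1)[OF u t]] Hs_pd[OF HsD(1)[OF v t]])
    qed
    have bound: "Hs_norm s (u t - dist_of (\<lambda>_. fourier_coeff u0 0))
         \<le> (2 * p * p) * exp (- \<alpha> * t) * Hs_norm s (u0 - dist_of (\<lambda>_. fourier_coeff u0 0))"
      if u0: "u0 \<in> Hs s" and u: "closed_loop_solution A g r s u0 u" and t: "t \<ge> 0" for u0 u t
    proof -
      define e where "e = dist_of (\<lambda>_. fourier_coeff u0 0)"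
      \<comment> \<open>The mean of \<open>u0\<close> in mode coordinates is a stationary solution;
        subtracting it leaves a solution with vanishing zero mode, as \<open>decay\<close>
        requires.\<close>
      define z where "z = single (0::int) (of_real (weight R s 0) * fourier_coeff u0 0)"
      have e: "e \<in> Hs s" "emb R s e = z" unfolding e_def z_def by (rule const_Hs[OF R] emb_const[OF R])+
      have z: "mode_solution (eig a) (feedback R s) (\<lambda>_. z)"
        unfolding z_def by (rule mode_solution_const) (simp_all add: eig_def feedback_const[OF R])
      note ut = HsD(1)[OF u t]
      note D = Hs_minus[OF ut e(1) R] Hs_minus[OF u0 e(1) R]
      have "norm (emb R s (u t) - z) \<le> 2 * exp (- \<alpha> * t) * norm (emb R s (u 0) - z)"
      proof (rule decay[OF diff[OF mode[OF u] z] _ t])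
        show "coord (emb R s (u 0) - z) 0 = 0"
          using HsD(2)[OF u t] by (simp add: coord_emb[OF u0 R] z_def)
      qed
      then have main: "norm (emb R s (u t - e)) \<le> 2 * exp (- \<alpha> * t) * norm (emb R s (u0 - e))"
        using HsD(2)[OF u t] by (simp add: emb_minus[OF ut e(1) R] emb_minus[OF u0 e(1) R] e(2))
      have "norm (emb 1 s (u t - e)) \<le> p * norm (emb R s (u t - e))"
        unfolding p_def by (rule norm_emb_le(2)[OF D(1) R])
      also have "\<dots> \<le> p * (2 * exp (- \<alpha> * t) * norm (emb R s (u0 - e)))"
        using p by (intro mult_left_mono main) auto
      also have "\<dots> \<le> p * (2 * exp (- \<alpha> * t) * (p * norm (emb 1 s (u0 - e))))"
        unfolding p_def by (intro mult_left_mono norm_emb_le(1)[OF D(2) R]) auto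
      finally have "sqrt (2 * pi) * norm (emb 1 s (u t - e))
          \<le> sqrt (2 * pi) * ((2 * p * p) * exp (- \<alpha> * t) * norm (emb 1 s (u0 - e)))"
        by (intro mult_left_mono) (simp_all add: mult_ac)
      then show ?thesis
        by (simp add: Hs_norm_eq[OF D(1)] Hs_norm_eq[OF D(2)] mult_ac flip: e_def)
    qed
    show "\<exists>M>0. \<forall>u0 \<in> Hs s.
      (\<exists>u. closed_loop_solution A g r s u0 u) \<and>
      (\<forall>u v. closed_loop_solution A g r s u0 u \<longrightarrow> closed_loop_solution A g r s u0 v
          \<longrightarrow> (\<forall>t\<ge>0. u t = v t)) \<and>
      (\<forall>u. closed_loop_solution A g r s u0 u \<longrightarrow>
         (\<forall>t\<ge>0. Hs_norm s (u t - dist_of (\<lambda>_. fourier_coeff u0 0))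
               \<le> M * exp (- \<alpha> * t) * Hs_norm s (u0 - dist_of (\<lambda>_. fourier_coeff u0 0))))"
    proof (rule exI[of _ "2 * p * p"], intro conjI ballI allI impI)
      show "2 * p * p > 0" using p by simp
    qed (rule closed_loop_solution_exists unique bound; assumption)+
  qed
qed

end
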